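(* Assume $\mu\in\mathcal M(\Omega)$ is a diffuse measure. Then there exist $f\in L^1(\Omega)$ and $v\in C_0(\overline\Omega)\cap H_0^1(\Omega)$ such that $$\int_\Omega\zeta\,d\mu=\int_\Omega f\zeta-\int_\Omega\nabla v\cdot\nabla\zeta\qquad\forall\zeta\in C_0(\overline\Omega)\cap H_0^1(\Omega).$$ In addition, given any $\delta>0$, $f$ and $v$ can be chosen so that $$\|f\|_{L^1}\le\|\mu\|_{\mathcal M},\qquad \|v\|_{L^\infty}\le\delta\|\mu\|_{\mathcal M}\qquad\text{and}\qquad\|v\|_{H^1}\le\delta^{1/2}\|\mu\|_{\mathcal M}.$$
   Context: $\Omega\subset\mathbb R^N$ is a bounded domain with smooth boundary. $C_0(\overline\Omega)$ is the set of $\zeta\in C(\overline\Omega)$ with $\zeta=0$ on $\partial\Omega$. $\mathcal M(\Omega)$ is the space of finite signed Borel measures on $\Omega$, identified with the dual of $C_0(\overline\Omega)$, with the total variation norm $\|\mu\|_{\mathcal M}$. "cap" is the Newtonian ($H^1$) capacity with respect to $\Omega$: for compact $K\subset\Omega$ it is $\inf\{\int_\Omega|\nabla\varphi|^2:\varphi\in C_c^\infty(\Omega),\ \varphi\ge1\text{ in a neighborhood of }K\}$, extended to open and then arbitrary sets in the usual way. $\mu\in\mathcal M(\Omega)$ is diffuse if $|\mu|(A)=0$ for every Borel set $A\subset\Omega$ with $\operatorname{cap}(A)=0$. *)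

theory Defs
  imports "HOL-Analysis.Analysis" "HOL-Probability.Essential_Supremum"
begin

primrec Ck_on :: "nat \<Rightarrow> 'a::euclidean_space set \<Rightarrow> ('a \<Rightarrow> real) \<Rightarrow> bool" where
  "Ck_on 0 U f \<longleftrightarrow> continuous_on U f"
| "Ck_on (Suc k) U f \<longleftrightarrow> (\<forall>x\<in>U. f differentiable (at x)) \<and>
     (\<forall>i\<in>Basis. Ck_on k U (\<lambda>x. frechet_derivative f (at x) i))"

definition smooth_on :: "'a::euclidean_space set \<Rightarrow> ('a \<Rightarrow> real) \<Rightarrow> bool" where
  "smooth_on U f \<longleftrightarrow> (\<forall>k. Ck_on k U f)"

text \<open>
  Near each boundary point the domain lies strictly on one side of a smooth graph, in the
  direction of a unit vector \<open>e\<close>. The graph function \<open>\<gamma>\<close> is only evaluated on the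
  hyperplane orthogonal to \<open>e\<close>; smooth functions on that hyperplane and restrictions to it of
  smooth functions on the whole space are the same thing.
\<close>

definition smooth_boundary :: "'a::euclidean_space set \<Rightarrow> bool" where
  "smooth_boundary \<Omega> \<longleftrightarrow> (\<forall>p\<in>frontier \<Omega>. \<exists>r>0. \<exists>e \<gamma>. norm e = 1 \<and> smooth_on UNIV \<gamma> \<and>
     \<Omega> \<inter> ball p r = {x \<in> ball p r. \<gamma> (x - (x \<bullet> e) *\<^sub>R e) < x \<bullet> e})"

definition smooth_bounded_domain :: "'a::euclidean_space set \<Rightarrow> bool" where
  "smooth_bounded_domain \<Omega> \<longleftrightarrow>
     open \<Omega> \<and> connected \<Omega> \<and> \<Omega> \<noteq> {} \<and> bounded \<Omega> \<and> smooth_boundary \<Omega>"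

text \<open>
  Functions on \<open>\<Omega>\<close> or its closure are represented by functions on the whole space, whose
  values elsewhere are irrelevant; only for \<open>Cc_infinity\<close> do we fix the extension by zero.
\<close>

definition Cc_infinity :: "'a::euclidean_space set \<Rightarrow> ('a \<Rightarrow> real) set" where
  "Cc_infinity \<Omega> =
     {\<phi>. smooth_on UNIV \<phi> \<and> compact (closure {x. \<phi> x \<noteq> 0}) \<and> closure {x. \<phi> x \<noteq> 0} \<subseteq> \<Omega>}"

definition C_0 :: "'a::euclidean_space set \<Rightarrow> ('a \<Rightarrow> real) set" where
  "C_0 \<Omega> = {\<zeta>. continuous_on (closure \<Omega>) \<zeta> \<and> (\<forall>x\<in>frontier \<Omega>. \<zeta> x = 0)}"

definition grad :: "('a::euclidean_space \<Rightarrow> real) \<Rightarrow> 'a \<Rightarrow> 'a" where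
  "grad \<phi> x = (\<Sum>i\<in>Basis. frechet_derivative \<phi> (at x) i *\<^sub>R i)"

definition L1_on :: "'a::euclidean_space set \<Rightarrow> ('a \<Rightarrow> real) set" where
  "L1_on \<Omega> = {f. integrable (lebesgue_on \<Omega>) f}"

definition L1_norm :: "'a::euclidean_space set \<Rightarrow> ('a \<Rightarrow> real) \<Rightarrow> real" where
  "L1_norm \<Omega> f = (LINT x|lebesgue_on \<Omega>. \<bar>f x\<bar>)"

definition Linfty_norm :: "'a::euclidean_space set \<Rightarrow> ('a \<Rightarrow> real) \<Rightarrow> ereal" where
  "Linfty_norm \<Omega> f = esssup (lebesgue_on \<Omega>) (\<lambda>x. ereal \<bar>f x\<bar>)"

definition L2_on :: "'a::euclidean_space set \<Rightarrow> ('a \<Rightarrow> 'b::euclidean_space) set" where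
  "L2_on \<Omega> = {u. u \<in> borel_measurable (lebesgue_on \<Omega>) \<and>
                  integrable (lebesgue_on \<Omega>) (\<lambda>x. (norm (u x))\<^sup>2)}"

definition locally_integrable_on ::
    "'a::euclidean_space set \<Rightarrow> ('a \<Rightarrow> 'b::euclidean_space) \<Rightarrow> bool" where
  "locally_integrable_on \<Omega> u \<longleftrightarrow> (\<forall>K. compact K \<and> K \<subseteq> \<Omega> \<longrightarrow> integrable (lebesgue_on K) u)"

definition has_weak_gradient ::
    "'a::euclidean_space set \<Rightarrow> ('a \<Rightarrow> real) \<Rightarrow> ('a \<Rightarrow> 'a) \<Rightarrow> bool" where
  "has_weak_gradient \<Omega> u G \<longleftrightarrow> locally_integrable_on \<Omega> u \<and> locally_integrable_on \<Omega> G \<and>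
     (\<forall>\<phi>\<in>Cc_infinity \<Omega>. \<forall>i\<in>Basis.
        (LINT x|lebesgue_on \<Omega>. u x * (grad \<phi> x \<bullet> i)) = - (LINT x|lebesgue_on \<Omega>. (G x \<bullet> i) * \<phi> x))"

text \<open>Weak gradients are unique only up to null sets; \<open>weak_grad\<close> picks a representative.\<close>

definition weak_grad :: "'a::euclidean_space set \<Rightarrow> ('a \<Rightarrow> real) \<Rightarrow> 'a \<Rightarrow> 'a" where
  "weak_grad \<Omega> u = (SOME G. has_weak_gradient \<Omega> u G)"

definition H1 :: "'a::euclidean_space set \<Rightarrow> ('a \<Rightarrow> real) set" where
  "H1 \<Omega> = {u. u \<in> L2_on \<Omega> \<and> (\<exists>G. has_weak_gradient \<Omega> u G \<and> G \<in> L2_on \<Omega>)}"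

definition H1_norm :: "'a::euclidean_space set \<Rightarrow> ('a \<Rightarrow> real) \<Rightarrow> real" where
  "H1_norm \<Omega> u = sqrt ((LINT x|lebesgue_on \<Omega>. (u x)\<^sup>2)
                      + (LINT x|lebesgue_on \<Omega>. (norm (weak_grad \<Omega> u x))\<^sup>2))"

definition H1_0 :: "'a::euclidean_space set \<Rightarrow> ('a \<Rightarrow> real) set" where
  "H1_0 \<Omega> = {u \<in> H1 \<Omega>. \<exists>\<phi> :: nat \<Rightarrow> 'a \<Rightarrow> real. range \<phi> \<subseteq> Cc_infinity \<Omega> \<and>
                  (\<lambda>n. H1_norm \<Omega> (\<lambda>x. \<phi> n x - u x)) \<longlonglongrightarrow> 0}"

text \<open>
  A finite signed measure on the measurable space \<open>M\<close> is a countably additive real-valued set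
  function; of \<open>M\<close> only the carrier and the sigma-algebra matter. The total variation measure
  and the positive variation (the positive part of the Jordan decomposition) are given by the
  usual suprema, and the integral is taken against the Jordan decomposition.
\<close>

definition finite_signed_measure :: "'a measure \<Rightarrow> ('a set \<Rightarrow> real) \<Rightarrow> bool" where
  "finite_signed_measure M \<mu> \<longleftrightarrow> \<mu> {} = 0 \<and>
     (\<forall>A :: nat \<Rightarrow> 'a set. range A \<subseteq> sets M \<and> disjoint_family A \<longrightarrow>
        (\<lambda>n. \<mu> (A n)) sums \<mu> (\<Union>n. A n))"

definition total_variation :: "'a measure \<Rightarrow> ('a set \<Rightarrow> real) \<Rightarrow> 'a measure" where
  "total_variation M \<mu> = measure_of (space M) (sets M)
     (\<lambda>A. SUP P \<in> {P :: nat \<Rightarrow> 'a set. range P \<subseteq> sets M \<and> disjoint_family P \<and> (\<Union>n. P n) = A}.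
            \<Sum>n. ennreal \<bar>\<mu> (P n)\<bar>)"

definition positive_variation :: "'a measure \<Rightarrow> ('a set \<Rightarrow> real) \<Rightarrow> 'a measure" where
  "positive_variation M \<mu> = measure_of (space M) (sets M)
     (\<lambda>A. SUP B \<in> {B \<in> sets M. B \<subseteq> A}. ennreal (\<mu> B))"

definition negative_variation :: "'a measure \<Rightarrow> ('a set \<Rightarrow> real) \<Rightarrow> 'a measure" where
  "negative_variation M \<mu> = positive_variation M (\<lambda>A. - \<mu> A)"

definition signed_integral :: "'a measure \<Rightarrow> ('a set \<Rightarrow> real) \<Rightarrow> ('a \<Rightarrow> real) \<Rightarrow> real" where
  "signed_integral M \<mu> f =
     (LINT x|positive_variation M \<mu>. f x) - (LINT x|negative_variation M \<mu>. f x)"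

abbreviation borel_on :: "'a::euclidean_space set \<Rightarrow> 'a measure" where
  "borel_on \<Omega> \<equiv> restrict_space borel \<Omega>"

definition signed_measures :: "'a::euclidean_space set \<Rightarrow> ('a set \<Rightarrow> real) set" where
  "signed_measures \<Omega> = {\<mu>. finite_signed_measure (borel_on \<Omega>) \<mu>}"

definition TV_norm :: "'a::euclidean_space set \<Rightarrow> ('a set \<Rightarrow> real) \<Rightarrow> real" where
  "TV_norm \<Omega> \<mu> = measure (total_variation (borel_on \<Omega>) \<mu>) \<Omega>"

definition cap_compact :: "'a::euclidean_space set \<Rightarrow> 'a set \<Rightarrow> ennreal" where
  "cap_compact \<Omega> K =
     (INF \<phi> \<in> {\<phi> \<in> Cc_infinity \<Omega>. \<exists>U. open U \<and> K \<subseteq> U \<and> (\<forall>x\<in>U. 1 \<le> \<phi> x)}.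
        \<integral>\<^sup>+ x. ennreal ((norm (grad \<phi> x))\<^sup>2) \<partial>lebesgue_on \<Omega>)"

definition cap_open :: "'a::euclidean_space set \<Rightarrow> 'a set \<Rightarrow> ennreal" where
  "cap_open \<Omega> U = (SUP K \<in> {K. compact K \<and> K \<subseteq> U}. cap_compact \<Omega> K)"

definition cap :: "'a::euclidean_space set \<Rightarrow> 'a set \<Rightarrow> ennreal" where
  "cap \<Omega> A = (INF U \<in> {U. open U \<and> A \<subseteq> U \<and> U \<subseteq> \<Omega>}. cap_open \<Omega> U)"

definition diffuse :: "'a::euclidean_space set \<Rightarrow> ('a set \<Rightarrow> real) \<Rightarrow> bool" where
  "diffuse \<Omega> \<mu> \<longleftrightarrow> (\<forall>A. A \<in> sets borel \<and> A \<subseteq> \<Omega> \<and> cap \<Omega> A = 0 \<longrightarrow>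
     emeasure (total_variation (borel_on \<Omega>) \<mu>) A = 0)"

text \<open>\<open>\<mu> = f + \<Delta>v\<close>, tested against continuous functions in \<open>H1_0\<close> vanishing on the boundary.\<close>

definition represents ::
    "'a::euclidean_space set \<Rightarrow> ('a set \<Rightarrow> real) \<Rightarrow> ('a \<Rightarrow> real) \<Rightarrow> ('a \<Rightarrow> real) \<Rightarrow> bool" where
  "represents \<Omega> \<mu> f v \<longleftrightarrow> (\<forall>\<zeta> \<in> C_0 \<Omega> \<inter> H1_0 \<Omega>.
     signed_integral (borel_on \<Omega>) \<mu> \<zeta> =
       (LINT x|lebesgue_on \<Omega>. f x * \<zeta> x)
       - (LINT x|lebesgue_on \<Omega>. weak_grad \<Omega> v x \<bullet> weak_grad \<Omega> \<zeta> x))"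

end

theory Submission
  imports Defs
begin

text \<open>
  Let \<open>mollifier s\<close> be a radial mollifier at scale \<open>s\<close>. Differentiating in \<open>s\<close> shows that
  \<open>mollifier s - mollifier r\<close> is minus the Laplacian of a nonnegative kernel \<open>potential_kernel s r\<close>
  supported in the ball of radius \<open>r\<close>. Hence, if the potentials of a finite measure \<open>\<nu>\<close>, truncated
  at distance \<open>r\<close>, tend to zero uniformly as \<open>r\<close> tends to zero, then \<open>\<nu>\<close> differs from its
  mollification at a small scale by the Laplacian of a function that is uniformly small, has support
  near that of \<open>\<nu>\<close> and, because its energy is at most the sup norm times the mass, is small in
  \<open>H1\<close>. The set where the potential of a measure is infinite has capacity zero, so the potential
  of a diffuse measure is finite almost everywhere; by Egorov's theorem and the maximum principle,
  almost all of the measure is carried by an increasing sequence of compact sets on which the truncated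
  potentials do tend to zero uniformly. Then \<open>f\<close> is a mollification with a scale depending on the
  position in this exhaustion.
\<close>

section \<open>Smooth functions\<close>

text \<open>The truncated kernel is an integral over scales, not a cut-off of the fundamental
  solution: the derivative of \<open>mollifier \<sigma>\<close> in \<sigma> is
  \<open>inverse \<sigma> ^ (DIM('a) + 1)\<close> times a rescaled \<open>laplacian bump\<close>.
  The formula is the same in every dimension, and over scales bounded away from zero it yields
  smooth functions of compact support. So all approximations of \<open>v\<close> are test functions,
  and membership in \<open>H1_0\<close> comes by construction. The energy of such a potential
  \<open>w\<close> is found by pairing \<open>w\<close> with its own equation: the Laplacian is a
  difference of two mollified measures, so the energy is at most twice the sup norm of
  \<open>w\<close> times the mass. This is why the \<open>H1\<close> bound carries the square root
  of \<delta>, and why the sup norms must decay so fast that their square roots are summable. The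
  obstacle is that a diffuse measure may have no scale at which all its truncated potentials are
  small. Compact pieces have one, but it may shrink along the exhaustion. Letting the scale depend
  on the point costs nothing in \<open>L1\<close>, since every kernel has integral one; hence the
  constant one in the bound for \<open>f\<close>.\<close>

lemma Ck_on_SucI:
  assumes "\<And>x. (f has_derivative D x) (at x)"
    and "\<And>i. i \<in> Basis \<Longrightarrow> Ck_on k UNIV (\<lambda>x. D x i)"
  shows "Ck_on (Suc k) UNIV f"
proof -
  have "frechet_derivative f (at x) = D x" for x
    using assms(1) by (metis frechet_derivative_at)
  then show ?thesis
    using assms by (auto simp: differentiable_def)
qed

lemma Ck_on_SucD:
  assumes "Ck_on (Suc k) UNIV f"
  shows "(f has_derivative frechet_derivative f (at x)) (at x)"
    and "i \<in> Basis \<Longrightarrow> Ck_on k UNIV (\<lambda>x. frechet_derivative f (at x) i)"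
  using assms by (auto simp: frechet_derivative_works)

lemma Ck_on_Suc_imp: "Ck_on (Suc k) UNIV f \<Longrightarrow> Ck_on k UNIV f"
proof (induction k arbitrary: f)
  case 0
  then show ?case
    by (simp add: differentiable_imp_continuous_on differentiable_on_def)
next
  case (Suc k)
  show ?case
    by (rule Ck_on_SucI[OF Ck_on_SucD(1)[OF Suc.prems]])
      (intro Suc.IH Ck_on_SucD(2)[OF Suc.prems])
qed

lemma Ck_on_const: "Ck_on k UNIV (\<lambda>x. c)"
proof (induction k arbitrary: c)
  case (Suc k)
  show ?case
    by (rule Ck_on_SucI[where D="\<lambda>_ _. 0"]) (use Suc in auto)
qed auto

lemma Ck_on_add: "Ck_on k UNIV f \<Longrightarrow> Ck_on k UNIV g \<Longrightarrow> Ck_on k UNIV (\<lambda>x. f x + g x)"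
proof (induction k arbitrary: f g)
  case (Suc k)
  show ?case
    by (rule Ck_on_SucI[OF has_derivative_add[OF Ck_on_SucD(1)[OF Suc.prems(1)]
            Ck_on_SucD(1)[OF Suc.prems(2)]]])
      (intro Suc.IH Ck_on_SucD(2)[OF Suc.prems(1)] Ck_on_SucD(2)[OF Suc.prems(2)])
qed (auto intro: continuous_intros)

lemma Ck_on_mult: "Ck_on k UNIV f \<Longrightarrow> Ck_on k UNIV g \<Longrightarrow> Ck_on k UNIV (\<lambda>x. f x * g x)"
proof (induction k arbitrary: f g)
  case (Suc k)
  show ?case
    by (rule Ck_on_SucI[OF has_derivative_mult[OF Ck_on_SucD(1)[OF Suc.prems(1)]
            Ck_on_SucD(1)[OF Suc.prems(2)]]])
      (intro Ck_on_add Suc.IH Ck_on_SucD(2)[OF Suc.prems(1)] Ck_on_SucD(2)[OF Suc.prems(2)]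
        Ck_on_Suc_imp[OF Suc.prems(1)] Ck_on_Suc_imp[OF Suc.prems(2)])
qed (auto intro: continuous_intros)

text \<open>The whole tower of derivatives is a parameter of the induction: differentiating
  \<open>g n (u x)\<close> produces \<open>g (Suc n) (u x)\<close>, so the claim is needed for all
  \<open>n\<close> at once. It is applied to \<open>smooth_step\<close> and to an exponential family
  in the capacity estimate.\<close>

lemma Ck_on_compose:
  fixes g :: "nat \<Rightarrow> real \<Rightarrow> real"
  assumes "\<And>n t. (g n has_real_derivative g (Suc n) t) (at t)"
  shows "Ck_on k UNIV u \<Longrightarrow> Ck_on k UNIV (\<lambda>x. g n (u x))"
proof (induction k arbitrary: n)
  case 0
  have "continuous_on UNIV (g n)"
    using assms[of n] by (intro continuous_at_imp_continuous_on) (auto intro: DERIV_isCont)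
  with 0 show ?case
    by (auto intro: continuous_on_compose2)
next
  case (Suc k)
  have "((\<lambda>x. g n (u x)) has_derivative
      (\<lambda>h. frechet_derivative u (at x) h * g (Suc n) (u x))) (at x)" for x
    by (rule DERIV_compose_FDERIV[OF assms Ck_on_SucD(1)[OF Suc.prems]])
  then show ?case
    by (rule Ck_on_SucI)
      (intro Ck_on_mult Ck_on_SucD(2)[OF Suc.prems] Suc.IH Ck_on_Suc_imp[OF Suc.prems])
qed

lemma Ck_on_inner: "Ck_on k UNIV (\<lambda>x. x \<bullet> c)"
proof (cases k)
  case (Suc m)
  have "((\<lambda>x. x \<bullet> c) has_derivative (\<lambda>h. h \<bullet> c)) (at x)" for x
    by (auto intro!: derivative_eq_intros)
  then show ?thesis
    unfolding Suc by (rule Ck_on_SucI) (rule Ck_on_const)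
qed (auto intro!: continuous_intros)

lemma Ck_on_sum: "finite I \<Longrightarrow> (\<And>i. i \<in> I \<Longrightarrow> Ck_on k UNIV (f i)) \<Longrightarrow> Ck_on k UNIV (\<lambda>x. \<Sum>i\<in>I. f i x)"
  by (induction I rule: finite_induct) (auto intro!: Ck_on_const Ck_on_add)

lemma Ck_on_inner_self: "Ck_on k UNIV (\<lambda>x::'a::euclidean_space. x \<bullet> x)"
  by (subst euclidean_inner) (intro Ck_on_sum Ck_on_mult Ck_on_inner finite_Basis)

section \<open>A smooth step function\<close>

text \<open>The \<open>n\<close>-th derivative of \<open>exp (- 1 / t)\<close> for \<open>t > 0\<close> is \<open>poly (step_poly n) (1 / t) * exp (- 1 / t)\<close>.\<close>

primrec step_poly :: "nat \<Rightarrow> real poly" where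
  "step_poly 0 = 1"
| "step_poly (Suc n) = [:0, 0, 1:] * (step_poly n - pderiv (step_poly n))"

definition smooth_step :: "nat \<Rightarrow> real \<Rightarrow> real" where
  "smooth_step n t = (if t > 0 then poly (step_poly n) (1 / t) * exp (- 1 / t) else 0)"

lemma poly_times_exp_minus_tendsto_0: "((\<lambda>s::real. poly p s * exp (- s)) \<longlongrightarrow> 0) at_top"
proof -
  have "((\<lambda>s::real. \<Sum>i\<le>degree p. coeff p i * (s ^ i / exp s)) \<longlongrightarrow> (\<Sum>i\<le>degree p. coeff p i * 0)) at_top"
    by (intro tendsto_sum tendsto_mult tendsto_const tendsto_power_div_exp_0)
  then show ?thesis
    by (simp add: poly_altdef sum_distrib_right exp_minus divide_inverse mult.assoc)
qed

lemma smooth_step_has_derivative: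
  "(smooth_step n has_real_derivative smooth_step (Suc n) t) (at t)"
proof -
  consider "t > 0" | "t < 0" | "t = 0" by linarith
  then show ?thesis
  proof cases
    case 1
    have inv: "((\<lambda>t. 1 / t) has_real_derivative - (1 / t\<^sup>2)) (at t)"
      using 1 by (auto intro!: derivative_eq_intros simp: power2_eq_square)
    have exp: "((\<lambda>t. exp (- (1 / t))) has_real_derivative exp (- (1 / t)) * (1 / t\<^sup>2)) (at t)"
      using DERIV_fun_exp[OF DERIV_minus[OF inv]] by simp
    have "smooth_step (Suc n) t = poly (pderiv (step_poly n)) (1 / t) * - (1 / t\<^sup>2) * exp (- (1 / t))
        + exp (- (1 / t)) * (1 / t\<^sup>2) * poly (step_poly n) (1 / t)"
      using 1 by (simp add: smooth_step_def power2_eq_square algebra_simps)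
    moreover have "((\<lambda>t. poly (step_poly n) (1 / t)) has_real_derivative
        poly (pderiv (step_poly n)) (1 / t) * - (1 / t\<^sup>2)) (at t)"
      by (rule DERIV_chain2[where f="poly (step_poly n)" and g="\<lambda>t. 1 / t", OF poly_DERIV inv])
    note DERIV_mult[OF this exp]
    ultimately
    have "((\<lambda>t. poly (step_poly n) (1 / t) * exp (- 1 / t)) has_real_derivative smooth_step (Suc n) t) (at t)"
      by simp
    moreover have "\<forall>\<^sub>F x in nhds t. x > 0"
      by (rule order_tendstoD(1)[OF filterlim_ident 1])
    moreover from this have "\<forall>\<^sub>F x in nhds t. smooth_step n x = poly (step_poly n) (1 / x) * exp (- 1 / x)"
      by (rule eventually_mono) (simp add: smooth_step_def)
    ultimately show ?thesis
      by (simp add: DERIV_cong_ev)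
  next
    case 2
    have "\<forall>\<^sub>F x in nhds t. x < 0"
      by (rule order_tendstoD(2)[OF filterlim_ident 2])
    then have "\<forall>\<^sub>F x in nhds t. smooth_step n x = 0"
      by (rule eventually_mono) (simp add: smooth_step_def)
    moreover have "smooth_step (Suc n) t = 0"
      using 2 by (simp add: smooth_step_def)
    ultimately show ?thesis
      by (simp add: DERIV_cong_ev[where g="\<lambda>_. 0"])
  next
    case 3
    have "((\<lambda>h. smooth_step n h / h) \<longlongrightarrow> 0) (at 0)"
    proof (rule filterlim_split_at)
      show "((\<lambda>h. smooth_step n h / h) \<longlongrightarrow> 0) (at_left 0)"
        by (rule tendsto_eventually) (simp add: smooth_step_def eventually_at_filter)
      \<comment> \<open>Dividing by \<open>h\<close> is the factor \<open>[:0, 1:]\<close> evaluated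
        at \<open>inverse h\<close>, so the right-hand quotient is again a polynomial times a
        decaying exponential in \<open>inverse h\<close>.\<close>
      have "((\<lambda>h. poly (step_poly n * [:0, 1:]) (inverse h) * exp (- inverse h)) \<longlongrightarrow> 0) (at_right (0::real))"
        by (rule filterlim_compose[OF poly_times_exp_minus_tendsto_0 filterlim_inverse_at_top_right])
      then show "((\<lambda>h. smooth_step n h / h) \<longlongrightarrow> 0) (at_right 0)"
        by (rule Lim_transform_eventually)
          (simp add: smooth_step_def eventually_at_filter divide_inverse)
    qed
    then show ?thesis
      using 3 by (simp add: DERIV_def smooth_step_def)
  qed
qed

lemma smooth_step_0_nonneg: "smooth_step 0 t \<ge> 0"
  by (simp add: smooth_step_def)

lemma smooth_step_1: "smooth_step (Suc 0) t = (if t > 0 then exp (- 1 / t) / t\<^sup>2 else 0)"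
  by (simp add: smooth_step_def power2_eq_square)

lemma smooth_step_1_nonneg: "smooth_step (Suc 0) t \<ge> 0"
  by (simp add: smooth_step_def)

lemma smooth_step_0_mono: "t \<le> u \<Longrightarrow> smooth_step 0 t \<le> smooth_step 0 u"
  by (rule DERIV_nonneg_imp_nondecreasing) (blast intro: smooth_step_has_derivative smooth_step_1_nonneg)+

lemma smooth_step_nonpos [simp]: "t \<le> 0 \<Longrightarrow> smooth_step n t = 0"
  by (simp add: smooth_step_def)

lemma Ck_on_smooth_step_compose: "Ck_on k UNIV u \<Longrightarrow> Ck_on k UNIV (\<lambda>x. smooth_step n (u x))"
  by (rule Ck_on_compose[where g=smooth_step, OF smooth_step_has_derivative])

section \<open>Test functions\<close>

lemma Cc_infinityI:
  assumes "\<And>k. Ck_on k UNIV \<phi>" "compact K" "K \<subseteq> \<Omega>" "\<And>x. x \<notin> K \<Longrightarrow> \<phi> x = 0"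
  shows "\<phi> \<in> Cc_infinity \<Omega>"
proof -
  have "closure {x. \<phi> x \<noteq> 0} \<subseteq> K"
    using assms(2,4) by (intro closure_minimal) (auto simp: compact_imp_closed)
  moreover from this have "compact (closure {x. \<phi> x \<noteq> 0})"
    using assms(2) closed_closure compact_Int_closed[of K "closure {x. \<phi> x \<noteq> 0}"]
    by (simp add: inf.absorb2)
  ultimately show ?thesis
    using assms(1,3) by (auto simp: Cc_infinity_def smooth_on_def)
qed

lemma Cc_infinity_mono: "\<phi> \<in> Cc_infinity \<Omega> \<Longrightarrow> \<Omega> \<subseteq> \<Omega>' \<Longrightarrow> \<phi> \<in> Cc_infinity \<Omega>'"
  by (auto simp: Cc_infinity_def)

lemma Cc_infinity_Ck: "\<phi> \<in> Cc_infinity \<Omega> \<Longrightarrow> Ck_on k UNIV \<phi>"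
  by (simp add: Cc_infinity_def smooth_on_def)

text \<open>The closed support has an open complement, on which the derivative vanishes together
  with the function. This passes compact support on to partial derivatives.\<close>

lemma Cc_infinity_support:
  assumes "\<phi> \<in> Cc_infinity \<Omega>"
  obtains K where "compact K" "K \<subseteq> \<Omega>" "\<And>x. x \<notin> K \<Longrightarrow> \<phi> x = 0"
    "\<And>x. x \<notin> K \<Longrightarrow> frechet_derivative \<phi> (at x) = (\<lambda>_. 0)"
proof
  let ?K = "closure {x. \<phi> x \<noteq> 0}"
  show "compact ?K" "?K \<subseteq> \<Omega>"
    using assms unfolding Cc_infinity_def by blast+
  show 0: "\<phi> x = 0" if "x \<notin> ?K" for x
    using that subsetD[OF closure_subset[of "{x. \<phi> x \<noteq> 0}"], of x] by auto
  show "frechet_derivative \<phi> (at x) = (\<lambda>_. 0)" if "x \<notin> ?K" for x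
  proof -
    have "(\<phi> has_derivative (\<lambda>_. 0)) (at x)"
    proof (rule has_derivative_transform_within_open)
      show "((\<lambda>_. 0) has_derivative (\<lambda>_. 0)) (at x)" by (rule has_derivative_const)
      show "open (- ?K)" by (rule open_Compl[OF closed_closure])
      show "x \<in> - ?K" using that by simp
      show "0 = \<phi> y" if "y \<in> - ?K" for y using 0[of y] that by simp
    qed
    then show ?thesis
      by (rule frechet_derivative_at[symmetric])
  qed
qed

lemma Cc_infinity_has_derivative:
  "\<phi> \<in> Cc_infinity \<Omega> \<Longrightarrow> (\<phi> has_derivative frechet_derivative \<phi> (at x)) (at x)"
  using Ck_on_SucD(1) Cc_infinity_Ck by blast

lemma Cc_infinity_partial:
  assumes "\<phi> \<in> Cc_infinity \<Omega>" "i \<in> Basis"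
  shows "(\<lambda>x. frechet_derivative \<phi> (at x) i) \<in> Cc_infinity \<Omega>"
proof -
  obtain K where "compact K" "K \<subseteq> \<Omega>" "\<And>x. x \<notin> K \<Longrightarrow> frechet_derivative \<phi> (at x) = (\<lambda>_. 0)"
    using assms(1) by (rule Cc_infinity_support) blast
  then show ?thesis
    using Ck_on_SucD(2)[OF Cc_infinity_Ck[OF assms(1)] assms(2)]
    by (intro Cc_infinityI[of _ K]) auto
qed

lemma grad_inner_Basis: "i \<in> Basis \<Longrightarrow> grad \<phi> x \<bullet> i = frechet_derivative \<phi> (at x) i"
  unfolding grad_def by (simp add: inner_sum_left inner_Basis if_distrib cong: if_cong)

lemma Cc_infinity_derivative_eq:
  assumes "\<phi> \<in> Cc_infinity \<Omega>"
  shows "frechet_derivative \<phi> (at x) = (\<lambda>h. h \<bullet> grad \<phi> x)"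
proof
  fix h
  have "linear (frechet_derivative \<phi> (at x))"
    using Cc_infinity_has_derivative[OF assms] has_derivative_linear by blast
  then have "frechet_derivative \<phi> (at x) (\<Sum>i\<in>Basis. (h \<bullet> i) *\<^sub>R i)
      = (\<Sum>i\<in>Basis. (h \<bullet> i) * frechet_derivative \<phi> (at x) i)"
    by (simp add: linear_sum linear_cmul)
  then show "frechet_derivative \<phi> (at x) h = h \<bullet> grad \<phi> x"
    unfolding euclidean_inner[of h "grad \<phi> x"] euclidean_representation
    by (simp add: grad_inner_Basis)
qed

lemma Cc_infinity_continuous: "\<phi> \<in> Cc_infinity \<Omega> \<Longrightarrow> continuous_on UNIV \<phi>"
  using Cc_infinity_Ck[of \<phi> \<Omega> 0] by simp

lemma Cc_infinity_borel: "\<phi> \<in> Cc_infinity \<Omega> \<Longrightarrow> \<phi> \<in> borel_measurable borel"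
  by (intro borel_measurable_continuous_onI Cc_infinity_continuous)

lemma grad_continuous:
  assumes "\<phi> \<in> Cc_infinity \<Omega>"
  shows "continuous_on UNIV (grad \<phi>)"
  unfolding grad_def
  by (intro continuous_on_sum continuous_on_scaleR continuous_on_const
      Cc_infinity_continuous[OF Cc_infinity_partial[OF assms]])

lemma grad_borel: "\<phi> \<in> Cc_infinity \<Omega> \<Longrightarrow> grad \<phi> \<in> borel_measurable borel"
  by (intro borel_measurable_continuous_onI grad_continuous)

lemma Cc_infinity_bounded:
  assumes "\<phi> \<in> Cc_infinity \<Omega>"
  obtains B where "B \<ge> 0" "\<And>x. \<bar>\<phi> x\<bar> \<le> B"
proof -
  obtain K where K: "compact K" "\<And>x. x \<notin> K \<Longrightarrow> \<phi> x = 0"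
    using assms by (rule Cc_infinity_support) blast
  have "bounded (\<phi> ` K)"
    using K(1) Cc_infinity_continuous[OF assms]
    by (intro compact_imp_bounded compact_continuous_image) (auto intro: continuous_on_subset)
  then obtain B where B: "\<And>x. x \<in> K \<Longrightarrow> \<bar>\<phi> x\<bar> \<le> B"
    unfolding bounded_iff by auto
  show ?thesis
  proof (rule that[of "max B 0"])
    show "\<bar>\<phi> x\<bar> \<le> max B 0" for x
      using B[of x] K(2)[of x] by (cases "x \<in> K") auto
  qed auto
qed

lemma grad_bounded:
  assumes "\<phi> \<in> Cc_infinity \<Omega>"
  obtains B where "B \<ge> 0" "\<And>x. norm (grad \<phi> x) \<le> B"
proof -
  have "\<forall>i\<in>Basis. \<exists>B. \<forall>x. \<bar>frechet_derivative \<phi> (at x) i\<bar> \<le> B"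
    using Cc_infinity_bounded[OF Cc_infinity_partial[OF assms]] by metis
  then obtain B where B: "\<And>i x. i \<in> Basis \<Longrightarrow> \<bar>frechet_derivative \<phi> (at x) i\<bar> \<le> B i"
    by metis
  have le: "norm (grad \<phi> x) \<le> (\<Sum>i\<in>Basis. B i)" for x
    using norm_le_l1[of "grad \<phi> x"] sum_mono[of Basis "\<lambda>i. \<bar>grad \<phi> x \<bullet> i\<bar>" B] B
    by (auto simp: grad_inner_Basis intro: order_trans)
  show ?thesis
    by (rule that[OF order_trans[OF norm_ge_zero le[of 0]] le])
qed

lemma Cc_infinity_lipschitz:
  assumes \<phi>: "\<phi> \<in> Cc_infinity \<Omega>" and B: "\<And>x. norm (grad \<phi> x) \<le> B"
  shows "\<bar>\<phi> x - \<phi> y\<bar> \<le> B * norm (x - y)"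
proof -
  have "onorm (\<lambda>h. h \<bullet> grad \<phi> z) \<le> B" for z
  proof (rule onorm_bound)
    show "norm (h \<bullet> grad \<phi> z) \<le> B * norm h" for h
      using Cauchy_Schwarz_ineq2[of h "grad \<phi> z"] mult_right_mono[OF B[of z] norm_ge_zero[of h]]
      unfolding real_norm_def mult.commute[of "norm h"] by linarith
  qed (rule order_trans[OF norm_ge_zero B[of z]])
  then have "norm (\<phi> x - \<phi> y) \<le> B * norm (x - y)"
    using Cc_infinity_has_derivative[OF \<phi>] unfolding Cc_infinity_derivative_eq[OF \<phi>]
    by (intro differentiable_bound[of UNIV \<phi> "\<lambda>z h. h \<bullet> grad \<phi> z"]) auto
  then show ?thesis by simp
qed

lemma Cc_infinity_integrable:
  assumes "\<phi> \<in> Cc_infinity \<Omega>"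
  shows "integrable lborel \<phi>"
proof -
  obtain K where K: "compact K" "\<And>x. x \<notin> K \<Longrightarrow> \<phi> x = 0"
    using assms by (rule Cc_infinity_support) blast
  have "integrable lborel (\<lambda>x. indicator K x *\<^sub>R \<phi> x)"
    by (rule borel_integrable_compact[OF K(1)])
      (rule continuous_on_subset[OF Cc_infinity_continuous[OF assms] subset_UNIV])
  also have "(\<lambda>x. indicator K x *\<^sub>R \<phi> x) = \<phi>"
    using K(2) by (force simp: indicator_def)
  finally show ?thesis .
qed

section \<open>Differentiation under the integral sign\<close>

text \<open>Dominated convergence for difference quotients. The affine argument covers both
  parameter integrals of the proof: \<open>b = 0\<close> with \<open>a\<close> an inverse scale for
  \<open>potential_kernel\<close>, and \<open>a = 1\<close> with \<open>b\<close> the identity for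
  convolutions with a measure.\<close>

lemma has_derivative_integral_affine:
  fixes b :: "'b \<Rightarrow> 'a::euclidean_space"
  assumes \<phi>: "\<phi> \<in> Cc_infinity UNIV" and c: "integrable M c"
    and [measurable]: "a \<in> borel_measurable M" "b \<in> borel_measurable M"
    and A: "\<And>\<omega>. \<omega> \<in> space M \<Longrightarrow> \<bar>a \<omega>\<bar> \<le> A"
  shows "((\<lambda>x. \<integral>\<omega>. c \<omega> * \<phi> (a \<omega> *\<^sub>R (x - b \<omega>)) \<partial>M) has_derivative
    (\<lambda>h. \<integral>\<omega>. c \<omega> * a \<omega> * (h \<bullet> grad \<phi> (a \<omega> *\<^sub>R (x - b \<omega>))) \<partial>M)) (at x)"
proof -
  note [measurable] = Cc_infinity_borel[OF \<phi>] grad_borel[OF \<phi>] borel_measurable_integrable[OF c]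
  obtain B where B: "B \<ge> 0" "\<And>x. \<bar>\<phi> x\<bar> \<le> B" by (rule Cc_infinity_bounded[OF \<phi>]) blast
  obtain B' where B': "B' \<ge> 0" "\<And>x. norm (grad \<phi> x) \<le> B'" by (rule grad_bounded[OF \<phi>]) blast
  have int0: "integrable M (\<lambda>\<omega>. c \<omega> * \<phi> (a \<omega> *\<^sub>R (x - b \<omega>)))" for x
    by (rule Bochner_Integration.integrable_bound[OF integrable_mult_left[OF integrable_abs[OF c], of B]])
      (use B in \<open>auto simp: abs_mult intro!: mult_left_mono\<close>)
  have bnd: "\<bar>c \<omega> * a \<omega> * (h \<bullet> grad \<phi> z)\<bar> \<le> \<bar>c \<omega>\<bar> * (A * (norm h * B'))" if "\<omega> \<in> space M" for \<omega> h z
  proof -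
    have "\<bar>h \<bullet> grad \<phi> z\<bar> \<le> norm h * B'"
      using Cauchy_Schwarz_ineq2[of h "grad \<phi> z"] mult_left_mono[OF B'(2)[of z] norm_ge_zero[of h]]
      by simp
    then have "\<bar>a \<omega>\<bar> * \<bar>h \<bullet> grad \<phi> z\<bar> \<le> A * (norm h * B')"
      using A[OF that] by (intro mult_mono) auto
    then show ?thesis
      by (simp add: abs_mult mult.assoc mult_left_mono)
  qed
  have int1: "integrable M (\<lambda>\<omega>. c \<omega> * a \<omega> * (h \<bullet> grad \<phi> (a \<omega> *\<^sub>R (x - b \<omega>))))" for x h
    by (rule Bochner_Integration.integrable_bound[OF integrable_mult_left[OF integrable_abs[OF c], of "A * (norm h * B')"]])
      (use bnd in \<open>auto intro!: AE_I2 order_trans[OF bnd]\<close>)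
  have lip: "\<bar>\<phi> u - \<phi> v\<bar> \<le> B' * norm (u - v)" for u v
    by (rule Cc_infinity_lipschitz[OF \<phi> B'(2)])
  have bl: "bounded_linear (\<lambda>h. \<integral>\<omega>. c \<omega> * a \<omega> * (h \<bullet> grad \<phi> (a \<omega> *\<^sub>R (x - b \<omega>))) \<partial>M)" (is "bounded_linear ?D")
  proof (rule linear_conv_bounded_linear[THEN iffD1], rule linearI)
    fix h k r
    show "?D (h + k) = ?D h + ?D k"
      using int1 by (simp add: inner_add_left distrib_left flip: Bochner_Integration.integral_add)
    have "?D (r *\<^sub>R h) = (\<integral>\<omega>. r * (c \<omega> * a \<omega> * (h \<bullet> grad \<phi> (a \<omega> *\<^sub>R (x - b \<omega>)))) \<partial>M)"
      by (intro Bochner_Integration.integral_cong) auto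
    then show "?D (r *\<^sub>R h) = r *\<^sub>R ?D h"
      by simp
  qed
  have "((\<lambda>y. ((\<integral>\<omega>. c \<omega> * \<phi> (a \<omega> *\<^sub>R (y - b \<omega>)) \<partial>M) - (\<integral>\<omega>. c \<omega> * \<phi> (a \<omega> *\<^sub>R (x - b \<omega>)) \<partial>M)
      - ?D (y - x)) /\<^sub>R norm (y - x)) \<longlongrightarrow> 0) (at x)"
    unfolding tendsto_at_iff_sequentially comp_def
  proof safe
    fix X :: "nat \<Rightarrow> 'a" assume X: "\<forall>i. X i \<in> UNIV - {x}" "X \<longlonglongrightarrow> x"
    let ?q = "\<lambda>n \<omega>. c \<omega> * ((\<phi> (a \<omega> *\<^sub>R (X n - b \<omega>)) - \<phi> (a \<omega> *\<^sub>R (x - b \<omega>))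
        - a \<omega> * ((X n - x) \<bullet> grad \<phi> (a \<omega> *\<^sub>R (x - b \<omega>)))) / norm (X n - x))"
    have "(\<lambda>n. \<integral>\<omega>. ?q n \<omega> \<partial>M) \<longlonglongrightarrow> (\<integral>\<omega>. 0 \<partial>M)"
    proof (rule integral_dominated_convergence)
      \<comment> \<open>The increment is controlled by the Lipschitz bound and its linear part by
        Cauchy-Schwarz, each by \<open>A * B' * norm (X n - x)\<close>; hence the factor 2.\<close>
      show "integrable M (\<lambda>\<omega>. \<bar>c \<omega>\<bar> * (2 * A * B'))"
        using c by auto
      show "AE \<omega> in M. norm (?q n \<omega>) \<le> \<bar>c \<omega>\<bar> * (2 * A * B')" for n
      proof (rule AE_I2)
        fix \<omega> assume \<omega>: "\<omega> \<in> space M"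
        have pos: "norm (X n - x) > 0" using X(1) by auto
        have "\<bar>\<phi> (a \<omega> *\<^sub>R (X n - b \<omega>)) - \<phi> (a \<omega> *\<^sub>R (x - b \<omega>))\<bar>
            \<le> B' * norm (a \<omega> *\<^sub>R (X n - b \<omega>) - a \<omega> *\<^sub>R (x - b \<omega>))"
          by (rule lip)
        also have "a \<omega> *\<^sub>R (X n - b \<omega>) - a \<omega> *\<^sub>R (x - b \<omega>) = a \<omega> *\<^sub>R (X n - x)"
          by (simp add: algebra_simps)
        also have "B' * norm (a \<omega> *\<^sub>R (X n - x)) \<le> B' * (A * norm (X n - x))"
          using A[OF \<omega>] B' by (auto intro!: mult_left_mono mult_right_mono)
        finally have 1: "\<bar>\<phi> (a \<omega> *\<^sub>R (X n - b \<omega>)) - \<phi> (a \<omega> *\<^sub>R (x - b \<omega>))\<bar> \<le> A * B' * norm (X n - x)"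
          by (simp add: mult_ac)
        have "\<bar>(X n - x) \<bullet> grad \<phi> (a \<omega> *\<^sub>R (x - b \<omega>))\<bar> \<le> norm (X n - x) * B'"
          using Cauchy_Schwarz_ineq2 mult_left_mono[OF B'(2) norm_ge_zero] order_trans by blast
        then have "\<bar>a \<omega> * ((X n - x) \<bullet> grad \<phi> (a \<omega> *\<^sub>R (x - b \<omega>)))\<bar> \<le> A * (norm (X n - x) * B')"
          unfolding abs_mult using A[OF \<omega>] by (intro mult_mono) auto
        with 1 have "\<bar>\<phi> (a \<omega> *\<^sub>R (X n - b \<omega>)) - \<phi> (a \<omega> *\<^sub>R (x - b \<omega>))
           - a \<omega> * ((X n - x) \<bullet> grad \<phi> (a \<omega> *\<^sub>R (x - b \<omega>)))\<bar> \<le> 2 * A * B' * norm (X n - x)"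
          by (simp add: mult_ac)
        with pos have "\<bar>\<phi> (a \<omega> *\<^sub>R (X n - b \<omega>)) - \<phi> (a \<omega> *\<^sub>R (x - b \<omega>))
           - a \<omega> * ((X n - x) \<bullet> grad \<phi> (a \<omega> *\<^sub>R (x - b \<omega>)))\<bar> / norm (X n - x) \<le> 2 * A * B'"
          by (simp add: pos_divide_le_eq)
        then show "norm (?q n \<omega>) \<le> \<bar>c \<omega>\<bar> * (2 * A * B')"
          unfolding real_norm_def abs_mult abs_divide abs_norm_cancel by (intro mult_left_mono) auto
      qed
      show "AE \<omega> in M. (\<lambda>n. ?q n \<omega>) \<longlonglongrightarrow> 0"
      proof (rule AE_I2)
        fix \<omega>
        have "((\<lambda>y. \<phi> (a \<omega> *\<^sub>R (y - b \<omega>))) has_derivative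
            (\<lambda>h. (a \<omega> *\<^sub>R h) \<bullet> grad \<phi> (a \<omega> *\<^sub>R (x - b \<omega>)))) (at x)"
          by (rule has_derivative_compose[where f="\<lambda>y. a \<omega> *\<^sub>R (y - b \<omega>)" and g=\<phi>])
            (auto intro!: derivative_eq_intros simp: Cc_infinity_derivative_eq[OF \<phi>, symmetric]
              Cc_infinity_has_derivative[OF \<phi>])
        then have "(\<lambda>n. (\<phi> (a \<omega> *\<^sub>R (X n - b \<omega>)) - \<phi> (a \<omega> *\<^sub>R (x - b \<omega>))
          - (a \<omega> *\<^sub>R (X n - x)) \<bullet> grad \<phi> (a \<omega> *\<^sub>R (x - b \<omega>))) /\<^sub>R norm (X n - x)) \<longlonglongrightarrow> 0"
          using X unfolding has_derivative_at_within tendsto_at_iff_sequentially comp_def by blast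
        from tendsto_mult_right_zero[OF this, of "c \<omega>"] show "(\<lambda>n. ?q n \<omega>) \<longlonglongrightarrow> 0"
          by (simp add: divide_inverse mult_ac)
      qed
    qed simp_all
    also have "(\<lambda>n. \<integral>\<omega>. ?q n \<omega> \<partial>M) = (\<lambda>n. ((\<integral>\<omega>. c \<omega> * \<phi> (a \<omega> *\<^sub>R (X n - b \<omega>)) \<partial>M)
       - (\<integral>\<omega>. c \<omega> * \<phi> (a \<omega> *\<^sub>R (x - b \<omega>)) \<partial>M) - ?D (X n - x)) /\<^sub>R norm (X n - x))"
    proof
      fix n
      have "(\<integral>\<omega>. ?q n \<omega> \<partial>M) = (\<integral>\<omega>. (c \<omega> * \<phi> (a \<omega> *\<^sub>R (X n - b \<omega>)) - c \<omega> * \<phi> (a \<omega> *\<^sub>R (x - b \<omega>))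
          - c \<omega> * a \<omega> * ((X n - x) \<bullet> grad \<phi> (a \<omega> *\<^sub>R (x - b \<omega>)))) / norm (X n - x) \<partial>M)"
        by (intro Bochner_Integration.integral_cong refl) (simp add: right_diff_distrib mult.assoc)
      then show "(\<integral>\<omega>. ?q n \<omega> \<partial>M) = ((\<integral>\<omega>. c \<omega> * \<phi> (a \<omega> *\<^sub>R (X n - b \<omega>)) \<partial>M)
       - (\<integral>\<omega>. c \<omega> * \<phi> (a \<omega> *\<^sub>R (x - b \<omega>)) \<partial>M) - ?D (X n - x)) /\<^sub>R norm (X n - x)"
        using int0 int1 by (simp add: divide_inverse mult.commute)
    qed
    finally show "(\<lambda>n. ((\<integral>\<omega>. c \<omega> * \<phi> (a \<omega> *\<^sub>R (X n - b \<omega>)) \<partial>M)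
       - (\<integral>\<omega>. c \<omega> * \<phi> (a \<omega> *\<^sub>R (x - b \<omega>)) \<partial>M) - ?D (X n - x)) /\<^sub>R norm (X n - x)) \<longlonglongrightarrow> 0"
      by simp
  qed
  with bl show ?thesis
    unfolding has_derivative_at_within by simp
qed

text \<open>One differentiation replaces \<open>c\<close> by \<open>c * a\<close> and \<phi> by a
  partial derivative, so the induction varies both; boundedness of \<open>a\<close> keeps the weight
  integrable.\<close>

lemma Ck_on_integral_affine:
  fixes b :: "'b \<Rightarrow> 'a::euclidean_space"
  assumes "\<phi> \<in> Cc_infinity UNIV" "integrable M c"
    and [measurable]: "a \<in> borel_measurable M" "b \<in> borel_measurable M"
    and A: "\<And>\<omega>. \<omega> \<in> space M \<Longrightarrow> \<bar>a \<omega>\<bar> \<le> A"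
  shows "Ck_on k UNIV (\<lambda>x. \<integral>\<omega>. c \<omega> * \<phi> (a \<omega> *\<^sub>R (x - b \<omega>)) \<partial>M)"
  using assms(1,2)
proof (induction k arbitrary: \<phi> c)
  case 0
  note D = has_derivative_integral_affine[OF 0 assms(3,4) A]
  show ?case
    using D by (auto intro!: has_derivative_continuous_on)
next
  case (Suc k)
  note [measurable] = borel_measurable_integrable[OF Suc.prems(2)]
  have ca: "integrable M (\<lambda>\<omega>. c \<omega> * a \<omega>)"
    by (rule Bochner_Integration.integrable_bound[OF integrable_mult_left[OF integrable_abs[OF Suc.prems(2)], of A]])
      (use A in \<open>auto simp: abs_mult intro!: mult_left_mono AE_I2 order_trans[OF A]\<close>)
  show ?case
  proof (rule Ck_on_SucI)
    fix i :: 'a assume i: "i \<in> Basis"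
    show "Ck_on k UNIV (\<lambda>x. \<integral>\<omega>. c \<omega> * a \<omega> * (i \<bullet> grad \<phi> (a \<omega> *\<^sub>R (x - b \<omega>))) \<partial>M)"
      using Suc.IH[OF Cc_infinity_partial[OF Suc.prems(1) i] ca] i
      by (simp add: grad_inner_Basis inner_commute[of i])
  qed (rule has_derivative_integral_affine[OF Suc.prems assms(3,4) A])
qed

section \<open>Integration by parts and weak gradients\<close>

lemma lborel_integral_affine:
  fixes f :: "'a::euclidean_space \<Rightarrow> real"
  assumes [measurable]: "f \<in> borel_measurable borel" and c: "c \<noteq> 0"
  shows "(\<integral>x. f x \<partial>lborel) = \<bar>c\<bar> ^ DIM('a) * (\<integral>x. f (t + c *\<^sub>R x) \<partial>lborel)"
proof -
  have "(\<integral>x. f x \<partial>lborel) = (\<integral>x. f x \<partial>density (distr lborel borel (\<lambda>x. t + c *\<^sub>R x)) (\<lambda>_. ennreal (\<bar>c\<bar> ^ DIM('a))))"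
    using lborel_affine[OF c, of t] by simp
  also have "\<dots> = (\<integral>x. \<bar>c\<bar> ^ DIM('a) *\<^sub>R f x \<partial>distr lborel borel (\<lambda>x. t + c *\<^sub>R x))"
    by (rule integral_density) auto
  also have "\<dots> = \<bar>c\<bar> ^ DIM('a) * (\<integral>x. f (t + c *\<^sub>R x) \<partial>lborel)"
    by (simp add: integral_distr)
  finally show ?thesis .
qed

text \<open>The notions of the theorem live on \<open>lebesgue_on \<Omega>\<close>, while
  translation invariance and Fubini are used on \<open>lborel\<close>; this is the passage between
  the two.\<close>

lemma lebesgue_on_integral_eq:
  fixes f :: "'a::euclidean_space \<Rightarrow> 'b::euclidean_space"
  assumes [measurable]: "\<Omega> \<in> sets borel" "f \<in> borel_measurable borel"
    and 0: "\<And>x. x \<notin> \<Omega> \<Longrightarrow> f x = 0"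
  shows "(\<integral>x. f x \<partial>lebesgue_on \<Omega>) = (\<integral>x. f x \<partial>lborel)"
    and "integrable (lebesgue_on \<Omega>) f \<longleftrightarrow> integrable lborel f"
proof -
  have eq: "(\<lambda>x. indicator \<Omega> x *\<^sub>R f x) = f"
    using 0 by (force simp: indicator_def)
  show "(\<integral>x. f x \<partial>lebesgue_on \<Omega>) = (\<integral>x. f x \<partial>lborel)"
    by (subst integral_restrict_space) (simp_all add: eq integral_completion)
  show "integrable (lebesgue_on \<Omega>) f \<longleftrightarrow> integrable lborel f"
    by (subst integrable_restrict_space) (simp_all add: eq integrable_completion)
qed

lemma Cc_infinity_outside: "\<phi> \<in> Cc_infinity \<Omega> \<Longrightarrow> x \<notin> \<Omega> \<Longrightarrow> \<phi> x = 0"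
  by (metis Cc_infinity_support subsetD)

text \<open>The integral of \<open>\<phi> (x + y)\<close> over \<open>y\<close> does not depend on \<open>x\<close>, so its derivative at \<open>x = 0\<close> vanishes.\<close>

lemma integral_partial_zero:
  fixes \<phi> :: "'a::euclidean_space \<Rightarrow> real"
  assumes \<phi>: "\<phi> \<in> Cc_infinity UNIV" and i: "i \<in> Basis"
  shows "(\<integral>x. frechet_derivative \<phi> (at x) i \<partial>lborel) = 0"
proof -
  note [measurable] = Cc_infinity_borel[OF \<phi>]
  obtain K where K: "compact K" "\<And>x. x \<notin> K \<Longrightarrow> \<phi> x = 0"
      "\<And>x. x \<notin> K \<Longrightarrow> frechet_derivative \<phi> (at x) = (\<lambda>_. 0)"
    using \<phi> by (rule Cc_infinity_support) blast
  obtain R where R: "\<And>x. x \<in> K \<Longrightarrow> norm x \<le> R"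
    using compact_imp_bounded[OF K(1)] unfolding bounded_iff by blast
  \<comment> \<open>Differentiation under the integral needs an integrable weight. This one equals 1
    on all translates of \<open>K\<close> by vectors of norm below 1, hence the radius
    \<open>R + 1\<close>.\<close>
  let ?c = "indicator (cball 0 (R + 1)) :: 'a \<Rightarrow> real"
  have c: "integrable lborel ?c"
    by (intro integrable_real_indicator emeasure_bounded_finite) auto
  have D: "((\<lambda>x. \<integral>y. ?c y * \<phi> (1 *\<^sub>R (x - (- y))) \<partial>lborel) has_derivative
      (\<lambda>h. \<integral>y. ?c y * 1 * (h \<bullet> grad \<phi> (1 *\<^sub>R (0 - (- y)))) \<partial>lborel)) (at 0)"
    by (rule has_derivative_integral_affine[OF \<phi> c, of "\<lambda>_. 1" _ 1]) auto
  have eq: "(\<integral>y. ?c y * \<phi> (1 *\<^sub>R (x - (- y))) \<partial>lborel) = (\<integral>y. \<phi> y \<partial>lborel)" if "x \<in> ball 0 1" for x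
  proof -
    have "?c y * \<phi> (x + y) = \<phi> (x + y)" for y
    proof (cases "x + y \<in> K")
      case True
      have "norm y \<le> norm (x + y) + norm x"
        using norm_triangle_ineq4[of "x + y" x] by simp
      with R[OF True] that show ?thesis by (simp add: indicator_def)
    qed (use K in simp)
    then have "(\<integral>y. ?c y * \<phi> (1 *\<^sub>R (x - (- y))) \<partial>lborel) = (\<integral>y. \<phi> (x + y) \<partial>lborel)"
      by (intro Bochner_Integration.integral_cong refl) simp
    also have "\<dots> = (\<integral>y. \<phi> y \<partial>lborel)"
      using lborel_integral_affine[of \<phi> 1 x] by simp
    finally show ?thesis .
  qed
  have "((\<lambda>x. \<integral>y. ?c y * \<phi> (1 *\<^sub>R (x - (- y))) \<partial>lborel) has_derivative (\<lambda>_. 0)) (at 0)"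
    by (rule has_derivative_transform_within_open[OF has_derivative_const open_ball[of 0 1]])
      (use eq in \<open>simp_all del: mem_ball scaleR_one\<close>)
  with D have "(\<lambda>h. \<integral>y. ?c y * 1 * (h \<bullet> grad \<phi> (1 *\<^sub>R (0 - (- y)))) \<partial>lborel) = (\<lambda>_. 0)"
    by (rule has_derivative_unique)
  then have "(\<integral>y. ?c y * (i \<bullet> grad \<phi> y) \<partial>lborel) = 0"
    by (simp add: fun_eq_iff)
  also have "(\<lambda>y. ?c y * (i \<bullet> grad \<phi> y)) = (\<lambda>y. frechet_derivative \<phi> (at y) i)"
  proof
    fix y show "?c y * (i \<bullet> grad \<phi> y) = frechet_derivative \<phi> (at y) i"
      using K(3)[of y] R[of y] i
      by (cases "y \<in> K") (auto simp: grad_inner_Basis inner_commute[of i] indicator_def)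
  qed
  finally show ?thesis .
qed

lemma Cc_infinity_mult:
  assumes "\<phi> \<in> Cc_infinity \<Omega>" "\<And>k. Ck_on k UNIV \<psi>"
  shows "(\<lambda>x. \<phi> x * \<psi> x) \<in> Cc_infinity \<Omega>"
proof -
  obtain K where "compact K" "K \<subseteq> \<Omega>" "\<And>x. x \<notin> K \<Longrightarrow> \<phi> x = 0"
    using assms(1) by (rule Cc_infinity_support) blast
  then show ?thesis
    by (intro Cc_infinityI[OF Ck_on_mult[OF Cc_infinity_Ck[OF assms(1)] assms(2)], of K]) auto
qed

lemma Cc_infinity_integral_by_parts:
  fixes \<phi> \<psi> :: "'a::euclidean_space \<Rightarrow> real"
  assumes \<phi>: "\<phi> \<in> Cc_infinity UNIV" and \<psi>: "\<psi> \<in> Cc_infinity UNIV" and i: "i \<in> Basis"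
  shows "(\<integral>x. \<psi> x * frechet_derivative \<phi> (at x) i \<partial>lborel)
    = - (\<integral>x. frechet_derivative \<psi> (at x) i * \<phi> x \<partial>lborel)"
proof -
  have "frechet_derivative (\<lambda>x. \<psi> x * \<phi> x) (at x) i
      = \<psi> x * frechet_derivative \<phi> (at x) i + frechet_derivative \<psi> (at x) i * \<phi> x" for x
    using has_derivative_mult[OF Cc_infinity_has_derivative[OF \<psi>] Cc_infinity_has_derivative[OF \<phi>], of x]
    by (simp flip: frechet_derivative_at)
  moreover have "integrable lborel (\<lambda>x. \<psi> x * frechet_derivative \<phi> (at x) i)"
      "integrable lborel (\<lambda>x. frechet_derivative \<psi> (at x) i * \<phi> x)"
    using Cc_infinity_integrable[OF Cc_infinity_mult[OF \<psi> Cc_infinity_Ck[OF Cc_infinity_partial[OF \<phi> i]]]]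
      Cc_infinity_integrable[OF Cc_infinity_mult[OF Cc_infinity_partial[OF \<psi> i] Cc_infinity_Ck[OF \<phi>]]]
    by auto
  ultimately show ?thesis
    using integral_partial_zero[OF Cc_infinity_mult[OF \<psi> Cc_infinity_Ck[OF \<phi>]] i] by simp
qed

lemma locally_integrable_mult:
  fixes G :: "'a::euclidean_space \<Rightarrow> 'b::euclidean_space"
  assumes \<Omega>: "\<Omega> \<in> sets borel" and G: "locally_integrable_on \<Omega> G"
    and K: "compact K" "K \<subseteq> \<Omega>" and \<phi>: "\<phi> \<in> borel_measurable borel" "\<And>x. \<bar>\<phi> x\<bar> \<le> B" "\<And>x. x \<notin> K \<Longrightarrow> \<phi> x = 0"
  shows "integrable (lebesgue_on \<Omega>) (\<lambda>x. \<phi> x *\<^sub>R G x)"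
proof -
  have [measurable]: "K \<in> sets lebesgue" "\<Omega> \<in> sets lebesgue"
    using K \<Omega> by (auto simp: compact_imp_closed)
  have [measurable]: "\<phi> \<in> borel_measurable lebesgue"
    using \<phi>(1) by (simp add: measurable_completion)
  have int: "integrable lebesgue (\<lambda>x. indicator K x *\<^sub>R G x)"
    using G K by (intro integrable_restrict_space[THEN iffD1]) (auto simp: locally_integrable_on_def)
  note [measurable] = borel_measurable_integrable[OF int]
  have "integrable lebesgue (\<lambda>x. \<phi> x *\<^sub>R (indicator K x *\<^sub>R G x))"
  proof (rule Bochner_Integration.integrable_bound[OF integrable_scaleR_right[OF int, of B]])
    show "(\<lambda>x. \<phi> x *\<^sub>R (indicator K x *\<^sub>R G x)) \<in> borel_measurable lebesgue"
      by (rule borel_measurable_scaleR) measurable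
    have "norm (\<phi> x *\<^sub>R y) \<le> norm (B *\<^sub>R y)" for x and y :: 'b
      using \<phi>(2)[of x] by (auto intro!: mult_right_mono)
    then show "AE x in lebesgue. norm (\<phi> x *\<^sub>R (indicator K x *\<^sub>R G x)) \<le> norm (B *\<^sub>R (indicator K x *\<^sub>R G x))"
      by blast
  qed
  also have "(\<lambda>x. \<phi> x *\<^sub>R (indicator K x *\<^sub>R G x)) = (\<lambda>x. indicator \<Omega> x *\<^sub>R (\<phi> x *\<^sub>R G x))"
    using K(2) \<phi>(3) by (auto simp: fun_eq_iff indicator_def)
  finally show ?thesis
    by (simp add: integrable_restrict_space)
qed

lemma locally_integrable_mult_Cc:
  fixes G :: "'a::euclidean_space \<Rightarrow> 'b::euclidean_space"
  assumes "\<Omega> \<in> sets borel" "locally_integrable_on \<Omega> G" and \<phi>: "\<phi> \<in> Cc_infinity \<Omega>"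
  shows "integrable (lebesgue_on \<Omega>) (\<lambda>x. \<phi> x *\<^sub>R G x)"
proof -
  obtain K where K: "compact K" "K \<subseteq> \<Omega>" "\<And>x. x \<notin> K \<Longrightarrow> \<phi> x = 0"
    using \<phi> by (rule Cc_infinity_support) blast
  obtain B where B: "\<And>x. \<bar>\<phi> x\<bar> \<le> B"
    using \<phi> by (rule Cc_infinity_bounded) blast
  show ?thesis
    by (rule locally_integrable_mult[OF assms(1,2) K(1,2) Cc_infinity_borel[OF \<phi>] B K(3)])
qed

lemma continuous_locally_integrable:
  fixes G :: "'a::euclidean_space \<Rightarrow> 'b::euclidean_space"
  assumes "continuous_on UNIV G"
  shows "locally_integrable_on \<Omega> G"
  unfolding locally_integrable_on_def
proof safe
  fix K :: "'a set" assume "compact K"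
  then have [measurable]: "K \<in> sets borel"
    by (simp add: borel_compact)
  have [measurable]: "G \<in> borel_measurable borel"
    using assms by (rule borel_measurable_continuous_onI)
  have "integrable lborel (\<lambda>x. indicator K x *\<^sub>R G x)"
    using \<open>compact K\<close> continuous_on_subset[OF assms subset_UNIV] by (rule borel_integrable_compact)
  then show "integrable (lebesgue_on K) G"
    by (simp add: integrable_restrict_space integrable_completion)
qed

lemma has_weak_gradient_Cc:
  assumes \<Omega>: "\<Omega> \<in> sets borel" and \<psi>: "\<psi> \<in> Cc_infinity \<Omega>"
  shows "has_weak_gradient \<Omega> \<psi> (grad \<psi>)"
  unfolding has_weak_gradient_def
proof (intro conjI ballI)
  fix \<phi> :: "'a \<Rightarrow> real" and i :: 'a assume \<phi>: "\<phi> \<in> Cc_infinity \<Omega>" and i: "i \<in> Basis"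
  note [measurable] = Cc_infinity_borel[OF \<phi>] Cc_infinity_borel[OF \<psi>] grad_borel[OF \<phi>] grad_borel[OF \<psi>]
  have "(\<integral>x. \<psi> x * (grad \<phi> x \<bullet> i) \<partial>lebesgue_on \<Omega>) = (\<integral>x. \<psi> x * (grad \<phi> x \<bullet> i) \<partial>lborel)"
    by (rule lebesgue_on_integral_eq[OF \<Omega>]) (auto simp: Cc_infinity_outside[OF \<psi>])
  moreover have "(\<integral>x. (grad \<psi> x \<bullet> i) * \<phi> x \<partial>lebesgue_on \<Omega>) = (\<integral>x. (grad \<psi> x \<bullet> i) * \<phi> x \<partial>lborel)"
    by (rule lebesgue_on_integral_eq[OF \<Omega>]) (auto simp: Cc_infinity_outside[OF \<phi>])
  ultimately show "(\<integral>x. \<psi> x * (grad \<phi> x \<bullet> i) \<partial>lebesgue_on \<Omega>) = - (\<integral>x. (grad \<psi> x \<bullet> i) * \<phi> x \<partial>lebesgue_on \<Omega>)"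
    using Cc_infinity_integral_by_parts[of \<phi> \<psi> i] Cc_infinity_mono[OF \<phi>] Cc_infinity_mono[OF \<psi>] i
    by (simp add: grad_inner_Basis)
qed (intro continuous_locally_integrable Cc_infinity_continuous[OF \<psi>] grad_continuous[OF \<psi>])+

section \<open>The Laplacian of a test function paired with a weakly differentiable function\<close>

definition laplacian :: "('a::euclidean_space \<Rightarrow> real) \<Rightarrow> 'a \<Rightarrow> real" where
  "laplacian \<phi> x = (\<Sum>i\<in>Basis. frechet_derivative (\<lambda>y. frechet_derivative \<phi> (at y) i) (at x) i)"

lemma laplacian_continuous: "\<phi> \<in> Cc_infinity \<Omega> \<Longrightarrow> continuous_on UNIV (laplacian \<phi>)"
  unfolding laplacian_def
  by (intro continuous_on_sum Cc_infinity_continuous Cc_infinity_partial)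

text \<open>The definition of the weak gradient is applied with the partial derivatives of \<phi> as
  test functions and summed over the basis. Both derivatives fall on \<phi>, so \<zeta> may be any
  function with a weak gradient.\<close>

lemma weak_gradient_laplacian:
  assumes \<Omega>: "\<Omega> \<in> sets borel" and Z: "has_weak_gradient \<Omega> \<zeta> Z" and \<phi>: "\<phi> \<in> Cc_infinity \<Omega>"
  shows "(\<integral>x. Z x \<bullet> grad \<phi> x \<partial>lebesgue_on \<Omega>) = - (\<integral>x. \<zeta> x * laplacian \<phi> x \<partial>lebesgue_on \<Omega>)"
proof -
  have loc: "locally_integrable_on \<Omega> \<zeta>" "locally_integrable_on \<Omega> Z"
    using Z by (auto simp: has_weak_gradient_def)
  let ?d = "\<lambda>i x. frechet_derivative \<phi> (at x) i"
  have d: "?d i \<in> Cc_infinity \<Omega>" "(\<lambda>x. frechet_derivative (?d i) (at x) i) \<in> Cc_infinity \<Omega>" if "i \<in> Basis" for i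
    using Cc_infinity_partial[OF \<phi> that] Cc_infinity_partial[OF Cc_infinity_partial[OF \<phi> that] that]
    by auto
  have int1: "integrable (lebesgue_on \<Omega>) (\<lambda>x. (Z x \<bullet> i) * ?d i x)" if "i \<in> Basis" for i
    using integrable_inner_left[OF locally_integrable_mult_Cc[OF \<Omega> loc(2) d(1)[OF that]], of i]
    by (simp add: mult.commute)
  have int2: "integrable (lebesgue_on \<Omega>) (\<lambda>x. \<zeta> x * frechet_derivative (?d i) (at x) i)" if "i \<in> Basis" for i
    using locally_integrable_mult_Cc[OF \<Omega> loc(1) d(2)[OF that]] by (simp add: mult.commute)
  have "(\<integral>x. Z x \<bullet> grad \<phi> x \<partial>lebesgue_on \<Omega>) = (\<integral>x. (\<Sum>i\<in>Basis. (Z x \<bullet> i) * ?d i x) \<partial>lebesgue_on \<Omega>)"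
    by (subst euclidean_inner) (simp add: grad_inner_Basis)
  also have "\<dots> = (\<Sum>i\<in>Basis. \<integral>x. (Z x \<bullet> i) * ?d i x \<partial>lebesgue_on \<Omega>)"
    by (rule Bochner_Integration.integral_sum[OF int1])
  also have "\<dots> = (\<Sum>i\<in>Basis. - (\<integral>x. \<zeta> x * frechet_derivative (?d i) (at x) i \<partial>lebesgue_on \<Omega>))"
  proof (rule sum.cong[OF refl])
    fix i :: 'a assume i: "i \<in> Basis"
    have "(\<integral>x. \<zeta> x * (grad (?d i) x \<bullet> i) \<partial>lebesgue_on \<Omega>) = - (\<integral>x. (Z x \<bullet> i) * ?d i x \<partial>lebesgue_on \<Omega>)"
      using Z d(1)[OF i] i unfolding has_weak_gradient_def by blast
    then show "(\<integral>x. (Z x \<bullet> i) * ?d i x \<partial>lebesgue_on \<Omega>)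
        = - (\<integral>x. \<zeta> x * frechet_derivative (?d i) (at x) i \<partial>lebesgue_on \<Omega>)"
      using i by (simp add: grad_inner_Basis)
  qed
  also have "\<dots> = - (\<integral>x. (\<Sum>i\<in>Basis. \<zeta> x * frechet_derivative (?d i) (at x) i) \<partial>lebesgue_on \<Omega>)"
    by (simp add: sum_negf Bochner_Integration.integral_sum[OF int2])
  finally show ?thesis
    by (simp add: laplacian_def sum_distrib_left)
qed

section \<open>Mollifiers and the potential kernel\<close>

text \<open>The integral of the unnormalised mollifier, not of the bump: dividing both functions by
  it makes the mollifier integrate to one and preserves the gradient relation between them. The type
  argument only carries the dimension.\<close>

definition bump_mass :: "'a::euclidean_space itself \<Rightarrow> real" where
  "bump_mass _ = (\<integral>y. 2 * smooth_step 1 (1 - (y::'a) \<bullet> y) \<partial>lborel)"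

text \<open>The radial functions \<open>bump\<close> and \<open>unit_mollifier\<close> are related by \<open>grad bump y = - unit_mollifier y *\<^sub>R y\<close>.\<close>

definition bump :: "'a::euclidean_space \<Rightarrow> real" where
  "bump y = smooth_step 0 (1 - y \<bullet> y) / bump_mass TYPE('a)"

definition unit_mollifier :: "'a::euclidean_space \<Rightarrow> real" where
  "unit_mollifier y = 2 * smooth_step 1 (1 - y \<bullet> y) / bump_mass TYPE('a)"

definition mollifier :: "real \<Rightarrow> 'a::euclidean_space \<Rightarrow> real" where
  "mollifier s x = inverse s ^ DIM('a) * unit_mollifier (inverse s *\<^sub>R x)"

text \<open>A truncated fundamental solution: \<open>- \<Delta> (potential_kernel s r) = mollifier s - mollifier r\<close>.\<close>

definition potential_kernel :: "real \<Rightarrow> real \<Rightarrow> 'a::euclidean_space \<Rightarrow> real" where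
  "potential_kernel s r x =
     (\<integral>\<sigma>. indicator {s..r} \<sigma> * inverse \<sigma> ^ (DIM('a) - 1) * bump (inverse \<sigma> *\<^sub>R x) \<partial>lborel)"

lemma Ck_on_cmult: "Ck_on k UNIV f \<Longrightarrow> Ck_on k UNIV (\<lambda>x. c * f x)"
  by (rule Ck_on_mult[OF Ck_on_const])

lemma Ck_on_smooth_step_radial:
  "Ck_on k UNIV (\<lambda>y::'a::euclidean_space. smooth_step n (1 - y \<bullet> y))"
proof -
  have "Ck_on k UNIV (\<lambda>y::'a. 1 + (- 1) * (y \<bullet> y))"
    by (intro Ck_on_add Ck_on_cmult Ck_on_inner_self Ck_on_const)
  then show ?thesis
    by (intro Ck_on_smooth_step_compose) simp
qed

lemma smooth_step_radial_Cc:
  "(\<lambda>y::'a::euclidean_space. c * smooth_step n (1 - y \<bullet> y)) \<in> Cc_infinity UNIV"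
proof (rule Cc_infinityI[OF Ck_on_cmult[OF Ck_on_smooth_step_radial]])
  show "compact (cball 0 1 :: 'a set)" by simp
  show "c * smooth_step n (1 - y \<bullet> y) = 0" if "y \<notin> cball 0 1" for y :: 'a
    using that by (simp add: dot_square_norm power_le_one_iff not_le)
qed auto

lemma smooth_step_radial_has_derivative:
  "((\<lambda>y::'a::euclidean_space. smooth_step n (1 - y \<bullet> y)) has_derivative
     (\<lambda>h. - 2 * (y \<bullet> h) * smooth_step (Suc n) (1 - y \<bullet> y))) (at y)"
  by (rule DERIV_compose_FDERIV[where f="smooth_step n" and g="\<lambda>y. 1 - y \<bullet> y",
        OF smooth_step_has_derivative, THEN has_derivative_eq_rhs])
    (auto intro!: derivative_eq_intros simp: inner_commute)

lemma bump_mass_pos: "bump_mass TYPE('a::euclidean_space) > 0"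
proof -
  let ?f = "\<lambda>y::'a. 2 * smooth_step 1 (1 - y \<bullet> y)"
  have f: "?f \<in> Cc_infinity UNIV" by (rule smooth_step_radial_Cc)
  have nn: "?f y \<ge> 0" for y
    using smooth_step_1_nonneg[of "1 - y \<bullet> y"] by simp
  have "integral\<^sup>L lborel ?f \<noteq> 0"
  proof
    assume "integral\<^sup>L lborel ?f = 0"
    then have "AE y in lborel. ?f y = 0"
      using integral_nonneg_eq_0_iff_AE[OF Cc_infinity_integrable[OF f]] nn by auto
    then have "AE y in lborel. y \<in> - ball (0::'a) 1"
      by (rule eventually_mono)
        (auto simp: smooth_step_1 dot_square_norm abs_square_less_1 abs_square_eq_1 split: if_splits)
    then have "AE y in lebesgue. y \<in> - ball (0::'a) 1"
      by (rule AE_completion)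
    \<comment> \<open>A closed set of full Lebesgue measure contains every point.\<close>
    then have "0 \<in> - (ball 0 1 :: 'a set)"
      by (intro mem_closed_if_AE_lebesgue) auto
    then show False by simp
  qed
  moreover have "integral\<^sup>L lborel ?f \<ge> 0"
    using nn by (intro Bochner_Integration.integral_nonneg) auto
  ultimately show ?thesis
    by (simp add: bump_mass_def)
qed

lemma bump_Cc: "bump \<in> Cc_infinity UNIV"
  using smooth_step_radial_Cc[of "1 / bump_mass TYPE('a)" 0]
  by (simp add: bump_def[abs_def])

lemma unit_mollifier_Cc: "unit_mollifier \<in> Cc_infinity UNIV"
  using smooth_step_radial_Cc[of "2 / bump_mass TYPE('a)" 1]
  by (simp add: unit_mollifier_def[abs_def])

lemma bump_nonneg: "bump y \<ge> 0"
  using bump_mass_pos[where 'a='a] smooth_step_0_nonneg by (simp add: bump_def)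

lemma bump_antimono:
  fixes x y :: "'a::euclidean_space"
  shows "norm x \<le> norm y \<Longrightarrow> bump y \<le> bump x"
  unfolding bump_def using bump_mass_pos[where 'a='a]
  by (intro divide_right_mono smooth_step_0_mono) (auto simp: dot_square_norm power_mono)

lemma bump_eq_0: "1 \<le> norm y \<Longrightarrow> bump y = 0"
  by (simp add: bump_def dot_square_norm)

lemma unit_mollifier_nonneg: "unit_mollifier y \<ge> 0"
  using bump_mass_pos[where 'a='a] smooth_step_1_nonneg by (simp add: unit_mollifier_def)

lemma unit_mollifier_eq_0: "1 \<le> norm y \<Longrightarrow> unit_mollifier y = 0"
  by (simp add: unit_mollifier_def dot_square_norm)

lemma integral_unit_mollifier: "(\<integral>y. unit_mollifier (y::'a::euclidean_space) \<partial>lborel) = 1"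
  using bump_mass_pos[where 'a='a] by (simp add: unit_mollifier_def bump_mass_def)

text \<open>The right-hand side is minus the divergence of
  \<open>unit_mollifier y *\<^sub>R y\<close>, which is exactly what differentiating a rescaled
  mollifier in its scale produces.\<close>

lemma laplacian_bump:
  fixes y :: "'a::euclidean_space"
  shows "laplacian bump y = - real DIM('a) * unit_mollifier y
    + (y \<bullet> y) * 4 * smooth_step 2 (1 - y \<bullet> y) / bump_mass TYPE('a)"
proof -
  let ?m = "bump_mass TYPE('a)"
  have 1: "frechet_derivative bump (at y) = (\<lambda>h. - (y \<bullet> h) * unit_mollifier y)" for y :: 'a
  proof (rule frechet_derivative_at[symmetric])
    show "(bump has_derivative (\<lambda>h. - (y \<bullet> h) * unit_mollifier y)) (at y)"
      unfolding bump_def[abs_def] unit_mollifier_def divide_inverse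
      by (rule has_derivative_eq_rhs[OF has_derivative_mult_left[OF smooth_step_radial_has_derivative]])
        (simp add: fun_eq_iff)
  qed
  have 2: "frechet_derivative (\<lambda>y. frechet_derivative bump (at y) i) (at y) i
      = - unit_mollifier y + (y \<bullet> i)\<^sup>2 * (4 * smooth_step 2 (1 - y \<bullet> y) / ?m)" if "i \<in> Basis" for i
  proof -
    have um: "(unit_mollifier has_derivative (\<lambda>h. - 4 * (y \<bullet> h) * smooth_step 2 (1 - y \<bullet> y) / ?m)) (at y)"
      unfolding unit_mollifier_def[abs_def] divide_inverse
      by (rule has_derivative_eq_rhs[OF has_derivative_mult_left[OF has_derivative_mult_right[OF smooth_step_radial_has_derivative]]])
        (simp add: fun_eq_iff numeral_2_eq_2)
    have "((\<lambda>y. - (y \<bullet> i) * unit_mollifier y) has_derivative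
       (\<lambda>h. - (y \<bullet> i) * (- 4 * (y \<bullet> h) * smooth_step 2 (1 - y \<bullet> y) / ?m) + - (h \<bullet> i) * unit_mollifier y)) (at y)"
      by (rule has_derivative_mult[OF _ um]) (auto intro!: derivative_eq_intros)
    from frechet_derivative_at[OF this, symmetric] that show ?thesis
      unfolding 1 by (simp add: power2_eq_square)
  qed
  show ?thesis
  proof -
    define Q where "Q = 4 * smooth_step 2 (1 - y \<bullet> y) / ?m"
    have "laplacian bump y = (\<Sum>i\<in>Basis. - unit_mollifier y + (y \<bullet> i)\<^sup>2 * Q)"
      unfolding laplacian_def Q_def by (rule sum.cong[OF refl 2])
    also have "\<dots> = - real DIM('a) * unit_mollifier y + (y \<bullet> y) * Q"
      by (subst euclidean_inner[of y y]) (simp add: sum.distrib power2_eq_square sum_distrib_right sum_subtractf)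
    finally show ?thesis
      by (simp add: Q_def)
  qed
qed

text \<open>For a kernel rescaled with preserved mass, the derivative in the scale is, up to a power
  of the scale, minus the divergence of the kernel times the position. By
  \<open>laplacian_bump\<close> this divergence is a Laplacian.\<close>

lemma mollifier_has_derivative_scale:
  fixes x :: "'a::euclidean_space"
  assumes "\<sigma> > 0"
  shows "((\<lambda>\<sigma>. mollifier \<sigma> x) has_real_derivative
    inverse \<sigma> ^ (DIM('a) + 1) * laplacian bump (inverse \<sigma> *\<^sub>R x)) (at \<sigma>)"
proof -
  let ?m = "bump_mass TYPE('a)" and ?N = "DIM('a)" and ?T = "x \<bullet> x"
  obtain n where n: "?N = Suc n"
    using DIM_positive[where 'a='a] by (cases "?N") auto
  \<comment> \<open>In the variable \<open>a\<close> the mollifier is a power times a smooth step of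
    a quadratic polynomial; the factor \<open>- a\<^sup>2\<close> comes in at the end by the chain
    rule.\<close>
  define a where "a = inverse \<sigma>"
  have inv: "(inverse has_real_derivative - a\<^sup>2) (at \<sigma>)"
    using assms by (auto intro!: derivative_eq_intros simp: a_def power2_eq_square)
  have st: "((\<lambda>a. smooth_step 1 (1 - a * a * ?T)) has_real_derivative
      smooth_step 2 (1 - a * a * ?T) * (- (2 * a * ?T))) (at a)"
    unfolding numeral_2_eq_2
    by (rule DERIV_chain2[where f="smooth_step 1" and g="\<lambda>a. 1 - a * a * ?T"])
      (auto intro!: derivative_eq_intros smooth_step_has_derivative[of "Suc 0"])
  have "((\<lambda>a. a ^ Suc n * (2 * smooth_step 1 (1 - a * a * ?T) / ?m)) has_real_derivative
     (real (Suc n) * a ^ n) * (2 * smooth_step 1 (1 - a * a * ?T) / ?m)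
     + (2 * (smooth_step 2 (1 - a * a * ?T) * (- (2 * a * ?T))) / ?m) * a ^ Suc n) (at a)"
    using DERIV_pow[of "Suc n" a] by (intro DERIV_mult[OF _ DERIV_cdivide[OF DERIV_cmult[OF st]]]) simp
  then have "((\<lambda>a. a ^ Suc n * (2 * smooth_step 1 (1 - a * a * ?T) / ?m)) has_real_derivative
     (real (Suc n) * a ^ n) * (2 * smooth_step 1 (1 - a * a * ?T) / ?m)
     + (2 * (smooth_step 2 (1 - a * a * ?T) * (- (2 * a * ?T))) / ?m) * a ^ Suc n) (at (inverse \<sigma>))"
    by (simp only: a_def)
  from DERIV_chain2[OF this inv]
  have "((\<lambda>\<sigma>. inverse \<sigma> ^ Suc n * (2 * smooth_step 1 (1 - inverse \<sigma> * inverse \<sigma> * ?T) / ?m)) has_real_derivative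
     ((real (Suc n) * a ^ n) * (2 * smooth_step 1 (1 - a * a * ?T) / ?m)
     + (2 * (smooth_step 2 (1 - a * a * ?T) * (- (2 * a * ?T))) / ?m) * a ^ Suc n) * - a\<^sup>2) (at \<sigma>)" .
  also have "((real (Suc n) * a ^ n) * (2 * smooth_step 1 (1 - a * a * ?T) / ?m)
     + (2 * (smooth_step 2 (1 - a * a * ?T) * (- (2 * a * ?T))) / ?m) * a ^ Suc n) * - a\<^sup>2
     = a ^ (?N + 1) * laplacian bump (a *\<^sub>R x)"
    unfolding laplacian_bump unit_mollifier_def n
    by (simp add: algebra_simps power2_eq_square divide_inverse)
  finally show ?thesis
    unfolding mollifier_def unit_mollifier_def n
    by (simp add: a_def mult.assoc)
qed

text \<open>Differentiating twice under the integral over scales turns the integrand into the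
  derivative of \<open>mollifier \<sigma> x\<close> in \<sigma>, and the fundamental theorem of
  calculus leaves the two end scales.\<close>

lemma potential_kernel_facts:
  fixes x :: "'a::euclidean_space"
  assumes s: "0 < s" "s \<le> r"
  shows potential_kernel_Ck: "Ck_on k UNIV (potential_kernel s r :: 'a \<Rightarrow> real)"
    and laplacian_potential_kernel: "laplacian (potential_kernel s r) x = mollifier r x - mollifier s x"
proof -
  let ?N = "DIM('a)"
  define c where "c = (\<lambda>\<sigma>. indicator {s..r} \<sigma> * inverse \<sigma> ^ (?N - 1) :: real)"
  \<comment> \<open>The indicator is put into \<open>a\<close> as well, so that the inverse scale is
    bounded on the whole line; where it changes \<open>a\<close>, the weight \<open>c\<close>
    vanishes.\<close>
  define a where "a = (\<lambda>\<sigma>. indicator {s..r} \<sigma> * inverse \<sigma> :: real)"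
  have [measurable]: "a \<in> borel_measurable borel" "c \<in> borel_measurable borel"
    by (simp_all add: a_def c_def)
  have a_bd: "\<bar>a \<sigma>\<bar> \<le> inverse s" for \<sigma>
    using s by (auto simp: a_def indicator_def)
  have c_bd: "\<bar>c \<sigma>\<bar> \<le> indicator {s..r} \<sigma> * inverse s ^ (?N - 1)" for \<sigma>
    using s by (auto simp: c_def indicator_def intro!: power_mono)
  have c: "integrable lborel c"
    by (rule Bochner_Integration.integrable_bound[of _ "\<lambda>\<sigma>. indicator {s..r} \<sigma> * inverse s ^ (?N - 1)"])
      (use c_bd s in \<open>auto intro!: integrable_mult_left integrable_real_indicator AE_I2 simp: emeasure_lborel_Icc_eq abs_mult\<close>)
  have ca: "integrable lborel (\<lambda>\<sigma>. c \<sigma> * a \<sigma>)"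
    by (rule Bochner_Integration.integrable_bound[OF integrable_mult_left[OF integrable_abs[OF c], of "inverse s"]])
      (use a_bd s in \<open>auto simp: abs_mult intro!: AE_I2 mult_left_mono\<close>)
  have eq: "potential_kernel s r x = (\<integral>\<sigma>. c \<sigma> * bump (a \<sigma> *\<^sub>R (x - 0)) \<partial>lborel)" for x :: 'a
    unfolding potential_kernel_def c_def a_def
    by (intro Bochner_Integration.integral_cong) (auto simp: indicator_def)
  show "Ck_on k UNIV (potential_kernel s r :: 'a \<Rightarrow> real)"
    unfolding eq[abs_def] by (rule Ck_on_integral_affine[OF bump_Cc c _ _ a_bd]) auto
  have 1: "frechet_derivative (potential_kernel s r) (at x) i
      = (\<integral>\<sigma>. c \<sigma> * a \<sigma> * frechet_derivative bump (at (a \<sigma> *\<^sub>R (x - 0))) i \<partial>lborel)" if i: "i \<in> Basis" for i x :: 'a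
    using frechet_derivative_at[OF has_derivative_integral_affine[OF bump_Cc c _ _ a_bd, where b="\<lambda>_. 0" and x=x], symmetric] i
    unfolding eq[abs_def] by (simp add: grad_inner_Basis inner_commute[of i])
  have 2: "frechet_derivative (\<lambda>y. frechet_derivative (potential_kernel s r) (at y) i) (at x) i
      = (\<integral>\<sigma>. c \<sigma> * a \<sigma> * a \<sigma> * frechet_derivative (\<lambda>y. frechet_derivative bump (at y) i) (at (a \<sigma> *\<^sub>R x)) i \<partial>lborel)"
    if i: "i \<in> Basis" for i x :: 'a
    using frechet_derivative_at[OF has_derivative_integral_affine[OF Cc_infinity_partial[OF bump_Cc i] ca _ _ a_bd, where b="\<lambda>_. 0" and x=x], symmetric] i
    by (simp add: 1 grad_inner_Basis inner_commute[of i])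
  have int: "integrable lborel (\<lambda>\<sigma>. c \<sigma> * a \<sigma> * a \<sigma> * \<phi> (a \<sigma> *\<^sub>R x))" if \<phi>: "\<phi> \<in> Cc_infinity UNIV" for \<phi>
  proof -
    note [measurable] = Cc_infinity_borel[OF \<phi>]
    obtain B where B: "B \<ge> 0" "\<And>x. \<bar>\<phi> x\<bar> \<le> B" using \<phi> by (rule Cc_infinity_bounded) blast
    have "\<bar>a \<sigma>\<bar> * \<bar>\<phi> (a \<sigma> *\<^sub>R x)\<bar> \<le> inverse s * B" for \<sigma>
      using a_bd[of \<sigma>] B s by (intro mult_mono) auto
    then show ?thesis
      by (intro Bochner_Integration.integrable_bound[OF integrable_mult_left[OF integrable_abs[OF ca], of "inverse s * B"]])
        (use B s in \<open>auto simp: abs_mult mult.assoc intro!: AE_I2 mult_left_mono\<close>)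
  qed
  have "laplacian (potential_kernel s r) x = (\<integral>\<sigma>. c \<sigma> * a \<sigma> * a \<sigma> * laplacian bump (a \<sigma> *\<^sub>R x) \<partial>lborel)"
    unfolding laplacian_def sum_distrib_left
    by (subst Bochner_Integration.integral_sum)
      (auto simp: 2 intro!: int Cc_infinity_partial bump_Cc)
  also have "\<dots> = (\<integral>\<sigma>. (inverse \<sigma> ^ (?N + 1) * laplacian bump (inverse \<sigma> *\<^sub>R x)) * indicator {s..r} \<sigma> \<partial>lborel)"
  proof (intro Bochner_Integration.integral_cong refl)
    fix \<sigma> :: real
    \<comment> \<open>Each of the two derivatives contributes one inverse scale, which raises the
      exponent from \<open>?N - 1\<close> to \<open>?N + 1\<close>; positivity of the dimension
      makes the natural subtraction harmless.\<close>
    have "inverse \<sigma> ^ (?N - 1) * inverse \<sigma> * inverse \<sigma> = inverse \<sigma> ^ (?N + 1)"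
      using DIM_positive[where 'a='a] by (cases "?N") auto
    then show "c \<sigma> * a \<sigma> * a \<sigma> * laplacian bump (a \<sigma> *\<^sub>R x)
        = (inverse \<sigma> ^ (?N + 1) * laplacian bump (inverse \<sigma> *\<^sub>R x)) * indicator {s..r} \<sigma>"
      by (auto simp: c_def a_def indicator_def)
  qed
  also have "\<dots> = mollifier r x - mollifier s x"
  proof (rule integral_FTC_Icc_real[OF s(2)])
    fix \<sigma> assume "s \<le> \<sigma>" "\<sigma> \<le> r"
    then have pos: "\<sigma> > 0" using s by simp
    show "((\<lambda>\<sigma>. mollifier \<sigma> x) has_real_derivative
        inverse \<sigma> ^ (?N + 1) * laplacian bump (inverse \<sigma> *\<^sub>R x)) (at \<sigma>)"
      by (rule mollifier_has_derivative_scale[OF pos])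
    have lap: "isCont (laplacian (bump :: 'a \<Rightarrow> real)) y" for y
      by (rule continuous_on_interior[OF laplacian_continuous[OF bump_Cc]]) simp
    have inv: "isCont (\<lambda>\<sigma>. inverse \<sigma>) \<sigma>"
      using pos by (intro continuous_at_within_inverse continuous_ident) simp
    have "isCont (\<lambda>\<sigma>. laplacian bump (inverse \<sigma> *\<^sub>R x)) \<sigma>"
      by (rule isCont_o2[OF continuous_scaleR[OF inv continuous_const] lap])
    then show "isCont (\<lambda>\<sigma>. inverse \<sigma> ^ (?N + 1) * laplacian bump (inverse \<sigma> *\<^sub>R x)) \<sigma>"
      by (rule isCont_mult[OF isCont_power[OF inv]])
  qed
  finally show "laplacian (potential_kernel s r) x = mollifier r x - mollifier s x" .
qed

lemma mollifier_eq_0: "s > 0 \<Longrightarrow> s \<le> norm x \<Longrightarrow> mollifier s x = 0"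
  unfolding mollifier_def by (subst unit_mollifier_eq_0) (auto simp: field_simps)

lemma mollifier_nonneg: "s > 0 \<Longrightarrow> mollifier s x \<ge> 0"
  by (simp add: mollifier_def unit_mollifier_nonneg)

lemma mollifier_Cc:
  assumes "s > 0"
  shows "mollifier s \<in> Cc_infinity (UNIV :: 'a::euclidean_space set)"
proof (rule Cc_infinityI)
  fix k
  let ?a = "inverse s"
  have "Ck_on k UNIV (\<lambda>x::'a. (?a ^ DIM('a) * 2 / bump_mass TYPE('a)) *
      smooth_step 1 (1 + (- (?a * ?a)) * (x \<bullet> x)))"
    by (intro Ck_on_cmult Ck_on_smooth_step_compose Ck_on_add Ck_on_const Ck_on_inner_self)
  then show "Ck_on k UNIV (mollifier s :: 'a \<Rightarrow> real)"
    by (simp add: mollifier_def[abs_def] unit_mollifier_def mult.assoc)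
next
  show "compact (cball 0 s :: 'a set)" by simp
  show "mollifier s x = 0" if "x \<notin> cball 0 s" for x :: 'a
    using that assms by (simp add: mollifier_eq_0)
qed auto

lemma mollifier_borel [measurable]: "mollifier s \<in> borel_measurable borel"
  unfolding mollifier_def[abs_def] using Cc_infinity_borel[OF unit_mollifier_Cc] by measurable

lemma integral_mollifier_shift:
  assumes "s > 0"
  shows "(\<integral>x. mollifier s (x - y) \<partial>lborel) = (1 :: real)"
    and "(\<integral>x. mollifier s (y - x) \<partial>lborel) = (1 :: real)"
proof -
  have 1: "(\<integral>x. mollifier s (x :: 'a) \<partial>lborel) = 1"
    using lborel_integral_affine[of "mollifier s :: 'a \<Rightarrow> real" s 0] assms
    by (simp add: mollifier_def integral_unit_mollifier power_inverse)
  show "(\<integral>x. mollifier s (x - y) \<partial>lborel) = (1 :: real)"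
    using lborel_integral_affine[of "\<lambda>x. mollifier s (x - y)" 1 y] 1 by simp
  show "(\<integral>x. mollifier s (y - x) \<partial>lborel) = (1 :: real)"
    using lborel_integral_affine[of "\<lambda>x. mollifier s (y - x)" "-1" y] 1 by simp
qed

text \<open>The Bochner integral of a non-integrable function is zero by convention, so the value
  one already shows integrability.\<close>

lemma integrable_mollifier_shift:
  assumes "s > 0"
  shows "integrable lborel (\<lambda>x. mollifier s (x - y))" "integrable lborel (\<lambda>x. mollifier s (y - x))"
  using integral_mollifier_shift[OF assms, of y] not_integrable_integral_eq
  by (metis zero_neq_one)+

lemma potential_kernel_nonneg: "0 < s \<Longrightarrow> potential_kernel s r x \<ge> 0"
  unfolding potential_kernel_def
  by (intro Bochner_Integration.integral_nonneg) (auto simp: bump_nonneg indicator_def)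

lemma potential_kernel_eq_0:
  assumes "0 < s" "r \<le> norm x"
  shows "potential_kernel s r x = 0"
proof -
  have "indicator {s..r} \<sigma> * inverse \<sigma> ^ k * bump (inverse \<sigma> *\<^sub>R x) = 0" for \<sigma> k
    using assms by (auto simp: indicator_def field_simps intro!: bump_eq_0)
  then show ?thesis
    unfolding potential_kernel_def by (simp only: Bochner_Integration.integral_zero)
qed

lemma potential_kernel_Cc:
  assumes "0 < s" "s \<le> r"
  shows "potential_kernel s r \<in> Cc_infinity (UNIV :: 'a::euclidean_space set)"
proof (rule Cc_infinityI[OF potential_kernel_Ck[OF assms]])
  show "compact (cball 0 r :: 'a set)" by simp
  show "potential_kernel s r x = 0" if "x \<notin> cball 0 r" for x :: 'a
    using that assms by (simp add: potential_kernel_eq_0)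
qed auto

section \<open>Convolutions with measures\<close>

lemma partial_convolution:
  fixes \<phi> :: "'a::euclidean_space \<Rightarrow> real"
  assumes \<phi>: "\<phi> \<in> Cc_infinity UNIV" and c: "integrable M c" and M: "sets M = sets borel" and i: "i \<in> Basis"
  shows "frechet_derivative (\<lambda>x. \<integral>y. c y * \<phi> (x - y) \<partial>M) (at x) i
    = (\<integral>y. c y * frechet_derivative \<phi> (at (x - y)) i \<partial>M)"
proof -
  have "(\<lambda>y. y) \<in> borel_measurable M"
    using M by (simp add: measurable_ident_sets)
  from frechet_derivative_at[OF has_derivative_integral_affine[OF \<phi> c _ this, of "\<lambda>_. 1" 1 x], symmetric]
  show ?thesis
    using i by (simp add: grad_inner_Basis inner_commute[of i])
qed

lemma Ck_on_convolution:
  fixes \<phi> :: "'a::euclidean_space \<Rightarrow> real"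
  assumes \<phi>: "\<phi> \<in> Cc_infinity UNIV" and c: "integrable M c" and M: "sets M = sets borel"
  shows "Ck_on k UNIV (\<lambda>x. \<integral>y. c y * \<phi> (x - y) \<partial>M)"
proof -
  have "(\<lambda>y. y) \<in> borel_measurable M"
    using M by (simp add: measurable_ident_sets)
  from Ck_on_integral_affine[OF \<phi> c _ this, of "\<lambda>_. 1" 1 k] show ?thesis
    by simp
qed

lemma integrable_convolution:
  fixes \<phi> :: "'a::euclidean_space \<Rightarrow> real"
  assumes \<phi>: "\<phi> \<in> borel_measurable borel" "\<And>x. \<bar>\<phi> x\<bar> \<le> B" and c: "integrable M c" and M: "sets M = sets borel"
  shows "integrable M (\<lambda>y. c y * \<phi> (x - y))"
proof -
  note [measurable] = \<phi>(1) and [measurable_cong] = M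
  have B: "B \<ge> 0" using \<phi>(2)[of 0] by simp
  show ?thesis
    by (rule Bochner_Integration.integrable_bound[OF integrable_mult_left[OF integrable_abs[OF c], of B]])
      (use \<phi>(2) B c in \<open>auto simp: abs_mult intro!: mult_left_mono\<close>)
qed

lemma integrable_convolution_Cc:
  fixes \<phi> :: "'a::euclidean_space \<Rightarrow> real"
  assumes \<phi>: "\<phi> \<in> Cc_infinity UNIV" and c: "integrable M c" and M: "sets M = sets borel"
  shows "integrable M (\<lambda>y. c y * \<phi> (x - y))"
proof -
  obtain B where B: "\<And>x. \<bar>\<phi> x\<bar> \<le> B" using \<phi> by (rule Cc_infinity_bounded) blast
  show ?thesis
    by (rule integrable_convolution[OF Cc_infinity_borel[OF \<phi>] B c M])
qed

lemma laplacian_convolution: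
  fixes \<phi> :: "'a::euclidean_space \<Rightarrow> real"
  assumes \<phi>: "\<phi> \<in> Cc_infinity UNIV" and c: "integrable M c" and M: "sets M = sets borel"
  shows "laplacian (\<lambda>x. \<integral>y. c y * \<phi> (x - y) \<partial>M) x = (\<integral>y. c y * laplacian \<phi> (x - y) \<partial>M)"
proof -
  let ?d = "\<lambda>i x. frechet_derivative \<phi> (at x) i"
  have d: "?d i \<in> Cc_infinity UNIV" "(\<lambda>x. frechet_derivative (?d i) (at x) i) \<in> Cc_infinity UNIV" if "i \<in> Basis" for i
    using Cc_infinity_partial[OF \<phi> that] Cc_infinity_partial[OF Cc_infinity_partial[OF \<phi> that] that] by auto
  have "laplacian (\<lambda>x. \<integral>y. c y * \<phi> (x - y) \<partial>M) x
      = (\<Sum>i\<in>Basis. \<integral>y. c y * frechet_derivative (?d i) (at (x - y)) i \<partial>M)"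
    unfolding laplacian_def
    by (rule sum.cong[OF refl]) (simp add: partial_convolution[OF \<phi> c M] partial_convolution[OF d(1) c M])
  also have "\<dots> = (\<integral>y. (\<Sum>i\<in>Basis. c y * frechet_derivative (?d i) (at (x - y)) i) \<partial>M)"
    by (rule Bochner_Integration.integral_sum[symmetric]) (rule integrable_convolution_Cc[OF d(2) c M])
  finally show ?thesis
    by (simp add: laplacian_def sum_distrib_left)
qed

text \<open>The support is contained in the Minkowski sum of \<open>L\<close> and a closed ball,
  which is compact and by hypothesis inside \<Omega>.\<close>

lemma convolution_Cc:
  fixes \<phi> :: "'a::euclidean_space \<Rightarrow> real"
  assumes \<phi>: "\<phi> \<in> Cc_infinity UNIV" and c: "integrable M c" and M: "sets M = sets borel"
    and L: "compact L" "\<And>y. y \<notin> L \<Longrightarrow> c y = 0" and r: "\<And>x. r < norm x \<Longrightarrow> \<phi> x = 0"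
    and \<Omega>: "(\<Union>y\<in>L. cball y r) \<subseteq> \<Omega>"
  shows "(\<lambda>x. \<integral>y. c y * \<phi> (x - y) \<partial>M) \<in> Cc_infinity \<Omega>"
proof (rule Cc_infinityI[OF Ck_on_convolution[OF \<phi> c M]])
  let ?K = "{y + z | y z. y \<in> L \<and> z \<in> cball 0 r}"
  show "compact ?K"
    using L(1) by (intro compact_sums) auto
  show "?K \<subseteq> \<Omega>"
    using \<Omega> by (force simp: dist_norm)
  fix x assume x: "x \<notin> ?K"
  have "c y * \<phi> (x - y) = 0" for y
  proof (cases "y \<in> L")
    case True
    have "x - y \<notin> cball 0 r"
    proof
      assume "x - y \<in> cball 0 r"
      then have "x \<in> ?K"
        by (intro CollectI exI[of _ y] exI[of _ "x - y"]) (simp add: True)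
      with x show False by contradiction
    qed
    then show ?thesis by (simp add: r)
  qed (simp add: L)
  then show "(\<integral>y. c y * \<phi> (x - y) \<partial>M) = 0"
    by (simp only: Bochner_Integration.integral_zero)
qed

lemma compact_neighbourhood_radius:
  fixes L :: "'a::euclidean_space set"
  assumes "compact L" "open \<Omega>" "L \<subseteq> \<Omega>"
  obtains d where "d > 0" "(\<Union>y\<in>L. cball y d) \<subseteq> \<Omega>"
proof -
  have "closed (- \<Omega>)" "L \<inter> - \<Omega> = {}"
    using assms by auto
  with separate_compact_closed[OF assms(1)]
  obtain d where d: "d > 0" "\<And>x y. x \<in> L \<Longrightarrow> y \<in> - \<Omega> \<Longrightarrow> d \<le> dist x y"
    by metis
  show ?thesis
    by (rule that[of "d / 2"]) (use d in \<open>force simp: not_le\<close>)+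
qed

section \<open>Uniqueness of weak gradients\<close>

text \<open>The indicator of the \<open>e n\<close>-neighbourhood of \<open>K\<close> is mollified
  at scale \<open>e n\<close>: the result is 1 on \<open>K\<close> and 0 off the neighbourhood of
  width \<open>2 * e n\<close>. The two widths together stay within the distance \<open>d\<close>
  available in \<Omega>, so one compact set carries all the supports.\<close>

lemma indicator_compact_approximation:
  fixes K :: "'a::euclidean_space set"
  assumes K: "compact K" and \<Omega>: "open \<Omega>" "K \<subseteq> \<Omega>"
  obtains \<phi> :: "nat \<Rightarrow> 'a \<Rightarrow> real" and K' where "compact K'" "K' \<subseteq> \<Omega>" "\<And>n. \<phi> n \<in> Cc_infinity \<Omega>"
    "\<And>n x. \<bar>\<phi> n x\<bar> \<le> 1" "\<And>n x. x \<notin> K' \<Longrightarrow> \<phi> n x = 0" "\<And>x. (\<lambda>n. \<phi> n x) \<longlonglongrightarrow> indicator K x"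
proof -
  obtain d where d: "d > 0" "(\<Union>y\<in>K. cball y d) \<subseteq> \<Omega>"
    using compact_neighbourhood_radius[OF K \<Omega>] .
  define e where "e n = d / 2 / real (Suc n)" for n
  have e: "e n > 0" "2 * e n \<le> d" for n
    using d by (auto simp: e_def field_simps)
  have e0: "e \<longlonglongrightarrow> 0"
    unfolding e_def by (rule LIMSEQ_Suc[OF lim_const_over_n])
  define N where "N t = {y + z | y z. y \<in> K \<and> z \<in> cball (0::'a) t}" for t
  have N_compact: "compact (N t)" for t
    unfolding N_def using K by (intro compact_sums) auto
  have N_iff: "x \<in> N t \<longleftrightarrow> (\<exists>y\<in>K. norm (x - y) \<le> t)" for x t
    unfolding N_def by (force intro: exI[of _ "x - y" for y])
  have [measurable]: "N t \<in> sets borel" for t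
    using N_compact by (rule borel_compact)
  define \<phi> where "\<phi> n x = (\<integral>y. indicator (N (e n)) y * mollifier (e n) (x - y) \<partial>lborel)" for n x
  have int: "integrable lborel (indicator (N t) :: 'a \<Rightarrow> real)" for t
    using N_compact[of t] by (intro integrable_real_indicator emeasure_bounded_finite compact_imp_bounded) auto
  have sub: "(\<Union>y\<in>N (e n). cball y (e n)) \<subseteq> N d" for n
  proof safe
    fix x y assume "y \<in> N (e n)" "x \<in> cball y (e n)"
    then obtain z where "z \<in> K" "norm (y - z) \<le> e n" "norm (x - y) \<le> e n"
      unfolding N_iff by (auto simp: dist_norm norm_minus_commute)
    moreover have "norm (x - z) \<le> norm (x - y) + norm (y - z)"
      using norm_triangle_ineq[of "x - y" "y - z"] by simp
    ultimately show "x \<in> N d"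
      unfolding N_iff using e(2)[of n] by (intro bexI[of _ z]) auto
  qed
  have N\<Omega>: "N d \<subseteq> \<Omega>"
    using d(2) by (force simp: N_iff dist_norm norm_minus_commute)
  have \<phi>_Cc: "\<phi> n \<in> Cc_infinity (N d)" for n
    unfolding \<phi>_def using e(1)[of n] sub
    by (intro convolution_Cc[OF mollifier_Cc int _ N_compact, of _ _ "e n" "e n"])
      (auto simp: mollifier_eq_0)
  have eq: "\<phi> n x = 1" if x: "x \<in> K" for x n
  proof -
    have "indicator (N (e n)) y * mollifier (e n) (x - y) = mollifier (e n) (x - y)" for y
      using x e(1)[of n] mollifier_eq_0[of "e n" "x - y"]
      by (cases "norm (x - y) \<le> e n") (auto simp: N_iff norm_minus_commute indicator_def)
    then show ?thesis
      using integral_mollifier_shift(2)[OF e(1), of n x] by (simp only: \<phi>_def)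
  qed
  have zero: "\<phi> n x = 0" if x: "x \<notin> N (2 * e n)" for x n
  proof -
    have "indicator (N (e n)) y * mollifier (e n) (x - y) = 0" for y
    proof (cases "y \<in> N (e n)")
      case True
      then obtain z where z: "z \<in> K" "norm (y - z) \<le> e n" by (auto simp: N_iff)
      have "norm (x - z) \<le> norm (x - y) + norm (y - z)"
        using norm_triangle_ineq[of "x - y" "y - z"] by simp
      with x z have "e n \<le> norm (x - y)"
        unfolding N_iff by force
      then show ?thesis using e(1) by (simp add: mollifier_eq_0)
    qed simp
    then show ?thesis
      by (simp only: \<phi>_def Bochner_Integration.integral_zero)
  qed
  have bd: "\<bar>\<phi> n x\<bar> \<le> 1" for n x
  proof -
    have "0 \<le> \<phi> n x"
      unfolding \<phi>_def by (intro Bochner_Integration.integral_nonneg mult_nonneg_nonneg mollifier_nonneg e(1)) simp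
    moreover have "\<phi> n x \<le> (\<integral>y. mollifier (e n) (x - y) \<partial>lborel)"
      unfolding \<phi>_def
      by (intro Bochner_Integration.integral_mono integrable_convolution_Cc[OF mollifier_Cc[OF e(1)] int]
          integrable_mollifier_shift(2) e(1))
        (auto simp: indicator_def mollifier_nonneg[OF e(1)])
    ultimately show ?thesis
      using integral_mollifier_shift(2)[OF e(1), of n x] by simp
  qed
  have lim: "(\<lambda>n. \<phi> n x) \<longlonglongrightarrow> indicator K x" for x
  proof (cases "x \<in> K")
    case False
    obtain t where t: "t > 0" "\<And>y. y \<in> K \<Longrightarrow> t \<le> dist x y"
      using separate_compact_closed[of "{x}" K] K False by (auto simp: compact_imp_closed)
    have "\<forall>\<^sub>F n in sequentially. e n < t / 2"
      using order_tendstoD(2)[OF e0, of "t / 2"] t by simp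
    then have "\<forall>\<^sub>F n in sequentially. \<phi> n x = 0"
    proof eventually_elim
      case (elim n)
      have "x \<notin> N (2 * e n)"
        unfolding N_iff using t(2) elim by (force simp: dist_norm)
      then show ?case by (rule zero)
    qed
    then show ?thesis
      using False by (simp add: tendsto_eventually)
  qed (simp add: eq)
  show ?thesis
  proof (rule that[OF N_compact[of d] N\<Omega> _ bd _ lim])
    show "\<phi> n \<in> Cc_infinity \<Omega>" for n
      by (rule Cc_infinity_mono[OF \<phi>_Cc N\<Omega>])
    show "\<phi> n x = 0" if "x \<notin> N d" for n x
      by (rule Cc_infinity_outside[OF \<phi>_Cc that])
  qed
qed

text \<open>By inner regularity the part of \<open>C n\<close> where \<open>g\<close> is positive
  is, up to a null set, a countable union of compact sets. On each of these a positive function has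
  nonpositive integral, so each is null.\<close>

lemma negligible_if_integrals_nonpos:
  fixes g :: "'a::euclidean_space \<Rightarrow> real"
  assumes \<Omega>: "open \<Omega>" and g: "locally_integrable_on \<Omega> g"
    and le: "\<And>K. compact K \<Longrightarrow> K \<subseteq> \<Omega> \<Longrightarrow> (\<integral>x. g x \<partial>lebesgue_on K) \<le> 0"
  shows "AE x in lebesgue. x \<in> \<Omega> \<longrightarrow> g x \<le> 0"
proof -
  obtain C where C: "\<And>n::nat. compact (C n)" "\<And>n. C n \<subseteq> \<Omega>" "(\<Union>n. C n) = \<Omega>"
    using open_Union_compact_subsets[OF \<Omega>] by metis
  have "AE x in lebesgue. x \<in> C n \<longrightarrow> g x \<le> 0" for n
  proof -
    have [measurable]: "C n \<in> sets lebesgue" using C(1) by (auto simp: borel_compact)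
    have "g \<in> borel_measurable (lebesgue_on (C n))"
      using g C unfolding locally_integrable_on_def by (blast intro: borel_measurable_integrable)
    then have "{x \<in> space (lebesgue_on (C n)). g x > 0} \<in> sets (lebesgue_on (C n))"
      by measurable
    then have "{x \<in> C n. g x > 0} \<in> sets lebesgue"
      by (simp add: sets_restrict_space_iff)
    then obtain N D where N: "negligible N" and D: "\<And>m::nat. compact (D m)"
        and eq: "{x \<in> C n. g x > 0} = (\<Union>m. D m) \<union> N"
      by (rule lebesgue_regular_inner) blast
    have "AE x in lebesgue. x \<notin> D m" for m
    proof -
      have sub: "D m \<subseteq> {x \<in> C n. g x > 0}" using eq by blast
      then have sub': "D m \<subseteq> \<Omega>" using C by blast
      have [measurable]: "D m \<in> sets lebesgue" using D by (auto simp: borel_compact)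
      have int: "integrable (lebesgue_on (D m)) g"
        using g D sub' unfolding locally_integrable_on_def by blast
      have nn: "AE x in lebesgue_on (D m). 0 \<le> g x"
        using sub by (auto intro!: AE_I2)
      have "(\<integral>x. g x \<partial>lebesgue_on (D m)) = 0"
        using le[OF D sub'] integral_nonneg_AE[OF nn] by linarith
      then have "AE x in lebesgue_on (D m). g x = 0"
        using integral_nonneg_eq_0_iff_AE[OF int nn] by blast
      then have "AE x in lebesgue. x \<in> D m \<longrightarrow> g x = 0"
        by (simp add: AE_restrict_space_iff)
      then show ?thesis
        by (rule eventually_mono) (use sub in fastforce)
    qed
    then have "AE x in lebesgue. \<forall>m. x \<notin> D m"
      by (simp add: AE_all_countable)
    moreover have "AE x in lebesgue. x \<notin> N"
      using N by (simp add: negligible_iff_null_sets AE_not_in)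
    ultimately show ?thesis
    proof eventually_elim
      case (elim x)
      then have "x \<notin> {x \<in> C n. g x > 0}"
        unfolding eq by blast
      then show ?case by auto
    qed
  qed
  then have "AE x in lebesgue. \<forall>n. x \<in> C n \<longrightarrow> g x \<le> 0"
    by (subst AE_all_countable) blast
  then show ?thesis
    by (rule eventually_mono) (use C(3) in blast)
qed

text \<open>Testing with smooth approximations of the indicator of a compact set shows that
  \<open>g\<close> has integral zero over every compact subset of \<Omega>; the previous lemma then
  applies to \<open>g\<close> and to \<open>- g\<close>.\<close>

lemma fundamental_lemma:
  fixes g :: "'a::euclidean_space \<Rightarrow> real"
  assumes \<Omega>: "open \<Omega>" and g: "locally_integrable_on \<Omega> g"
    and 0: "\<And>\<phi>. \<phi> \<in> Cc_infinity \<Omega> \<Longrightarrow> (\<integral>x. g x * \<phi> x \<partial>lebesgue_on \<Omega>) = 0"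
  shows "AE x in lebesgue. x \<in> \<Omega> \<longrightarrow> g x = 0"
proof -
  have K0: "(\<integral>x. g x \<partial>lebesgue_on K) = 0" if K: "compact K" "K \<subseteq> \<Omega>" for K
  proof -
    obtain \<phi> K' where \<phi>: "compact K'" "K' \<subseteq> \<Omega>" "\<And>n::nat. \<phi> n \<in> Cc_infinity \<Omega>"
      "\<And>n x. \<bar>\<phi> n x\<bar> \<le> 1" "\<And>n x. x \<notin> K' \<Longrightarrow> \<phi> n x = 0" "\<And>x. (\<lambda>n. \<phi> n x) \<longlonglongrightarrow> indicator K x"
      using indicator_compact_approximation[OF K(1) \<Omega> K(2)] by metis
    have b\<Omega>: "\<Omega> \<in> sets borel" using \<Omega> by simp
    have int: "integrable (lebesgue_on \<Omega>) (\<lambda>x. indicator K' x * g x)"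
      using locally_integrable_mult[OF b\<Omega> g \<phi>(1,2), of "indicator K'" 1] borel_compact[OF \<phi>(1)]
      by auto
    have intK: "integrable (lebesgue_on \<Omega>) (\<lambda>x. indicator K x * g x)"
      using locally_integrable_mult[OF b\<Omega> g K, of "indicator K" 1] borel_compact[OF K(1)]
      by auto
    have "(\<lambda>n. \<integral>x. g x * \<phi> n x \<partial>lebesgue_on \<Omega>) \<longlonglongrightarrow> (\<integral>x. indicator K x * g x \<partial>lebesgue_on \<Omega>)"
    proof (rule integral_dominated_convergence[OF _ _ integrable_abs[OF int]])
      show "(\<lambda>x. g x * \<phi> n x) \<in> borel_measurable (lebesgue_on \<Omega>)" for n
        using locally_integrable_mult_Cc[OF b\<Omega> g \<phi>(3)[of n]] by (auto simp: mult.commute)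
      show "(\<lambda>x. indicator K x * g x) \<in> borel_measurable (lebesgue_on \<Omega>)"
        using intK by auto
      show "AE x in lebesgue_on \<Omega>. (\<lambda>n. g x * \<phi> n x) \<longlonglongrightarrow> indicator K x * g x"
        using tendsto_mult_left[OF \<phi>(6)] by (auto simp: mult.commute)
      have "\<bar>g x * \<phi> n x\<bar> \<le> \<bar>indicator K' x * g x\<bar>" for n x
        using \<phi>(4)[of n x] \<phi>(5)[of x n] mult_left_le[of "\<bar>\<phi> n x\<bar>" "\<bar>g x\<bar>"]
        by (cases "x \<in> K'") (auto simp: abs_mult)
      then show "AE x in lebesgue_on \<Omega>. norm (g x * \<phi> n x) \<le> \<bar>indicator K' x * g x\<bar>" for n
        by simp
    qed
    then have "(\<integral>x. indicator K x * g x \<partial>lebesgue_on \<Omega>) = 0"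
      using 0[OF \<phi>(3)] by (simp add: LIMSEQ_const_iff)
    moreover have "(\<integral>x. indicator K x * g x \<partial>lebesgue_on \<Omega>) = (\<integral>x. g x \<partial>lebesgue_on K)"
      using K \<Omega> by (subst (1 2) integral_restrict_space)
        (auto simp: borel_compact intro!: Bochner_Integration.integral_cong split: split_indicator)
    ultimately show ?thesis by simp
  qed
  have ng: "locally_integrable_on \<Omega> (\<lambda>x. - g x)"
    using g by (auto simp: locally_integrable_on_def)
  have "AE x in lebesgue. x \<in> \<Omega> \<longrightarrow> g x \<le> 0"
    by (rule negligible_if_integrals_nonpos[OF \<Omega> g]) (simp add: K0)
  moreover have "AE x in lebesgue. x \<in> \<Omega> \<longrightarrow> - g x \<le> 0"
    by (rule negligible_if_integrals_nonpos[OF \<Omega> ng]) (simp add: K0)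
  ultimately show ?thesis
    by eventually_elim auto
qed

lemma weak_gradient_unique:
  fixes \<Omega> :: "'a::euclidean_space set"
  assumes \<Omega>: "open \<Omega>" and G: "has_weak_gradient \<Omega> u G" "has_weak_gradient \<Omega> u G'"
  shows "AE x in lebesgue_on \<Omega>. G x = G' x"
proof -
  have loc: "locally_integrable_on \<Omega> G" "locally_integrable_on \<Omega> G'"
    using G by (auto simp: has_weak_gradient_def)
  have b\<Omega>: "\<Omega> \<in> sets borel" using \<Omega> by simp
  have "AE x in lebesgue. x \<in> \<Omega> \<longrightarrow> (G x - G' x) \<bullet> i = 0" if i: "i \<in> Basis" for i
  proof (rule fundamental_lemma[OF \<Omega>])
    show "locally_integrable_on \<Omega> (\<lambda>x. (G x - G' x) \<bullet> i)"
      using loc by (auto simp: locally_integrable_on_def)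
    fix \<phi> assume \<phi>: "\<phi> \<in> Cc_infinity \<Omega>"
    have int: "integrable (lebesgue_on \<Omega>) (\<lambda>x. (H x \<bullet> i) * \<phi> x)" if "locally_integrable_on \<Omega> H" for H :: "'a \<Rightarrow> 'a"
      using integrable_inner_left[OF locally_integrable_mult_Cc[OF b\<Omega> that \<phi>], of i]
      by (simp add: mult.commute)
    have "(\<integral>x. (G x \<bullet> i) * \<phi> x \<partial>lebesgue_on \<Omega>) = (\<integral>x. (G' x \<bullet> i) * \<phi> x \<partial>lebesgue_on \<Omega>)"
      using G \<phi> i unfolding has_weak_gradient_def by fastforce
    then show "(\<integral>x. (G x - G' x) \<bullet> i * \<phi> x \<partial>lebesgue_on \<Omega>) = 0"
      using int[OF loc(1)] int[OF loc(2)] by (simp add: inner_diff_left left_diff_distrib)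
  qed
  then have "AE x in lebesgue. \<forall>i\<in>Basis. x \<in> \<Omega> \<longrightarrow> (G x - G' x) \<bullet> i = 0"
    using eventually_ball_finite[OF finite_Basis, of "\<lambda>x i. x \<in> \<Omega> \<longrightarrow> (G x - G' x) \<bullet> i = 0"] by blast
  then have "AE x in lebesgue. x \<in> \<Omega> \<longrightarrow> G x = G' x"
    by (rule eventually_mono) (auto simp: inner_diff_left intro: euclidean_eqI)
  then show ?thesis
    using \<Omega> by (subst AE_restrict_space_iff) auto
qed

text \<open>Since \<open>weak_grad\<close> is an arbitrary choice, gradients are computed with
  convenient representatives, and only final integrals are transferred to the chosen one by
  uniqueness.\<close>

lemma weak_grad_eq:
  assumes "open \<Omega>" "has_weak_gradient \<Omega> u G"
  shows "has_weak_gradient \<Omega> u (weak_grad \<Omega> u)" "AE x in lebesgue_on \<Omega>. weak_grad \<Omega> u x = G x"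
proof -
  show 1: "has_weak_gradient \<Omega> u (weak_grad \<Omega> u)"
    unfolding weak_grad_def by (rule someI[of "has_weak_gradient \<Omega> u" G, OF assms(2)])
  show "AE x in lebesgue_on \<Omega>. weak_grad \<Omega> u x = G x"
    by (rule weak_gradient_unique[OF assms(1) 1 assms(2)])
qed

section \<open>Convergence in \<open>L\<^sup>2\<close>\<close>

text \<open>Cauchy-Schwarz after writing \<open>norm (F k)\<close> as
  \<open>sqrt (b k) * (norm (F k) / sqrt (b k))\<close>. The tail of \<open>b\<close> appears in the
  second bound, which makes it tend to zero with \<open>n\<close>.\<close>

lemma summable_weighted_bound:
  fixes F :: "nat \<Rightarrow> 'b::banach" and b :: "nat \<Rightarrow> real"
  assumes b: "\<And>k. b k > 0" "summable b" and q: "summable (\<lambda>k. (norm (F k))\<^sup>2 / b k)"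
  shows "summable F"
    and "(norm ((\<Sum>k. F k) - (\<Sum>k<n. F k)))\<^sup>2 \<le> (\<Sum>k. b (k + n)) * (\<Sum>k. (norm (F k))\<^sup>2 / b k)"
proof -
  let ?q = "\<lambda>k. (norm (F k))\<^sup>2 / b k"
  have q0: "?q k \<ge> 0" for k using b(1)[of k] by simp
  have b': "summable (\<lambda>k. b (k + n))" for n using b(2) by (simp add: summable_iff_shift)
  have fin: "(\<Sum>k<m. norm (F (k + n)))\<^sup>2 \<le> (\<Sum>k. b (k + n)) * (\<Sum>k. ?q k)" for m n
  proof -
    have "(\<Sum>k<m. norm (F (k + n))) = (\<Sum>k<m. sqrt (b (k + n)) * (norm (F (k + n)) / sqrt (b (k + n))))"
      using b(1) by (intro sum.cong refl) (simp add: less_imp_neq[symmetric])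
    also have "\<dots>\<^sup>2 \<le> (\<Sum>k<m. (sqrt (b (k + n)))\<^sup>2) * (\<Sum>k<m. (norm (F (k + n)) / sqrt (b (k + n)))\<^sup>2)"
      by (rule Cauchy_Schwarz_ineq_sum)
    also have "\<dots> = (\<Sum>k<m. b (k + n)) * (\<Sum>k<m. ?q (k + n))"
      using b(1) by (simp add: power_divide less_imp_le)
    also have "\<dots> \<le> (\<Sum>k. b (k + n)) * (\<Sum>k. ?q k)"
    proof (intro mult_mono)
      show "(\<Sum>k<m. b (k + n)) \<le> (\<Sum>k. b (k + n))"
        using b(1) by (intro sum_le_suminf b') (auto intro: less_imp_le)
      have "(\<Sum>k<m. ?q (k + n)) = sum ?q {n..<m + n}"
        by (simp add: sum.shift_bounds_nat_ivl[symmetric] lessThan_atLeast0 flip: sum.shift_bounds_nat_ivl[of ?q 0 n m])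
      also have "\<dots> \<le> (\<Sum>k. ?q k)"
        using q0 by (intro sum_le_suminf q) auto
      finally show "(\<Sum>k<m. ?q (k + n)) \<le> (\<Sum>k. ?q k)" .
      show "0 \<le> (\<Sum>k. b (k + n))"
        using b(1) by (intro suminf_nonneg b') (auto intro: less_imp_le)
      show "0 \<le> (\<Sum>k<m. ?q (k + n))"
        using q0 by (intro sum_nonneg) auto
    qed
    finally show ?thesis .
  qed
  have "summable (\<lambda>k. norm (F k))"
  proof (rule bounded_imp_summable)
    show "(\<Sum>k\<le>m. norm (F k)) \<le> sqrt ((\<Sum>k. b (k + 0)) * (\<Sum>k. ?q k))" for m
      using fin[where m="Suc m" and n=0] by (intro real_le_rsqrt) (simp add: lessThan_Suc_atMost)
  qed auto
  then show sF: "summable F"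
    by (rule summable_norm_cancel)
  have "(\<lambda>m. (norm (\<Sum>k<m. F (k + n)))\<^sup>2) \<longlonglongrightarrow> (norm (\<Sum>k. F (k + n)))\<^sup>2"
    using sF by (intro tendsto_intros summable_LIMSEQ) (simp add: summable_iff_shift)
  moreover have "(norm (\<Sum>k<m. F (k + n)))\<^sup>2 \<le> (\<Sum>k. b (k + n)) * (\<Sum>k. ?q k)" for m
    using power_mono[OF norm_sum[of "\<lambda>k. F (k + n)" "{..<m}"], of 2] fin[where m=m and n=n] by simp
  ultimately have "(norm (\<Sum>k. F (k + n)))\<^sup>2 \<le> (\<Sum>k. b (k + n)) * (\<Sum>k. ?q k)"
    by (intro LIMSEQ_le_const2[of _ _ "(\<Sum>k. b (k + n)) * (\<Sum>k. ?q k)"]) blast+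
  moreover have "(\<Sum>k. F k) - (\<Sum>k<n. F k) = (\<Sum>k. F (k + n))"
    using suminf_split_initial_segment[OF sF, of n] by simp
  ultimately show "(norm ((\<Sum>k. F k) - (\<Sum>k<n. F k)))\<^sup>2 \<le> (\<Sum>k. b (k + n)) * (\<Sum>k. ?q k)"
    by simp
qed

text \<open>Convergence is obtained pointwise rather than from completeness of a function space. The
  weighted sum of squares \<open>?Q\<close> has finite integral, so the series converges almost
  everywhere and every tail is dominated by a vanishing multiple of \<open>?Q\<close>. On the
  remaining null set the value of \<open>G\<close> is a default and does not matter.\<close>

lemma L2_series:
  fixes F :: "nat \<Rightarrow> 'a \<Rightarrow> 'b::euclidean_space" and b :: "nat \<Rightarrow> real"
  assumes [measurable]: "\<And>k. F k \<in> borel_measurable M"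
    and int: "\<And>k. integrable M (\<lambda>x. (norm (F k x))\<^sup>2)"
    and le: "\<And>k. (\<integral>x. (norm (F k x))\<^sup>2 \<partial>M) \<le> (C * b k)\<^sup>2"
    and b: "\<And>k. b k > 0" "summable b"
  defines "G \<equiv> \<lambda>x. \<Sum>k. F k x"
  shows "G \<in> borel_measurable M" "integrable M (\<lambda>x. (norm (G x))\<^sup>2)"
    "(\<integral>x. (norm (G x))\<^sup>2 \<partial>M) \<le> C\<^sup>2 * (\<Sum>k. b k)\<^sup>2"
    "\<And>n. integrable M (\<lambda>x. (norm (G x - (\<Sum>k<n. F k x)))\<^sup>2)"
    "(\<lambda>n. \<integral>x. (norm (G x - (\<Sum>k<n. F k x)))\<^sup>2 \<partial>M) \<longlonglongrightarrow> 0"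
proof -
  let ?q = "\<lambda>k x. (norm (F k x))\<^sup>2 / b k" and ?Q = "\<lambda>x. \<Sum>k. (norm (F k x))\<^sup>2 / b k"
  let ?B = "\<lambda>n. \<Sum>k. b (k + n)"
  show G[measurable]: "G \<in> borel_measurable M"
    unfolding G_def by measurable
  have q0: "?q k x \<ge> 0" for k x using b(1)[of k] by simp
  have intq: "integrable M (?q k)" for k using int[of k] by simp
  have leq: "(\<integral>x. ?q k x \<partial>M) \<le> C\<^sup>2 * b k" for k
    using le[of k] b(1)[of k] by (simp add: field_simps power2_eq_square)
  have nn: "(\<integral>\<^sup>+x. ennreal (?q k x) \<partial>M) = ennreal (\<integral>x. ?q k x \<partial>M)" for k
    by (rule nn_integral_eq_integral[OF intq]) (use q0 in auto)
  have sumq: "summable (\<lambda>k. \<integral>x. ?q k x \<partial>M)"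
    by (rule summable_comparison_test'[of "\<lambda>k. C\<^sup>2 * b k" 0])
      (use leq b q0 in \<open>auto simp: summable_mult integral_nonneg_AE abs_of_pos\<close>)
  have fin: "(\<integral>\<^sup>+x. (\<Sum>k. ennreal (?q k x)) \<partial>M) = ennreal (\<Sum>k. \<integral>x. ?q k x \<partial>M)"
    unfolding nn_integral_suminf[OF measurable_compose[OF borel_measurable_integrable[OF intq] measurable_ennreal]] nn
    by (rule suminf_ennreal2[OF _ sumq]) (rule Bochner_Integration.integral_nonneg[OF q0])
  have "AE x in M. (\<Sum>k. ennreal (?q k x)) \<noteq> \<infinity>"
    by (rule nn_integral_PInf_AE) (use fin in auto)
  then have AEs: "AE x in M. summable (\<lambda>k. ?q k x)"
    by (rule eventually_mono) (use q0 summable_suminf_not_top in auto)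
  have intQ: "integrable M ?Q" and Qeq: "(\<integral>x. ?Q x \<partial>M) = (\<Sum>k. \<integral>x. ?q k x \<partial>M)"
    using integrable_suminf[OF intq] integral_suminf[OF intq] AEs sumq q0 b(1) by (simp_all add: abs_of_pos)
  have Q0: "0 \<le> (\<integral>x. ?Q x \<partial>M)"
    unfolding Qeq by (intro suminf_nonneg sumq Bochner_Integration.integral_nonneg q0)
  have Qle: "(\<integral>x. ?Q x \<partial>M) \<le> C\<^sup>2 * (\<Sum>k. b k)"
    unfolding Qeq suminf_mult[OF b(2), symmetric] by (intro suminf_le leq sumq summable_mult b)
  have bd: "AE x in M. (norm (G x - (\<Sum>k<n. F k x)))\<^sup>2 \<le> ?B n * ?Q x" for n
    using AEs by eventually_elim (unfold G_def, intro summable_weighted_bound(2) b)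
  show intD: "integrable M (\<lambda>x. (norm (G x - (\<Sum>k<n. F k x)))\<^sup>2)" for n
    by (rule Bochner_Integration.integrable_bound[OF integrable_mult_right[OF intQ, of "?B n"]])
      (use bd[of n] in \<open>auto elim!: eventually_mono\<close>)
  have le_n: "(\<integral>x. (norm (G x - (\<Sum>k<n. F k x)))\<^sup>2 \<partial>M) \<le> ?B n * (\<integral>x. ?Q x \<partial>M)" for n
    using integral_mono_AE[OF intD integrable_mult_right[OF intQ] bd] by simp
  show "integrable M (\<lambda>x. (norm (G x))\<^sup>2)"
    using intD[of 0] by simp
  have "(\<integral>x. (norm (G x))\<^sup>2 \<partial>M) \<le> (\<Sum>k. b k) * (C\<^sup>2 * (\<Sum>k. b k))"
    using le_n[of 0] mult_left_mono[OF Qle suminf_nonneg[OF b(2)]] b(1) by (force simp: less_imp_le)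
  then show "(\<integral>x. (norm (G x))\<^sup>2 \<partial>M) \<le> C\<^sup>2 * (\<Sum>k. b k)\<^sup>2"
    by (simp add: power2_eq_square mult_ac)
  have "(\<lambda>n. ?B n * (\<integral>x. ?Q x \<partial>M)) \<longlonglongrightarrow> 0 * (\<integral>x. ?Q x \<partial>M)"
    by (intro tendsto_mult_right suminf_exist_split2 b)
  then have lim: "(\<lambda>n. ?B n * (\<integral>x. ?Q x \<partial>M)) \<longlonglongrightarrow> 0"
    unfolding mult_zero_left .
  have "0 \<le> (\<integral>x. (norm (G x - (\<Sum>k<n. F k x)))\<^sup>2 \<partial>M)" for n
    by (rule Bochner_Integration.integral_nonneg) simp
  then show "(\<lambda>n. \<integral>x. (norm (G x - (\<Sum>k<n. F k x)))\<^sup>2 \<partial>M) \<longlonglongrightarrow> 0"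
    using le_n by (intro tendsto_sandwich[OF always_eventually always_eventually tendsto_const lim]) blast+
qed

text \<open>Expanding the squares of \<open>t *\<^sub>R Z x - D x\<close> and
  \<open>t *\<^sub>R Z x + D x\<close> bounds the inner product pointwise. The free parameter
  \<open>t\<close> takes the place of the product of norms in Cauchy-Schwarz.\<close>

lemma integrable_inner_L2:
  fixes Z D :: "'a \<Rightarrow> 'b::euclidean_space"
  assumes [measurable]: "Z \<in> borel_measurable M" "D \<in> borel_measurable M"
    and int: "integrable M (\<lambda>x. (norm (Z x))\<^sup>2)" "integrable M (\<lambda>x. (norm (D x))\<^sup>2)"
  shows "integrable M (\<lambda>x. Z x \<bullet> D x)"
    and "t > 0 \<Longrightarrow> \<bar>\<integral>x. Z x \<bullet> D x \<partial>M\<bar> \<le> t * (\<integral>x. (norm (Z x))\<^sup>2 \<partial>M) + (\<integral>x. (norm (D x))\<^sup>2 \<partial>M) / t"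
proof -
  have bd: "\<bar>Z x \<bullet> D x\<bar> \<le> t * (norm (Z x))\<^sup>2 + (norm (D x))\<^sup>2 / t" if t: "t > 0" for t x
  proof -
    have "0 \<le> (norm (t *\<^sub>R Z x - D x))\<^sup>2" "0 \<le> (norm (t *\<^sub>R Z x + D x))\<^sup>2" by auto
    then have "2 * t * \<bar>Z x \<bullet> D x\<bar> \<le> t\<^sup>2 * (norm (Z x))\<^sup>2 + (norm (D x))\<^sup>2"
      unfolding power2_norm_eq_inner
      by (simp add: inner_diff_left inner_diff_right inner_add_left inner_add_right inner_commute power2_eq_square algebra_simps abs_if)
    then have "2 * \<bar>Z x \<bullet> D x\<bar> \<le> t * (norm (Z x))\<^sup>2 + (norm (D x))\<^sup>2 / t"
      using t by (simp add: field_simps power2_eq_square)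
    then show ?thesis by linarith
  qed
  have bdi: "integrable M (\<lambda>x. t * (norm (Z x))\<^sup>2 + (norm (D x))\<^sup>2 / t)" for t
    using int by auto
  show ZD: "integrable M (\<lambda>x. Z x \<bullet> D x)"
    by (rule Bochner_Integration.integrable_bound[OF bdi[of 1]]) (use bd[of 1] in auto)
  show "\<bar>\<integral>x. Z x \<bullet> D x \<partial>M\<bar> \<le> t * (\<integral>x. (norm (Z x))\<^sup>2 \<partial>M) + (\<integral>x. (norm (D x))\<^sup>2 \<partial>M) / t" if t: "t > 0"
  proof -
    have "\<bar>\<integral>x. Z x \<bullet> D x \<partial>M\<bar> \<le> (\<integral>x. \<bar>Z x \<bullet> D x\<bar> \<partial>M)"
      by (rule integral_abs_bound)
    also have "\<dots> \<le> (\<integral>x. t * (norm (Z x))\<^sup>2 + (norm (D x))\<^sup>2 / t \<partial>M)"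
      by (rule Bochner_Integration.integral_mono[OF integrable_abs[OF ZD] bdi bd[OF t]])
    finally show ?thesis using int by simp
  qed
qed

lemma tendsto_integral_inner_L2:
  fixes Z D :: "'a \<Rightarrow> 'b::euclidean_space" and S :: "nat \<Rightarrow> 'a \<Rightarrow> 'b"
  assumes [measurable]: "Z \<in> borel_measurable M" "D \<in> borel_measurable M" "\<And>n. S n \<in> borel_measurable M"
    and int: "integrable M (\<lambda>x. (norm (Z x))\<^sup>2)" "integrable M (\<lambda>x. (norm (D x))\<^sup>2)"
      "\<And>n. integrable M (\<lambda>x. (norm (D x - S n x))\<^sup>2)"
    and lim: "(\<lambda>n. \<integral>x. (norm (D x - S n x))\<^sup>2 \<partial>M) \<longlonglongrightarrow> 0"
  shows "(\<lambda>n. \<integral>x. Z x \<bullet> S n x \<partial>M) \<longlonglongrightarrow> (\<integral>x. Z x \<bullet> D x \<partial>M)"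
proof -
  let ?A = "\<integral>x. (norm (Z x))\<^sup>2 \<partial>M" and ?d = "\<lambda>n. \<integral>x. (norm (D x - S n x))\<^sup>2 \<partial>M"
  have A: "?A \<ge> 0" by simp
  have "(\<lambda>n. \<integral>x. Z x \<bullet> (D x - S n x) \<partial>M) \<longlonglongrightarrow> 0"
  proof (rule LIMSEQ_I)
    fix e :: real assume e: "e > 0"
    \<comment> \<open>This makes the \<open>Z\<close> part at most \<open>e / 2\<close>; adding 1 to
      \<open>?A\<close> keeps the quotient meaningful when \<open>Z\<close> vanishes almost
      everywhere.\<close>
    define t where "t = e / (2 * (?A + 1))"
    have t: "t > 0" using e A by (simp add: t_def add_nonneg_pos)
    have "t * ?A \<le> t * (?A + 1)" using t by simp
    also have "\<dots> = e / 2"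
    proof -
      have "e / (2 * a) * a = e / 2" if "a \<noteq> 0" for a using that by simp
      moreover have "?A + 1 \<noteq> 0" using A by linarith
      ultimately show ?thesis unfolding t_def by blast
    qed
    finally have tA: "t * ?A \<le> e / 2" .
    have "\<forall>\<^sub>F n in sequentially. ?d n < t * e / 2"
      using order_tendstoD(2)[OF lim, of "t * e / 2"] t e by simp
    then have "\<forall>\<^sub>F n in sequentially. \<bar>\<integral>x. Z x \<bullet> (D x - S n x) \<partial>M\<bar> < e"
    proof eventually_elim
      case (elim n)
      have "\<bar>\<integral>x. Z x \<bullet> (D x - S n x) \<partial>M\<bar> \<le> t * ?A + ?d n / t"
        by (rule integrable_inner_L2(2)[OF _ _ int(1) int(3) t]) auto
      moreover have "?d n / t < e / 2" using elim t by (simp add: field_simps)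
      ultimately show ?case using tA by linarith
    qed
    then show "\<exists>no. \<forall>n\<ge>no. norm ((\<integral>x. Z x \<bullet> (D x - S n x) \<partial>M) - 0) < e"
      by (simp add: eventually_sequentially)
  qed
  from tendsto_diff[OF tendsto_const[of "\<integral>x. Z x \<bullet> D x \<partial>M"] this]
  have "(\<lambda>n. (\<integral>x. Z x \<bullet> D x \<partial>M) - (\<integral>x. Z x \<bullet> (D x - S n x) \<partial>M)) \<longlonglongrightarrow> (\<integral>x. Z x \<bullet> D x \<partial>M)"
    by simp
  moreover have "(\<integral>x. Z x \<bullet> D x \<partial>M) - (\<integral>x. Z x \<bullet> (D x - S n x) \<partial>M) = (\<integral>x. Z x \<bullet> S n x \<partial>M)" for n
  proof -
    have "(\<integral>x. Z x \<bullet> D x \<partial>M) - (\<integral>x. Z x \<bullet> (D x - S n x) \<partial>M) = (\<integral>x. Z x \<bullet> D x - Z x \<bullet> (D x - S n x) \<partial>M)"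
      by (rule Bochner_Integration.integral_diff[symmetric]; rule integrable_inner_L2) (auto simp: int)
    then show ?thesis by (simp add: inner_diff_right)
  qed
  ultimately show ?thesis by simp
qed

section \<open>Series of test functions in \<open>H1_0\<close>\<close>

text \<open>Local integrability gives measurability on compact subsets only; an exhaustion of
  \<Omega> by compact sets and a pointwise limit extend it to \<Omega>.\<close>

lemma locally_integrable_measurable:
  fixes G :: "'a::euclidean_space \<Rightarrow> 'b::euclidean_space"
  assumes \<Omega>: "open \<Omega>" and G: "locally_integrable_on \<Omega> G"
  shows "G \<in> borel_measurable (lebesgue_on \<Omega>)"
proof -
  obtain C where C: "\<And>n::nat. compact (C n)" "\<And>n. C n \<subseteq> \<Omega>" "(\<Union>n. C n) = \<Omega>"
      "\<And>K. compact K \<Longrightarrow> K \<subseteq> \<Omega> \<Longrightarrow> \<exists>N. \<forall>n\<ge>N. K \<subseteq> C n"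
    using open_Union_compact_subsets[OF \<Omega>] by metis
  have "(\<lambda>x. indicator \<Omega> x *\<^sub>R G x) \<in> borel_measurable lebesgue"
  proof (rule borel_measurable_LIMSEQ_metric)
    show "(\<lambda>x. indicator (C n) x *\<^sub>R G x) \<in> borel_measurable lebesgue" for n
    proof -
      have "integrable (lebesgue_on (C n)) G"
        using G C(1,2) unfolding locally_integrable_on_def by blast
      then show ?thesis
        using borel_compact[OF C(1)[of n]]
        by (subst borel_measurable_restrict_space_iff[symmetric]) auto
    qed
    show "(\<lambda>n. indicator (C n) x *\<^sub>R G x) \<longlonglongrightarrow> indicator \<Omega> x *\<^sub>R G x" for x
    proof (cases "x \<in> \<Omega>")
      case True
      then obtain N where "\<forall>n\<ge>N. x \<in> C n"
        using C(4)[of "{x}"] by auto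
      then have "\<forall>\<^sub>F n in sequentially. indicator (C n) x *\<^sub>R G x = indicator \<Omega> x *\<^sub>R G x"
        using True by (auto intro!: eventually_sequentiallyI[of N])
      then show ?thesis by (rule tendsto_eventually)
    next
      case False
      then have "x \<notin> C n" for n using C(2) by blast
      with False show ?thesis by simp
    qed
  qed
  then show ?thesis
    using \<Omega> by (subst borel_measurable_restrict_space_iff) auto
qed

lemma Cc_infinity_sum:
  assumes "\<And>k. w k \<in> Cc_infinity \<Omega>"
  shows "(\<lambda>x. \<Sum>k<n::nat. w k x) \<in> Cc_infinity \<Omega>"
    and "grad (\<lambda>x. \<Sum>k<n. w k x) x = (\<Sum>k<n. grad (w k) x)"
proof -
  have "\<exists>K. compact K \<and> K \<subseteq> \<Omega> \<and> (\<forall>x. x \<notin> K \<longrightarrow> w k x = 0)" for k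
    by (rule Cc_infinity_support[OF assms[of k]]) blast
  then obtain K where K: "\<And>k. compact (K k)" "\<And>k. K k \<subseteq> \<Omega>" "\<And>k x. x \<notin> K k \<Longrightarrow> w k x = 0"
    by metis
  show "(\<lambda>x. \<Sum>k<n::nat. w k x) \<in> Cc_infinity \<Omega>"
    by (rule Cc_infinityI[of _ "\<Union>k<n. K k"])
      (use K in \<open>auto intro!: Ck_on_sum Cc_infinity_Ck[OF assms] sum.neutral\<close>)
  have "((\<lambda>x. \<Sum>k<n. w k x) has_derivative (\<lambda>h. \<Sum>k<n. frechet_derivative (w k) (at x) h)) (at x)"
    by (intro has_derivative_sum Cc_infinity_has_derivative[OF assms])
  then have "frechet_derivative (\<lambda>x. \<Sum>k<n. w k x) (at x) = (\<lambda>h. \<Sum>k<n. frechet_derivative (w k) (at x) h)"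
    by (rule frechet_derivative_at[symmetric])
  then show "grad (\<lambda>x. \<Sum>k<n. w k x) x = (\<Sum>k<n. grad (w k) x)"
    unfolding grad_def by (simp add: scaleR_sum_left sum.swap[of _ "{..<n}"])
qed

lemma L2_on_bounded:
  fixes v :: "'a::euclidean_space \<Rightarrow> real"
  assumes \<Omega>: "open \<Omega>" "bounded \<Omega>" and [measurable]: "v \<in> borel_measurable (lebesgue_on \<Omega>)"
    and bd: "\<And>x. x \<in> \<Omega> \<Longrightarrow> \<bar>v x\<bar> \<le> B"
  shows "v \<in> L2_on \<Omega>" "(\<integral>x. (v x)\<^sup>2 \<partial>lebesgue_on \<Omega>) \<le> B\<^sup>2 * measure lebesgue \<Omega>"
proof -
  have \<Omega>m: "\<Omega> \<in> lmeasurable"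
    using \<Omega> by (intro bounded_set_imp_lmeasurable) auto
  interpret finite_measure "lebesgue_on \<Omega>"
    by (rule finite_measure_lebesgue_on[OF \<Omega>m])
  have le: "(v x)\<^sup>2 \<le> B\<^sup>2" if "x \<in> \<Omega>" for x
    using power_mono[OF bd[OF that], of 2] by simp
  have int: "integrable (lebesgue_on \<Omega>) (\<lambda>x. (v x)\<^sup>2)"
    by (rule Bochner_Integration.integrable_bound[of _ "\<lambda>_. B\<^sup>2"]) (use le in \<open>auto intro!: AE_I2\<close>)
  then show "v \<in> L2_on \<Omega>"
    by (simp add: L2_on_def)
  have "(\<integral>x. (v x)\<^sup>2 \<partial>lebesgue_on \<Omega>) \<le> (\<integral>x. B\<^sup>2 \<partial>lebesgue_on \<Omega>)"
    using le by (intro integral_mono_AE int) auto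
  then show "(\<integral>x. (v x)\<^sup>2 \<partial>lebesgue_on \<Omega>) \<le> B\<^sup>2 * measure lebesgue \<Omega>"
    using \<Omega> by (simp add: mult.commute measure_restrict_space)
qed

lemma H1_norm_eq:
  assumes \<Omega>: "open \<Omega>" and G: "has_weak_gradient \<Omega> u G"
  shows "H1_norm \<Omega> u = sqrt ((\<integral>x. (u x)\<^sup>2 \<partial>lebesgue_on \<Omega>) + (\<integral>x. (norm (G x))\<^sup>2 \<partial>lebesgue_on \<Omega>))"
proof -
  have [measurable]: "weak_grad \<Omega> u \<in> borel_measurable (lebesgue_on \<Omega>)" "G \<in> borel_measurable (lebesgue_on \<Omega>)"
    using weak_grad_eq(1)[OF assms] G
    by (auto intro!: locally_integrable_measurable[OF \<Omega>] simp: has_weak_gradient_def)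
  have "(\<integral>x. (norm (weak_grad \<Omega> u x))\<^sup>2 \<partial>lebesgue_on \<Omega>) = (\<integral>x. (norm (G x))\<^sup>2 \<partial>lebesgue_on \<Omega>)"
    by (rule integral_cong_AE) (use weak_grad_eq(2)[OF assms] in \<open>auto elim: eventually_mono\<close>)
  then show ?thesis
    by (simp add: H1_norm_def)
qed

lemma integral_weak_grad_inner_eq:
  assumes \<Omega>: "open \<Omega>" and "has_weak_gradient \<Omega> u G" "has_weak_gradient \<Omega> v H"
  shows "(\<integral>x. weak_grad \<Omega> u x \<bullet> weak_grad \<Omega> v x \<partial>lebesgue_on \<Omega>) = (\<integral>x. G x \<bullet> H x \<partial>lebesgue_on \<Omega>)"
proof -
  note wu = weak_grad_eq[OF \<Omega> assms(2)] and wv = weak_grad_eq[OF \<Omega> assms(3)]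
  have [measurable]: "weak_grad \<Omega> u \<in> borel_measurable (lebesgue_on \<Omega>)" "G \<in> borel_measurable (lebesgue_on \<Omega>)"
    "weak_grad \<Omega> v \<in> borel_measurable (lebesgue_on \<Omega>)" "H \<in> borel_measurable (lebesgue_on \<Omega>)"
    using wu(1) wv(1) assms(2,3)
    by (auto intro!: locally_integrable_measurable[OF \<Omega>] simp: has_weak_gradient_def)
  have "AE x in lebesgue_on \<Omega>. weak_grad \<Omega> u x \<bullet> weak_grad \<Omega> v x = G x \<bullet> H x"
    using wu(2) wv(2) by eventually_elim simp
  then show ?thesis
    by (intro integral_cong_AE) auto
qed

lemma L2_on_locally_integrable:
  fixes G :: "'a::euclidean_space \<Rightarrow> 'b::euclidean_space"
  assumes G: "G \<in> L2_on \<Omega>" and \<Omega>: "open \<Omega>" "bounded \<Omega>"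
  shows "locally_integrable_on \<Omega> G" "integrable (lebesgue_on \<Omega>) G"
proof -
  have \<Omega>m: "\<Omega> \<in> lmeasurable"
    using \<Omega> by (intro bounded_set_imp_lmeasurable) auto
  interpret finite_measure "lebesgue_on \<Omega>"
    by (rule finite_measure_lebesgue_on[OF \<Omega>m])
  have [measurable]: "G \<in> borel_measurable (lebesgue_on \<Omega>)" and int: "integrable (lebesgue_on \<Omega>) (\<lambda>x. (norm (G x))\<^sup>2)"
    using G by (auto simp: L2_on_def)
  have le: "norm (G x) \<le> (norm (G x))\<^sup>2 + 1" for x
  proof -
    have "2 * norm (G x) \<le> (norm (G x))\<^sup>2 + 1"
      using zero_le_power2[of "norm (G x) - 1"] by (simp add: power2_diff)
    then show ?thesis
      using norm_ge_zero[of "G x"] by linarith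
  qed
  show intG: "integrable (lebesgue_on \<Omega>) G"
    by (rule Bochner_Integration.integrable_bound[of _ "\<lambda>x. (norm (G x))\<^sup>2 + 1"]) (use int le in auto)
  have intG': "integrable lebesgue (\<lambda>x. indicator \<Omega> x *\<^sub>R G x)"
    using intG \<Omega> by (subst (asm) integrable_restrict_space) auto
  show "locally_integrable_on \<Omega> G"
    unfolding locally_integrable_on_def
  proof safe
    fix K assume K: "compact K" "K \<subseteq> \<Omega>"
    then have [measurable]: "K \<in> sets lebesgue" by (auto simp: borel_compact)
    have "integrable lebesgue (\<lambda>x. indicator K x *\<^sub>R (indicator \<Omega> x *\<^sub>R G x))"
      by (rule integrable_mult_indicator[OF _ intG']) measurable
    also have "(\<lambda>x. indicator K x *\<^sub>R (indicator \<Omega> x *\<^sub>R G x)) = (\<lambda>x. indicator K x *\<^sub>R G x)"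
      using K by (auto simp: fun_eq_iff indicator_def)
    finally show "integrable (lebesgue_on K) G"
      by (subst integrable_restrict_space) auto
  qed
qed

text \<open>The partial sums are themselves the test functions demanded by \<open>H1_0\<close>. The
  bounds \<open>a\<close> give uniform convergence, hence continuity and zero boundary values; the
  bounds \<open>b\<close> give convergence of the gradients in \<open>L2\<close>, hence the weak
  gradient and the limit of the Dirichlet pairings.\<close>

lemma H1_0_series:
  fixes \<Omega> :: "'a::euclidean_space set" and w :: "nat \<Rightarrow> 'a \<Rightarrow> real"
  assumes \<Omega>: "open \<Omega>" "bounded \<Omega>" and w: "\<And>k. w k \<in> Cc_infinity \<Omega>"
    and a: "\<And>k x. \<bar>w k x\<bar> \<le> a k" "summable a"
    and le: "\<And>k. (\<integral>x. (norm (grad (w k) x))\<^sup>2 \<partial>lebesgue_on \<Omega>) \<le> (C * b k)\<^sup>2"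
    and b: "\<And>k. b k > 0" "summable b"
  defines "v \<equiv> \<lambda>x. \<Sum>k. w k x" and "G \<equiv> \<lambda>x. \<Sum>k. grad (w k) x"
  shows "v \<in> C_0 \<Omega>" "v \<in> H1_0 \<Omega>" "\<And>x. \<bar>v x\<bar> \<le> (\<Sum>k. a k)" "continuous_on UNIV v"
    "has_weak_gradient \<Omega> v G"
    "H1_norm \<Omega> v \<le> sqrt ((\<Sum>k. a k)\<^sup>2 * measure lebesgue \<Omega> + C\<^sup>2 * (\<Sum>k. b k)\<^sup>2)"
    "\<And>Z :: 'a \<Rightarrow> 'a. Z \<in> L2_on \<Omega> \<Longrightarrow>
       (\<lambda>n. \<integral>x. Z x \<bullet> grad (\<lambda>x. \<Sum>k<n. w k x) x \<partial>lebesgue_on \<Omega>) \<longlonglongrightarrow> (\<integral>x. Z x \<bullet> G x \<partial>lebesgue_on \<Omega>)"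
proof -
  let ?M = "lebesgue_on \<Omega>"
  let ?S = "\<lambda>n x. \<Sum>k<n. w k x"
  have b\<Omega>: "\<Omega> \<in> sets borel" using \<Omega> by simp
  have ml: "f \<in> borel_measurable ?M" if "f \<in> borel_measurable borel" for f :: "'a \<Rightarrow> 'c::euclidean_space"
    using that by (intro measurable_restrict_space1 measurable_completion) simp
  have gm: "grad (w k) \<in> borel_measurable ?M" for k
    by (rule ml[OF grad_borel[OF w]])
  have \<Omega>m: "\<Omega> \<in> lmeasurable"
    using \<Omega> by (intro bounded_set_imp_lmeasurable) auto
  interpret finite_measure ?M
    by (rule finite_measure_lebesgue_on[OF \<Omega>m])
  have gi: "integrable ?M (\<lambda>x. (norm (grad (w k) x))\<^sup>2)" for k
  proof -
    obtain B where B: "\<And>x. norm (grad (w k) x) \<le> B" using w[of k] by (rule grad_bounded) blast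
    have "(norm (grad (w k) x))\<^sup>2 \<le> B\<^sup>2" for x
      using power_mono[OF B norm_ge_zero] .
    moreover have "(\<lambda>x. (norm (grad (w k) x))\<^sup>2) \<in> borel_measurable ?M"
      using gm[of k] by measurable
    ultimately show ?thesis
      by - (rule Bochner_Integration.integrable_bound[of _ "\<lambda>_. B\<^sup>2"], simp_all)
  qed
  have Gx: "(\<Sum>k. grad (w k) x) = G x" for x
    by (simp add: G_def)
  note L2 = L2_series[of "\<lambda>k. grad (w k)" ?M, OF gm gi le b, unfolded Gx]
  have S: "?S n \<in> Cc_infinity \<Omega>" and gS: "grad (?S n) = (\<lambda>x. \<Sum>k<n. grad (w k) x)" for n
    using Cc_infinity_sum[of w \<Omega> n] w by auto
  have G_L2: "G \<in> L2_on \<Omega>"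
    using L2(1,2) by (simp add: L2_on_def)
  have sw: "summable (\<lambda>k. w k x)" for x
    by (rule summable_comparison_test'[OF a(2), of 0]) (use a(1) in auto)
  have tail: "\<bar>v x - ?S n x\<bar> \<le> (\<Sum>k. a (k + n))" for n x
  proof -
    have "v x - ?S n x = (\<Sum>k. w (k + n) x)"
      using suminf_split_initial_segment[OF sw, of x n] by (simp add: v_def)
    also have "\<bar>\<dots>\<bar> \<le> (\<Sum>k. a (k + n))"
      using norm_suminf_le[of "\<lambda>k. w (k + n) x" "\<lambda>k. a (k + n)"] a by (simp add: summable_iff_shift)
    finally show ?thesis .
  qed
  have tail0: "(\<lambda>n. \<Sum>k. a (k + n)) \<longlonglongrightarrow> 0"
    by (rule suminf_exist_split2[OF a(2)])
  show bd: "\<bar>v x\<bar> \<le> (\<Sum>k. a k)" for x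
    using tail[of x 0] by simp
  have "uniform_limit UNIV (\<lambda>n. ?S n) v sequentially"
    unfolding v_def by (rule Weierstrass_m_test[OF _ a(2)]) (use a(1) in auto)
  then show cont: "continuous_on UNIV v"
    by (rule uniform_limit_theorem[rotated])
      (simp, rule always_eventually, rule allI, rule Cc_infinity_continuous[OF S])
  have v0: "v x = 0" if "x \<notin> \<Omega>" for x
    using Cc_infinity_outside[OF w that] by (simp add: v_def)
  show "v \<in> C_0 \<Omega>"
    using cont v0 \<Omega>(1) by (auto simp: C_0_def frontier_def interior_open intro: continuous_on_subset)
  have vm: "v \<in> borel_measurable ?M"
    by (rule ml[OF borel_measurable_continuous_onI[OF cont]])
  have v_L2: "v \<in> L2_on \<Omega>" and v_le: "(\<integral>x. (v x)\<^sup>2 \<partial>?M) \<le> (\<Sum>k. a k)\<^sup>2 * measure lebesgue \<Omega>"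
    using L2_on_bounded[OF \<Omega> vm bd] by auto
  show lim: "(\<lambda>n. \<integral>x. Z x \<bullet> grad (?S n) x \<partial>?M) \<longlonglongrightarrow> (\<integral>x. Z x \<bullet> G x \<partial>?M)" if Z: "Z \<in> L2_on \<Omega>" for Z :: "'a \<Rightarrow> 'a"
    unfolding gS using Z gm L2
    by (intro tendsto_integral_inner_L2) (auto simp: L2_on_def)
  show wg: "has_weak_gradient \<Omega> v G"
    unfolding has_weak_gradient_def
  proof (intro conjI ballI)
    show "locally_integrable_on \<Omega> G"
      by (rule L2_on_locally_integrable(1)[OF G_L2 \<Omega>])
    show "locally_integrable_on \<Omega> v"
      by (rule continuous_locally_integrable[OF cont])
    fix \<phi> :: "'a \<Rightarrow> real" and i :: 'a assume \<phi>: "\<phi> \<in> Cc_infinity \<Omega>" and i: "i \<in> Basis"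
    have \<phi>m: "\<phi> \<in> borel_measurable ?M" "(\<lambda>x. grad \<phi> x \<bullet> i) \<in> borel_measurable ?M"
      using ml[OF Cc_infinity_borel[OF \<phi>]] ml[OF grad_borel[OF \<phi>]] by auto
    obtain B where B: "\<And>x. norm (grad \<phi> x) \<le> B" using \<phi> by (rule grad_bounded) blast
    obtain B' where B': "\<And>x. \<bar>\<phi> x\<bar> \<le> B'" using \<phi> by (rule Cc_infinity_bounded) blast
    have gb: "\<bar>grad \<phi> x \<bullet> i\<bar> \<le> B" for x
      using Basis_le_norm[OF i, of "grad \<phi> x"] B[of x] by linarith
    have "(\<lambda>n. \<integral>x. ?S n x * (grad \<phi> x \<bullet> i) \<partial>?M) \<longlonglongrightarrow> (\<integral>x. v x * (grad \<phi> x \<bullet> i) \<partial>?M)"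
    proof (rule integral_dominated_convergence[of _ _ _ "\<lambda>_. (\<Sum>k. a k) * B"])
      show "(\<lambda>x. v x * (grad \<phi> x \<bullet> i)) \<in> borel_measurable ?M"
        using vm \<phi>m by measurable
      show "(\<lambda>x. ?S n x * (grad \<phi> x \<bullet> i)) \<in> borel_measurable ?M" for n
        using ml[OF Cc_infinity_borel[OF S]] \<phi>m by measurable
      show "AE x in ?M. (\<lambda>n. ?S n x * (grad \<phi> x \<bullet> i)) \<longlonglongrightarrow> v x * (grad \<phi> x \<bullet> i)"
        unfolding v_def by (intro AE_I2 tendsto_mult_right summable_LIMSEQ sw)
      have "\<bar>?S n x\<bar> \<le> (\<Sum>k. a k)" for n x
      proof -
        have "\<bar>?S n x\<bar> \<le> (\<Sum>k<n. a k)"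
          using a(1) by (intro order_trans[OF sum_abs] sum_mono)
        also have "\<dots> \<le> (\<Sum>k. a k)"
          using order_trans[OF abs_ge_zero a(1)] by (intro sum_le_suminf a(2)) auto
        finally show ?thesis .
      qed
      then have "\<bar>?S n x * (grad \<phi> x \<bullet> i)\<bar> \<le> (\<Sum>k. a k) * B" for n x
        unfolding abs_mult using gb by (intro mult_mono) (auto intro: order_trans[OF abs_ge_zero bd])
      then show "AE x in ?M. norm (?S n x * (grad \<phi> x \<bullet> i)) \<le> (\<Sum>k. a k) * B" for n
        by simp
    qed simp
    \<comment> \<open>One component of the gradient is written as an inner product with the field
      \<open>\<phi> x *\<^sub>R i\<close>, so that the convergence of pairings already proved
      applies.\<close>
    moreover have "(\<integral>x. ?S n x * (grad \<phi> x \<bullet> i) \<partial>?M) = - (\<integral>x. (\<phi> x *\<^sub>R i) \<bullet> grad (?S n) x \<partial>?M)" for n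
    proof -
      have "(\<integral>x. ?S n x * (grad \<phi> x \<bullet> i) \<partial>?M) = - (\<integral>x. (grad (?S n) x \<bullet> i) * \<phi> x \<partial>?M)"
        using has_weak_gradient_Cc[OF b\<Omega> S] \<phi> i unfolding has_weak_gradient_def by blast
      then show ?thesis by (simp add: inner_commute mult.commute)
    qed
    moreover have "(\<lambda>n. - (\<integral>x. (\<phi> x *\<^sub>R i) \<bullet> grad (?S n) x \<partial>?M)) \<longlonglongrightarrow> - (\<integral>x. (\<phi> x *\<^sub>R i) \<bullet> G x \<partial>?M)"
    proof (intro tendsto_minus lim)
      show "(\<lambda>x. \<phi> x *\<^sub>R i) \<in> L2_on \<Omega>"
        using L2_on_bounded(1)[OF \<Omega> \<phi>m(1) B'] \<phi>m(1) i by (simp add: L2_on_def)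
    qed
    ultimately have "(\<integral>x. v x * (grad \<phi> x \<bullet> i) \<partial>?M) = - (\<integral>x. (\<phi> x *\<^sub>R i) \<bullet> G x \<partial>?M)"
      using LIMSEQ_unique by auto
    then show "(\<integral>x. v x * (grad \<phi> x \<bullet> i) \<partial>?M) = - (\<integral>x. (G x \<bullet> i) * \<phi> x \<partial>?M)"
      by (simp add: inner_commute mult.commute)
  qed
  have H1v: "v \<in> H1 \<Omega>"
    using v_L2 G_L2 wg by (auto simp: H1_def)
  have H1norm: "H1_norm \<Omega> (\<lambda>x. ?S n x - v x)
      = sqrt ((\<integral>x. (?S n x - v x)\<^sup>2 \<partial>?M) + (\<integral>x. (norm (G x - (\<Sum>k<n. grad (w k) x)))\<^sup>2 \<partial>?M))" for n
  proof -
    have "has_weak_gradient \<Omega> (\<lambda>x. ?S n x - v x) (\<lambda>x. grad (?S n) x - G x)"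
      unfolding has_weak_gradient_def
    proof (intro conjI ballI)
      show "locally_integrable_on \<Omega> (\<lambda>x. ?S n x - v x)"
        by (intro continuous_locally_integrable continuous_on_diff cont Cc_infinity_continuous[OF S])
      have "locally_integrable_on \<Omega> (grad (?S n))"
        by (intro continuous_locally_integrable grad_continuous[OF S])
      then show "locally_integrable_on \<Omega> (\<lambda>x. grad (?S n) x - G x)"
        using L2_on_locally_integrable(1)[OF G_L2 \<Omega>] by (simp add: locally_integrable_on_def)
      fix \<phi> :: "'a \<Rightarrow> real" and i :: 'a assume \<phi>: "\<phi> \<in> Cc_infinity \<Omega>" and i: "i \<in> Basis"
      have \<phi>': "(\<lambda>x. grad \<phi> x \<bullet> i) \<in> Cc_infinity \<Omega>"
        using Cc_infinity_partial[OF \<phi> i] i by (simp add: grad_inner_Basis)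
      have i1: "integrable ?M (\<lambda>x. u x * (grad \<phi> x \<bullet> i))" if "locally_integrable_on \<Omega> u" for u :: "'a \<Rightarrow> real"
        using locally_integrable_mult_Cc[OF b\<Omega> that \<phi>'] by (simp add: mult.commute)
      have i2: "integrable ?M (\<lambda>x. (H x \<bullet> i) * \<phi> x)" if "locally_integrable_on \<Omega> H" for H :: "'a \<Rightarrow> 'a"
        using integrable_inner_left[OF locally_integrable_mult_Cc[OF b\<Omega> that \<phi>], of i] by (simp add: mult.commute)
      have Sw: "has_weak_gradient \<Omega> (?S n) (grad (?S n))"
        by (rule has_weak_gradient_Cc[OF b\<Omega> S])
      have "(\<integral>x. (?S n x - v x) * (grad \<phi> x \<bullet> i) \<partial>?M)
          = (\<integral>x. ?S n x * (grad \<phi> x \<bullet> i) \<partial>?M) - (\<integral>x. v x * (grad \<phi> x \<bullet> i) \<partial>?M)"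
        unfolding left_diff_distrib using Sw wg
        by (intro Bochner_Integration.integral_diff i1) (simp_all add: has_weak_gradient_def)
      also have "\<dots> = - ((\<integral>x. (grad (?S n) x \<bullet> i) * \<phi> x \<partial>?M) - (\<integral>x. (G x \<bullet> i) * \<phi> x \<partial>?M))"
        using Sw wg \<phi> i unfolding has_weak_gradient_def by simp
      also have "(\<integral>x. (grad (?S n) x \<bullet> i) * \<phi> x \<partial>?M) - (\<integral>x. (G x \<bullet> i) * \<phi> x \<partial>?M)
          = (\<integral>x. ((grad (?S n) x - G x) \<bullet> i) * \<phi> x \<partial>?M)"
        unfolding left_diff_distrib inner_diff_left using Sw wg
        by (intro Bochner_Integration.integral_diff[symmetric] i2) (simp_all add: has_weak_gradient_def)
      finally show "(\<integral>x. (?S n x - v x) * (grad \<phi> x \<bullet> i) \<partial>?M) = - (\<integral>x. ((grad (?S n) x - G x) \<bullet> i) * \<phi> x \<partial>?M)" .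
    qed
    from H1_norm_eq[OF \<Omega>(1) this] show ?thesis
      by (simp add: gS norm_minus_commute)
  qed
  have "(\<lambda>n. \<integral>x. (?S n x - v x)\<^sup>2 \<partial>?M) \<longlonglongrightarrow> 0"
  proof (rule tendsto_sandwich[OF always_eventually always_eventually tendsto_const])
    show "\<forall>n. 0 \<le> (\<integral>x. (?S n x - v x)\<^sup>2 \<partial>?M)"
      by simp
    have "(\<lambda>x. ?S n x - v x) \<in> borel_measurable ?M" for n
      using vm ml[OF Cc_infinity_borel[OF S]] by measurable
    then show "\<forall>n. (\<integral>x. (?S n x - v x)\<^sup>2 \<partial>?M) \<le> (\<Sum>k. a (k + n))\<^sup>2 * measure lebesgue \<Omega>"
      using tail by (intro allI L2_on_bounded(2)[OF \<Omega>]) (auto simp: abs_minus_commute)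
    show "(\<lambda>n. (\<Sum>k. a (k + n))\<^sup>2 * measure lebesgue \<Omega>) \<longlonglongrightarrow> 0"
      using tendsto_mult_right[OF tendsto_power[OF tail0, of 2], of "measure lebesgue \<Omega>"] by simp
  qed
  then have "(\<lambda>n. sqrt ((\<integral>x. (?S n x - v x)\<^sup>2 \<partial>?M) + (\<integral>x. (norm (G x - (\<Sum>k<n. grad (w k) x)))\<^sup>2 \<partial>?M))) \<longlonglongrightarrow> sqrt (0 + 0)"
    by (intro tendsto_real_sqrt tendsto_add L2(5))
  then have "(\<lambda>n. H1_norm \<Omega> (\<lambda>x. ?S n x - v x)) \<longlonglongrightarrow> 0"
    unfolding H1norm by simp
  then show "v \<in> H1_0 \<Omega>"
    unfolding H1_0_def using H1v S by (intro CollectI conjI exI[of _ ?S]) auto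
  show "H1_norm \<Omega> v \<le> sqrt ((\<Sum>k. a k)\<^sup>2 * measure lebesgue \<Omega> + C\<^sup>2 * (\<Sum>k. b k)\<^sup>2)"
    unfolding H1_norm_eq[OF \<Omega>(1) wg] by (intro real_sqrt_le_mono add_mono v_le L2(3))
qed

section \<open>Jordan decomposition of signed measures\<close>

lemma SUP_add_SUP_le_ennreal:
  fixes f g :: "'i \<Rightarrow> ennreal"
  assumes "I \<noteq> {}" "J \<noteq> {}" "\<And>i j. i \<in> I \<Longrightarrow> j \<in> J \<Longrightarrow> f i + g j \<le> X"
  shows "(SUP i\<in>I. f i) + (SUP j\<in>J. g j) \<le> X"
  unfolding ennreal_SUP_add_left[OF assms(1), symmetric] ennreal_SUP_add_right[OF assms(2)]
  by (intro SUP_least assms(3))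

locale signed_measure =
  fixes M :: "'a measure" and \<mu> :: "'a set \<Rightarrow> real"
  assumes signed: "finite_signed_measure M \<mu>"
begin

lemma signed_empty: "\<mu> {} = 0"
  using signed by (simp add: finite_signed_measure_def)

lemma signed_sums:
  "range A \<subseteq> sets M \<Longrightarrow> disjoint_family A \<Longrightarrow> (\<lambda>n::nat. \<mu> (A n)) sums \<mu> (\<Union>n. A n)"
  using signed by (simp add: finite_signed_measure_def)

lemma signed_Un:
  assumes "A \<in> sets M" "B \<in> sets M" "A \<inter> B = {}"
  shows "\<mu> (A \<union> B) = \<mu> A + \<mu> B"
proof -
  have "disjoint_family (binaryset A B)"
    using assms(3) by (auto simp: disjoint_family_on_def binaryset_def)
  then have "(\<lambda>n. \<mu> (binaryset A B n)) sums \<mu> (A \<union> B)"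
    using signed_sums[of "binaryset A B"] assms by (simp add: range_binaryset_eq UN_binaryset_eq)
  then show ?thesis
    using binaryset_sums[of \<mu> A B, OF signed_empty] sums_unique2 by blast
qed

lemma signed_Diff:
  assumes "A \<in> sets M" "B \<in> sets M" "B \<subseteq> A"
  shows "\<mu> (A - B) = \<mu> A - \<mu> B"
  using signed_Un[of B "A - B"] assms by (simp add: Un_absorb1)

text \<open>This is the set function inside \<open>positive_variation\<close>, studied separately
  because \<open>measure_of\<close> returns it as a measure only once countable additivity is
  known.\<close>

definition upper_variation :: "'a set \<Rightarrow> ennreal" where
  "upper_variation A = (SUP B \<in> {B \<in> sets M. B \<subseteq> A}. ennreal (\<mu> B))"

lemma upper_variation_ge: "B \<in> sets M \<Longrightarrow> B \<subseteq> A \<Longrightarrow> ennreal (\<mu> B) \<le> upper_variation A"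
  unfolding upper_variation_def by (rule SUP_upper) auto

lemma upper_variation_mono: "A \<subseteq> B \<Longrightarrow> upper_variation A \<le> upper_variation B"
  unfolding upper_variation_def by (rule SUP_subset_mono) auto

lemma upper_variation_empty: "upper_variation {} = 0"
proof -
  have "{B \<in> sets M. B \<subseteq> {}} = {{}}" by auto
  then show ?thesis by (simp add: upper_variation_def signed_empty)
qed

lemma upper_variation_superadditive:
  assumes "A \<inter> B = {}"
  shows "upper_variation A + upper_variation B \<le> upper_variation (A \<union> B)"
  unfolding upper_variation_def[of A] upper_variation_def[of B]
proof (rule SUP_add_SUP_le_ennreal)
  fix C D assume "C \<in> {C \<in> sets M. C \<subseteq> A}" "D \<in> {D \<in> sets M. D \<subseteq> B}"
  then have CD: "C \<in> sets M" "D \<in> sets M" "C \<subseteq> A" "D \<subseteq> B" by auto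
  \<comment> \<open>\<open>ennreal\<close> sends negative values to zero, so additivity can be used
    only if both values are nonnegative; otherwise the other set alone suffices.\<close>
  consider "\<mu> C \<le> 0" | "\<mu> D \<le> 0" | "\<mu> C \<ge> 0" "\<mu> D \<ge> 0" by linarith
  then show "ennreal (\<mu> C) + ennreal (\<mu> D) \<le> upper_variation (A \<union> B)"
  proof cases
    case 1
    then show ?thesis using CD upper_variation_ge[of D "A \<union> B"] by (simp add: ennreal_neg le_supI2)
  next
    case 2
    then show ?thesis using CD upper_variation_ge[of C "A \<union> B"] by (simp add: ennreal_neg le_supI1)
  next
    case 3
    have "C \<inter> D = {}" using CD assms by blast
    then have "ennreal (\<mu> C) + ennreal (\<mu> D) = ennreal (\<mu> (C \<union> D))"
      using CD 3 by (simp add: signed_Un)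
    also have "\<dots> \<le> upper_variation (A \<union> B)"
      using CD by (intro upper_variation_ge) auto
    finally show ?thesis .
  qed
qed auto

lemma upper_variation_suminf:
  assumes A: "range A \<subseteq> sets M" "disjoint_family A"
  shows "(\<Sum>n::nat. upper_variation (A n)) = upper_variation (\<Union>n. A n)"
proof (rule antisym)
  have "(\<Sum>n<k. upper_variation (A n)) \<le> upper_variation (\<Union>n<k. A n)" for k
  proof (induction k)
    case (Suc k)
    have "A n \<inter> A k = {}" if "n < k" for n
      using that by (intro disjoint_family_onD[OF A(2)]) auto
    then have "(\<Union>n<k. A n) \<inter> A k = {}"
      by blast
    from add_right_mono[OF Suc] upper_variation_superadditive[OF this]
    have "(\<Sum>n<k. upper_variation (A n)) + upper_variation (A k) \<le> upper_variation ((\<Union>n<k. A n) \<union> A k)"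
      by (rule order_trans)
    then show ?case
      by (simp add: lessThan_Suc Un_commute add.commute)
  qed (simp add: upper_variation_empty)
  also have "upper_variation (\<Union>n<k. A n) \<le> upper_variation (\<Union>n. A n)" for k
    by (rule upper_variation_mono) auto
  finally show "(\<Sum>n. upper_variation (A n)) \<le> upper_variation (\<Union>n. A n)"
    by (intro suminf_le_const[OF summableI])
  show "upper_variation (\<Union>n. A n) \<le> (\<Sum>n. upper_variation (A n))"
    unfolding upper_variation_def[of "\<Union>n. A n"]
  proof (rule SUP_least)
    fix B assume "B \<in> {B \<in> sets M. B \<subseteq> (\<Union>n. A n)}"
    then have B: "B \<in> sets M" "B = (\<Union>n. B \<inter> A n)" by auto
    have "disjoint_family (\<lambda>n. B \<inter> A n)"
      using A(2) by (auto simp: disjoint_family_on_def)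
    then have s: "(\<lambda>n. \<mu> (B \<inter> A n)) sums \<mu> B"
      using signed_sums[of "\<lambda>n. B \<inter> A n"] A(1) B by auto
    \<comment> \<open>The signed series converges, but its positive parts need not be known to be
      summable at this point; if they are not, the right-hand side is infinite and nothing is to be
      shown.\<close>
    have "ennreal (\<mu> B) \<le> (\<Sum>n. ennreal (\<mu> (B \<inter> A n)))"
    proof (cases "(\<Sum>n. ennreal (\<mu> (B \<inter> A n))) = top")
      case False
      have eq: "(\<lambda>n. ennreal (\<mu> (B \<inter> A n))) = (\<lambda>n. ennreal (max 0 (\<mu> (B \<inter> A n))))"
        by (auto simp: max_def ennreal_neg)
      have sm: "summable (\<lambda>n. max 0 (\<mu> (B \<inter> A n)))"
        using False unfolding eq by (intro summable_suminf_not_top) auto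
      have "\<mu> B \<le> (\<Sum>n. max 0 (\<mu> (B \<inter> A n)))"
        using suminf_le[OF _ sums_summable[OF s] sm] sums_unique[OF s] by simp
      then show ?thesis
        unfolding eq by (subst suminf_ennreal2[OF _ sm]) (auto intro: ennreal_leI)
    qed simp
    also have "\<dots> \<le> (\<Sum>n. upper_variation (A n))"
      using A B by (intro suminf_le summableI upper_variation_ge) auto
    finally show "ennreal (\<mu> B) \<le> (\<Sum>n. upper_variation (A n))" .
  qed
qed

lemma sets_positive_variation [simp]: "sets (positive_variation M \<mu>) = sets M"
  and space_positive_variation [simp]: "space (positive_variation M \<mu>) = space M"
  by (simp_all add: positive_variation_def sets.sets_measure_of_eq sets.space_measure_of_eq)

lemma emeasure_positive_variation:
  "A \<in> sets M \<Longrightarrow> emeasure (positive_variation M \<mu>) A = upper_variation A"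
  unfolding positive_variation_def upper_variation_def[symmetric, abs_def]
  by (rule emeasure_measure_of_sigma)
    (auto simp: positive_def upper_variation_empty countably_additive_def upper_variation_suminf
      intro: sets.sigma_algebra_axioms)

text \<open>Iterating this splitting yields disjoint sets whose measures do not tend to zero, which is how
  infinite variation is refuted.\<close>

lemma upper_variation_split:
  assumes E: "E \<in> sets M" "upper_variation E = top"
  shows "\<exists>A. A \<in> sets M \<and> upper_variation A = top \<and> A \<subseteq> E \<and> 1 \<le> \<bar>\<mu> (E - A)\<bar>"
proof -
  \<comment> \<open>With \<open>\<mu> B > \<bar>\<mu> E\<bar> + 1\<close>, both \<open>B\<close> and
    \<open>E - B\<close> have measure larger than 1 in absolute value. Whichever of them keeps
    infinite variation, the discarded one is large.\<close>
  have "ennreal (\<bar>\<mu> E\<bar> + 1) < upper_variation E" using E(2) by simp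
  then obtain B where B: "B \<in> sets M" "B \<subseteq> E" "ennreal (\<bar>\<mu> E\<bar> + 1) < ennreal (\<mu> B)"
    unfolding upper_variation_def less_SUP_iff by auto
  have big: "\<bar>\<mu> E\<bar> + 1 < \<mu> B"
    by (rule ennreal_less_iff[THEN iffD1, OF _ B(3)]) simp
  have diff: "\<mu> (E - B) = \<mu> E - \<mu> B" by (rule signed_Diff[OF E(1) B(1,2)])
  have "upper_variation E = upper_variation B + upper_variation (E - B)"
    using emeasure_Un[of B "positive_variation M \<mu>" "E - B"] B E(1)
      plus_emeasure[of B "positive_variation M \<mu>" "E - B"]
    by (simp add: emeasure_positive_variation Un_absorb1)
  then consider "upper_variation B = top" | "upper_variation (E - B) = top"
    using E(2) by (metis ennreal_add_eq_top)
  then show ?thesis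
  proof cases
    case 1
    then show ?thesis using B big diff by (intro exI[of _ B]) auto
  next
    case 2
    have "E - (E - B) = B" using B by auto
    then show ?thesis using B E big 2 by (intro exI[of _ "E - B"]) auto
  qed
qed

lemma upper_variation_finite:
  assumes "E \<in> sets M"
  shows "upper_variation E \<noteq> top"
proof
  assume top: "upper_variation E = top"
  obtain S where S: "\<And>n. S n \<in> sets M" "\<And>n. S (Suc n) \<subseteq> S n" "\<And>n. 1 \<le> \<bar>\<mu> (S n - S (Suc n))\<bar>"
    using dependent_nat_choice[of "\<lambda>_ A. A \<in> sets M \<and> upper_variation A = top"
        "\<lambda>_ A B. B \<subseteq> A \<and> 1 \<le> \<bar>\<mu> (A - B)\<bar>"] upper_variation_split assms top by metis
  have dec: "m \<le> n \<Longrightarrow> S n \<subseteq> S m" for m n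
    by (rule lift_Suc_antimono_le[of S, OF S(2)])
  have "disjoint_family (\<lambda>n. S n - S (Suc n))"
    unfolding disjoint_family_on_def
  proof safe
    fix m n x assume "m \<noteq> n" "x \<in> S m" "x \<notin> S (Suc m)" "x \<in> S n" "x \<notin> S (Suc n)"
    then show "x \<in> {}"
      using dec[of "Suc m" n] dec[of "Suc n" m] by (cases m n rule: linorder_cases) auto
  qed
  moreover have "range (\<lambda>n. S n - S (Suc n)) \<subseteq> sets M"
    using S(1) by (intro image_subsetI sets.Diff)
  ultimately have "summable (\<lambda>n. \<mu> (S n - S (Suc n)))"
    using signed_sums[of "\<lambda>n. S n - S (Suc n)"] by (auto simp: sums_iff)
  then have "(\<lambda>n. \<mu> (S n - S (Suc n))) \<longlonglongrightarrow> 0"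
    by (rule summable_LIMSEQ_zero)
  from tendsto_rabs[OF this] have "(\<lambda>n. \<bar>\<mu> (S n - S (Suc n))\<bar>) \<longlonglongrightarrow> 0" by simp
  from LIMSEQ_le_const[OF this, of 1] S(3) show False by auto
qed

lemma finite_measure_positive_variation: "finite_measure (positive_variation M \<mu>)"
  by (rule finite_measureI)
    (use upper_variation_finite[of "space M"] in \<open>simp add: emeasure_positive_variation\<close>)

end

lemma signed_measure_uminus:
  assumes "signed_measure M \<mu>"
  shows "signed_measure M (\<lambda>A. - \<mu> A)"
  using assms unfolding signed_measure_def finite_signed_measure_def by (auto intro: sums_minus)

context signed_measure
begin

lemma finite_measure_negative_variation: "finite_measure (negative_variation M \<mu>)"
  and sets_negative_variation [simp]: "sets (negative_variation M \<mu>) = sets M"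
  and space_negative_variation [simp]: "space (negative_variation M \<mu>) = space M"
  unfolding negative_variation_def
  using signed_measure.finite_measure_positive_variation[OF signed_measure_uminus[OF signed_measure_axioms]]
    signed_measure.sets_positive_variation[OF signed_measure_uminus[OF signed_measure_axioms]]
    signed_measure.space_positive_variation[OF signed_measure_uminus[OF signed_measure_axioms]]
  by auto

lemma abs_le_variations:
  assumes "A \<in> sets M"
  shows "ennreal \<bar>\<mu> A\<bar> \<le> emeasure (positive_variation M \<mu>) A + emeasure (negative_variation M \<mu>) A"
proof -
  interpret m: signed_measure M "\<lambda>A. - \<mu> A"
    by (rule signed_measure_uminus[OF signed_measure_axioms])
  show ?thesis
    using upper_variation_ge[OF assms order_refl] m.upper_variation_ge[OF assms order_refl]
    unfolding negative_variation_def emeasure_positive_variation[OF assms] m.emeasure_positive_variation[OF assms]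
    by (cases "\<mu> A \<ge> 0") (auto intro: add_increasing add_increasing2)
qed

text \<open>For the lower bound, the competitors \<open>B\<close> and \<open>C\<close> of the two
  variations may overlap. Since \<open>\<mu> B - \<mu> C = \<mu> (B - C) - \<mu> (C - B)\<close>,
  they can be replaced by disjoint sets, which a third set completes to a partition of
  \<open>A\<close>.\<close>

lemma emeasure_total_variation:
  assumes "A \<in> sets M"
  shows "emeasure (total_variation M \<mu>) A
    = emeasure (positive_variation M \<mu>) A + emeasure (negative_variation M \<mu>) A"
proof -
  interpret m: signed_measure M "\<lambda>A. - \<mu> A"
    by (rule signed_measure_uminus[OF signed_measure_axioms])
  let ?P = "positive_variation M \<mu>" and ?N = "negative_variation M \<mu>"
  let ?part = "\<lambda>A. {P :: nat \<Rightarrow> 'a set. range P \<subseteq> sets M \<and> disjoint_family P \<and> (\<Union>n. P n) = A}"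
  let ?t = "\<lambda>A. SUP P \<in> ?part A. \<Sum>n. ennreal \<bar>\<mu> (P n)\<bar>"
  have suminf: "(\<Sum>n. emeasure ?P (P n) + emeasure ?N (P n)) = emeasure ?P (\<Union>n. P n) + emeasure ?N (\<Union>n. P n)"
    if "range P \<subseteq> sets M" "disjoint_family P" for P :: "nat \<Rightarrow> 'a set"
    using that by (simp add: suminf_emeasure suminf_add[symmetric])
  have eq: "?t A = emeasure ?P A + emeasure ?N A" if A: "A \<in> sets M" for A
  proof (rule antisym)
    show "?t A \<le> emeasure ?P A + emeasure ?N A"
    proof (rule SUP_least)
      fix P :: "nat \<Rightarrow> 'a set" assume "P \<in> ?part A"
      then have P: "range P \<subseteq> sets M" "disjoint_family P" "(\<Union>n. P n) = A" by auto
      have "(\<Sum>n. ennreal \<bar>\<mu> (P n)\<bar>) \<le> (\<Sum>n. emeasure ?P (P n) + emeasure ?N (P n))"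
        using P(1) by (intro suminf_le abs_le_variations summableI) auto
      also have "\<dots> = emeasure ?P A + emeasure ?N A"
        using suminf[OF P(1,2)] P(3) by simp
      finally show "(\<Sum>n. ennreal \<bar>\<mu> (P n)\<bar>) \<le> emeasure ?P A + emeasure ?N A" .
    qed
    have disj: "ennreal \<bar>\<mu> B\<bar> + ennreal \<bar>\<mu> C\<bar> \<le> ?t A"
      if B: "B \<in> sets M" "B \<subseteq> A" and C: "C \<in> sets M" "C \<subseteq> A" and BC: "B \<inter> C = {}" for B C
    proof -
      define P where "P = (\<lambda>n::nat. if n = 0 then B else if n = 1 then C else if n = 2 then A - B - C else {})"
      have part: "P \<in> ?part A"
        using that A by (fastforce simp: P_def disjoint_family_on_def split: if_splits)
      have "ennreal \<bar>\<mu> B\<bar> + ennreal \<bar>\<mu> C\<bar> = (\<Sum>n<2. ennreal \<bar>\<mu> (P n)\<bar>)"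
        by (simp add: P_def numeral_2_eq_2)
      also have "\<dots> \<le> (\<Sum>n. ennreal \<bar>\<mu> (P n)\<bar>)"
        by (rule sum_le_suminf) auto
      also have "\<dots> \<le> ?t A"
        by (rule SUP_upper[OF part])
      finally show ?thesis .
    qed
    have pm: "ennreal (\<mu> B) + ennreal (- \<mu> C) \<le> ?t A"
      if B: "B \<in> sets M" "B \<subseteq> A" and C: "C \<in> sets M" "C \<subseteq> A" for B C
    proof -
      have split: "\<mu> B = \<mu> (B - C) + \<mu> (B \<inter> C)" if "B \<in> sets M" "C \<in> sets M" for B C
      proof -
        have "\<mu> ((B - C) \<union> (B \<inter> C)) = \<mu> (B - C) + \<mu> (B \<inter> C)"
          using that by (intro signed_Un) auto
        then show ?thesis by (simp add: Un_Diff_Int)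
      qed
      have "\<mu> B - \<mu> C = \<mu> (B - C) - \<mu> (C - B)"
        using split[OF B(1) C(1)] split[OF C(1) B(1)] by (simp add: Int_commute)
      then have le: "\<mu> B - \<mu> C \<le> \<bar>\<mu> (B - C)\<bar> + \<bar>\<mu> (C - B)\<bar>" by linarith
      consider "\<mu> B \<le> 0" | "- \<mu> C \<le> 0" | "\<mu> B \<ge> 0" "- \<mu> C \<ge> 0" by linarith
      then show ?thesis
      proof cases
        case 1
        have "ennreal (- \<mu> C) \<le> ennreal \<bar>\<mu> {}\<bar> + ennreal \<bar>\<mu> C\<bar>"
          by (auto simp: signed_empty intro: ennreal_leI)
        also have "\<dots> \<le> ?t A" by (rule disj) (use C in auto)
        finally show ?thesis using 1 by (simp add: ennreal_neg)
      next
        case 2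
        have "ennreal (\<mu> B) \<le> ennreal \<bar>\<mu> {}\<bar> + ennreal \<bar>\<mu> B\<bar>"
          by (auto simp: signed_empty intro: ennreal_leI)
        also have "\<dots> \<le> ?t A" by (rule disj) (use B in auto)
        finally show ?thesis using 2 by (simp add: ennreal_neg)
      next
        case 3
        then have "ennreal (\<mu> B) + ennreal (- \<mu> C) = ennreal (\<mu> B - \<mu> C)"
          by (simp flip: ennreal_plus)
        also have "\<dots> \<le> ennreal (\<bar>\<mu> (B - C)\<bar> + \<bar>\<mu> (C - B)\<bar>)"
          by (rule ennreal_leI[OF le])
        also have "\<dots> = ennreal \<bar>\<mu> (B - C)\<bar> + ennreal \<bar>\<mu> (C - B)\<bar>"
          by simp
        also have "\<dots> \<le> ?t A"
          by (rule disj) (use B C in auto)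
        finally show ?thesis .
      qed
    qed
    show "emeasure ?P A + emeasure ?N A \<le> ?t A"
      unfolding negative_variation_def emeasure_positive_variation[OF A] m.emeasure_positive_variation[OF A]
        upper_variation_def m.upper_variation_def
      by (rule SUP_add_SUP_le_ennreal) (auto intro: pm)
  qed
  have "emeasure (measure_of (space M) (sets M) ?t) A = ?t A"
  proof (rule emeasure_measure_of_sigma)
    show "sigma_algebra (space M) (sets M)" by (rule sets.sigma_algebra_axioms)
    show "A \<in> sets M" by (rule assms)
    show "positive (sets M) ?t"
      unfolding positive_def eq[OF sets.empty_sets] by simp
    show "countably_additive (sets M) ?t"
      unfolding countably_additive_def
    proof safe
      fix P :: "nat \<Rightarrow> 'a set" assume P: "range P \<subseteq> sets M" "disjoint_family P" "(\<Union>n. P n) \<in> sets M"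
      have "(\<Sum>n. ?t (P n)) = (\<Sum>n. emeasure ?P (P n) + emeasure ?N (P n))"
        using P(1) by (intro suminf_cong eq) auto
      then show "(\<Sum>n. ?t (P n)) = ?t (\<Union>n. P n)"
        unfolding suminf[OF P(1,2)] eq[OF P(3)] .
    qed
  qed
  then show ?thesis
    by (simp only: total_variation_def eq[OF assms])
qed

lemma sets_total_variation [simp]: "sets (total_variation M \<mu>) = sets M"
  and space_total_variation [simp]: "space (total_variation M \<mu>) = space M"
  by (simp_all add: total_variation_def sets.sets_measure_of_eq sets.space_measure_of_eq)

lemma finite_measure_total_variation: "finite_measure (total_variation M \<mu>)"
proof (rule finite_measureI)
  interpret P: finite_measure "positive_variation M \<mu>" by (rule finite_measure_positive_variation)
  interpret N: finite_measure "negative_variation M \<mu>" by (rule finite_measure_negative_variation)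
  show "emeasure (total_variation M \<mu>) (space (total_variation M \<mu>)) \<noteq> \<infinity>"
    by (simp add: emeasure_total_variation P.emeasure_finite N.emeasure_finite)
qed

text \<open>Polar decomposition without a Hahn decomposition: both variations have Radon-Nikodym
  densities with respect to the total variation, and these add up to 1 almost everywhere. Their
  difference is therefore bounded by 1.\<close>

lemma signed_integral_density:
  obtains g where "g \<in> borel_measurable M" "\<And>x. \<bar>g x\<bar> \<le> (1::real)"
    "\<And>\<zeta>. integrable (total_variation M \<mu>) \<zeta> \<Longrightarrow>
       signed_integral M \<mu> \<zeta> = (\<integral>x. g x * \<zeta> x \<partial>total_variation M \<mu>)"
proof -
  let ?P = "positive_variation M \<mu>" and ?N = "negative_variation M \<mu>" and ?T = "total_variation M \<mu>"
  interpret T: finite_measure ?T by (rule finite_measure_total_variation)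
  have meas: "borel_measurable ?T = borel_measurable M"
    by (rule measurable_cong_sets) simp_all
  have "absolutely_continuous ?T ?P" "absolutely_continuous ?T ?N"
    by (auto simp: absolutely_continuous_def null_sets_def emeasure_total_variation)
  then obtain p n where p: "p \<in> borel_measurable ?T" "density ?T p = ?P"
    and n: "n \<in> borel_measurable ?T" "density ?T n = ?N"
    using T.Radon_Nikodym[of ?P] T.Radon_Nikodym[of ?N] by auto
  note p(1)[measurable] n(1)[measurable]
  have "density ?T (\<lambda>x. p x + n x) = density ?T (\<lambda>_. 1)"
  proof (rule measure_eqI)
    fix A assume "A \<in> sets (density ?T (\<lambda>x. p x + n x))"
    then have A: "A \<in> sets ?T" by simp
    note A[measurable]
    have "emeasure (density ?T (\<lambda>x. p x + n x)) A
        = (\<integral>\<^sup>+x. p x * indicator A x + n x * indicator A x \<partial>?T)"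
      unfolding distrib_right[symmetric] by (rule emeasure_density[OF _ A]) measurable
    also have "\<dots> = (\<integral>\<^sup>+x. p x * indicator A x \<partial>?T) + (\<integral>\<^sup>+x. n x * indicator A x \<partial>?T)"
      by (rule nn_integral_add) measurable
    also have "\<dots> = emeasure (density ?T p) A + emeasure (density ?T n) A"
      by (simp only: emeasure_density[OF p(1) A] emeasure_density[OF n(1) A])
    also have "\<dots> = emeasure ?T A"
      using A by (simp add: p n emeasure_total_variation)
    finally show "emeasure (density ?T (\<lambda>x. p x + n x)) A = emeasure (density ?T (\<lambda>_. 1)) A"
      by (simp add: density_1)
  qed simp
  then have pn: "AE x in ?T. p x + n x = 1"
    by (intro T.density_unique) auto
  \<comment> \<open>Truncating at 1 makes the bounds hold at every point and changes the densities
    only on a null set, because \<open>p x + n x = 1\<close> almost everywhere.\<close>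
  define hp hn where "hp x = enn2real (min 1 (p x))" and "hn x = enn2real (min 1 (n x))" for x
  have [measurable]: "hp \<in> borel_measurable ?T" "hn \<in> borel_measurable ?T"
    unfolding hp_def[abs_def] hn_def[abs_def] by measurable
  have h01: "0 \<le> hp x" "hp x \<le> 1" "0 \<le> hn x" "hn x \<le> 1" for x
    unfolding hp_def hn_def by (auto simp: enn2real_leI)
  have "AE x in ?T. p x = ennreal (hp x)"
    using pn
  proof eventually_elim
    case (elim x)
    then have "p x \<le> 1" by (metis le_iff_add)
    moreover from this have "p x \<noteq> top" by (rule neq_top_trans[rotated]) simp
    ultimately show ?case by (simp add: hp_def min_absorb2 ennreal_enn2real_if)
  qed
  then have Pd: "?P = density ?T (\<lambda>x. ennreal (hp x))"
    unfolding p(2)[symmetric] by (intro density_cong) auto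
  have "AE x in ?T. n x = ennreal (hn x)"
    using pn
  proof eventually_elim
    case (elim x)
    then have "n x \<le> 1" by (metis le_iff_add add.commute)
    moreover from this have "n x \<noteq> top" by (rule neq_top_trans[rotated]) simp
    ultimately show ?case by (simp add: hn_def min_absorb2 ennreal_enn2real_if)
  qed
  then have Nd: "?N = density ?T (\<lambda>x. ennreal (hn x))"
    unfolding n(2)[symmetric] by (intro density_cong) auto
  show ?thesis
  proof (rule that[of "\<lambda>x. hp x - hn x"])
    show "(\<lambda>x. hp x - hn x) \<in> borel_measurable M"
      unfolding meas[symmetric] by measurable
    show "\<bar>hp x - hn x\<bar> \<le> 1" for x
      using h01[of x] by linarith
    fix \<zeta> :: "'a \<Rightarrow> real" assume \<zeta>: "integrable ?T \<zeta>"
    note [measurable] = borel_measurable_integrable[OF \<zeta>]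
    have b: "integrable ?T (\<lambda>x. hp x * \<zeta> x)" "integrable ?T (\<lambda>x. hn x * \<zeta> x)"
      by (rule Bochner_Integration.integrable_bound[OF \<zeta>]; use h01 in \<open>auto simp: abs_mult intro!: AE_I2 mult_left_le_one_le\<close>)+
    have "(\<integral>x. \<zeta> x \<partial>?P) = (\<integral>x. hp x * \<zeta> x \<partial>?T)"
      unfolding Pd using h01 by (subst integral_density) auto
    moreover have "(\<integral>x. \<zeta> x \<partial>?N) = (\<integral>x. hn x * \<zeta> x \<partial>?T)"
      unfolding Nd using h01 by (subst integral_density) auto
    ultimately show "signed_integral M \<mu> \<zeta> = (\<integral>x. (hp x - hn x) * \<zeta> x \<partial>?T)"
      using b by (simp add: signed_integral_def left_diff_distrib)
  qed
qed

end

text \<open>Convolution needs a measure on the whole space, so the total variation on the subspace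
  \<Omega> is pushed forward to a Borel measure that does not charge the complement;
  \<open>g\<close> is the polar density, set to zero outside \<Omega>.\<close>

lemma signed_measure_representation:
  fixes \<Omega> :: "'a::euclidean_space set"
  assumes \<Omega>: "open \<Omega>" and \<mu>: "\<mu> \<in> signed_measures \<Omega>"
  obtains \<nu> :: "'a measure" and g :: "'a \<Rightarrow> real" where
    "sets \<nu> = sets borel" "finite_measure \<nu>" "emeasure \<nu> (- \<Omega>) = 0" "measure \<nu> UNIV = TV_norm \<Omega> \<mu>"
    "\<And>A. A \<in> sets borel \<Longrightarrow> A \<subseteq> \<Omega> \<Longrightarrow> emeasure \<nu> A = emeasure (total_variation (borel_on \<Omega>) \<mu>) A"
    "g \<in> borel_measurable borel" "\<And>x. \<bar>g x\<bar> \<le> 1"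
    "\<And>\<zeta>. integrable \<nu> (\<lambda>x. indicator \<Omega> x * \<zeta> x) \<Longrightarrow> \<zeta> \<in> borel_measurable (borel_on \<Omega>) \<Longrightarrow>
       signed_integral (borel_on \<Omega>) \<mu> \<zeta> = (\<integral>x. g x * (indicator \<Omega> x * \<zeta> x) \<partial>\<nu>)"
proof -
  interpret signed_measure "borel_on \<Omega>" \<mu>
    using \<mu> by unfold_locales (simp add: signed_measures_def)
  let ?T = "total_variation (borel_on \<Omega>) \<mu>"
  interpret T: finite_measure ?T by (rule finite_measure_total_variation)
  have [measurable]: "\<Omega> \<in> sets borel" using \<Omega> by simp
  have spT: "space ?T = \<Omega>" by (simp add: space_restrict_space)
  have meas: "measurable ?T N = measurable (borel_on \<Omega>) N" for N :: "'b measure"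
    by (rule measurable_cong_sets) simp_all
  have id: "(\<lambda>x. x) \<in> measurable ?T borel"
    unfolding meas by (intro measurable_restrict_space1) simp
  obtain g where g: "g \<in> borel_measurable (borel_on \<Omega>)" "\<And>x. \<bar>g x\<bar> \<le> 1"
    "\<And>\<zeta>. integrable ?T \<zeta> \<Longrightarrow> signed_integral (borel_on \<Omega>) \<mu> \<zeta> = (\<integral>x. g x * \<zeta> x \<partial>?T)"
    by (rule signed_integral_density) blast
  let ?g = "\<lambda>x. indicator \<Omega> x * g x"
  have gm: "?g \<in> borel_measurable borel"
    using g(1) by (simp add: borel_measurable_restrict_space_iff)
  define \<nu> where "\<nu> = distr ?T borel (\<lambda>x. x)"
  have em: "emeasure \<nu> A = emeasure ?T (A \<inter> \<Omega>)" if "A \<in> sets borel" for A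
    unfolding \<nu>_def using that by (subst emeasure_distr[OF id]) (auto simp: spT)
  show ?thesis
  proof (rule that[of \<nu> ?g])
    show "sets \<nu> = sets borel" by (simp add: \<nu>_def)
    show "finite_measure \<nu>"
      unfolding \<nu>_def by (rule T.finite_measure_distr[OF id])
    show "emeasure \<nu> (- \<Omega>) = 0" by (subst em) auto
    show "measure \<nu> UNIV = TV_norm \<Omega> \<mu>"
      by (simp add: measure_def TV_norm_def em)
    show "emeasure \<nu> A = emeasure ?T A" if "A \<in> sets borel" "A \<subseteq> \<Omega>" for A
      using that by (simp add: em Int_absorb2)
    show "?g \<in> borel_measurable borel" by (rule gm)
    show "\<bar>?g x\<bar> \<le> 1" for x using g(2)[of x] by (simp add: indicator_def)
    fix \<zeta> :: "'a \<Rightarrow> real"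
    assume \<zeta>: "integrable \<nu> (\<lambda>x. indicator \<Omega> x * \<zeta> x)" "\<zeta> \<in> borel_measurable (borel_on \<Omega>)"
    have zm[measurable]: "(\<lambda>x. indicator \<Omega> x * \<zeta> x) \<in> borel_measurable borel"
      using \<zeta>(2) by (simp add: borel_measurable_restrict_space_iff)
    have "integrable ?T (\<lambda>x. indicator \<Omega> x * \<zeta> x)"
      using \<zeta>(1) unfolding \<nu>_def by (subst (asm) integrable_distr_eq[OF id]) auto
    also have "integrable ?T (\<lambda>x. indicator \<Omega> x * \<zeta> x) \<longleftrightarrow> integrable ?T \<zeta>"
      by (rule Bochner_Integration.integrable_cong) (auto simp: spT)
    finally have "signed_integral (borel_on \<Omega>) \<mu> \<zeta> = (\<integral>x. g x * \<zeta> x \<partial>?T)"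
      by (rule g(3))
    also have "\<dots> = (\<integral>x. ?g x * (indicator \<Omega> x * \<zeta> x) \<partial>?T)"
      by (rule Bochner_Integration.integral_cong) (auto simp: spT)
    also have "\<dots> = (\<integral>x. ?g x * (indicator \<Omega> x * \<zeta> x) \<partial>\<nu>)"
      unfolding \<nu>_def by (rule integral_distr[OF id borel_measurable_times[OF gm zm], symmetric])
    finally show "signed_integral (borel_on \<Omega>) \<mu> \<zeta> = (\<integral>x. ?g x * (indicator \<Omega> x * \<zeta> x) \<partial>\<nu>)" .
  qed
qed

section \<open>Potentials of finite measures\<close>

lemma bump_borel [measurable]: "bump \<in> borel_measurable borel"
  by (rule Cc_infinity_borel[OF bump_Cc])

lemma unit_mollifier_borel [measurable]: "unit_mollifier \<in> borel_measurable borel"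
  by (rule Cc_infinity_borel[OF unit_mollifier_Cc])

lemma ennreal_potential_kernel:
  fixes z :: "'a::euclidean_space"
  assumes s: "0 < s" "s \<le> r"
  shows "ennreal (potential_kernel s r z) =
    (\<integral>\<^sup>+\<sigma>. ennreal (inverse \<sigma> ^ (DIM('a) - 1) * bump (inverse \<sigma> *\<^sub>R z)) * indicator {s..r} \<sigma> \<partial>lborel)"
proof -
  let ?f = "\<lambda>\<sigma>. indicator {s..r} \<sigma> * inverse \<sigma> ^ (DIM('a) - 1) * bump (inverse \<sigma> *\<^sub>R z)"
  obtain B where B: "B \<ge> 0" "\<And>x::'a. \<bar>bump x\<bar> \<le> B" using bump_Cc by (rule Cc_infinity_bounded) blast
  have nn: "0 \<le> ?f \<sigma>" for \<sigma>
    using s by (auto simp: indicator_def bump_nonneg)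
  have int: "integrable lborel ?f"
  proof (rule Bochner_Integration.integrable_bound)
    show "integrable lborel (\<lambda>\<sigma>. indicator {s..r} \<sigma> * (inverse s ^ (DIM('a) - 1) * B))"
      by (intro integrable_mult_left integrable_real_indicator) (use s in \<open>auto simp: emeasure_lborel_Icc_eq\<close>)
    have "inverse \<sigma> ^ (DIM('a) - 1) * bump (inverse \<sigma> *\<^sub>R z) \<le> inverse s ^ (DIM('a) - 1) * B" if "s \<le> \<sigma>" for \<sigma>
      using that s B(1) order_trans[OF abs_ge_self B(2)] bump_nonneg
      by (intro mult_mono power_mono) (auto simp: field_simps)
    then show "AE \<sigma> in lborel. norm (?f \<sigma>) \<le> norm (indicator {s..r} \<sigma> * (inverse s ^ (DIM('a) - 1) * B))"
      using s B by (intro AE_I2) (auto simp: indicator_def bump_nonneg abs_mult)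
  qed measurable
  have "ennreal (potential_kernel s r z) = (\<integral>\<^sup>+\<sigma>. ennreal (?f \<sigma>) \<partial>lborel)"
    unfolding potential_kernel_def by (rule nn_integral_eq_integral[symmetric, OF int]) (use nn in auto)
  also have "\<dots> = (\<integral>\<^sup>+\<sigma>. ennreal (inverse \<sigma> ^ (DIM('a) - 1) * bump (inverse \<sigma> *\<^sub>R z)) * indicator {s..r} \<sigma> \<partial>lborel)"
    by (intro nn_integral_cong) (auto simp: indicator_def)
  finally show ?thesis .
qed

locale finite_borel_measure = finite_measure \<nu> for \<nu> :: "'a::euclidean_space measure" +
  assumes sets_\<nu> [measurable_cong]: "sets \<nu> = sets borel"
begin

lemma space_\<nu> [simp]: "space \<nu> = UNIV"
  using sets_eq_imp_space_eq[OF sets_\<nu>] by simp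

sublocale pair_sigma_finite lborel \<nu> ..

lemma integrable_indicator_\<nu>: "L \<in> sets borel \<Longrightarrow> integrable \<nu> (indicator L :: 'a \<Rightarrow> real)"
  by (simp add: integrable_indicator_iff emeasure_eq_measure sets_\<nu>)

text \<open>A smoothed form of the mass of the part of \<open>L\<close> in the ball of radius
  \<sigma> about \<open>x\<close>.\<close>

definition ball_mass :: "'a set \<Rightarrow> 'a \<Rightarrow> real \<Rightarrow> ennreal" where
  "ball_mass L x \<sigma> = (\<integral>\<^sup>+y. ennreal (bump (inverse \<sigma> *\<^sub>R (x - y))) * indicator L y \<partial>\<nu>)"

text \<open>A measure on the scales: every truncation of the potential is the mass of an interval,
  so monotonicity and continuity in the truncation come from measure theory. The weight is that of
  \<open>potential_kernel\<close>.\<close>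

definition scale_measure_at :: "'a set \<Rightarrow> 'a \<Rightarrow> real measure" where
  "scale_measure_at L x = density lborel (\<lambda>\<sigma>. ennreal (inverse \<sigma> ^ (DIM('a) - 1)) * ball_mass L x \<sigma>)"

text \<open>The potential at \<open>x\<close> of the restriction of \<open>\<nu>\<close> to \<open>L\<close>, truncated to distances below \<open>r\<close>.\<close>

definition potential :: "'a set \<Rightarrow> real \<Rightarrow> 'a \<Rightarrow> ennreal" where
  "potential L r x = emeasure (scale_measure_at L x) {0<..r}"

definition smooth_potential :: "'a set \<Rightarrow> real \<Rightarrow> real \<Rightarrow> 'a \<Rightarrow> real" where
  "smooth_potential L s r x = (\<integral>y. indicator L y * potential_kernel s r (x - y) \<partial>\<nu>)"

lemma ball_mass_measurable [measurable]:
  assumes [measurable]: "L \<in> sets borel"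
  shows "ball_mass L x \<in> borel_measurable borel"
  unfolding ball_mass_def[abs_def] by measurable

lemma emeasure_scale_measure_at:
  assumes [measurable]: "L \<in> sets borel" "S \<in> sets borel"
  shows "emeasure (scale_measure_at L x) S
    = (\<integral>\<^sup>+\<sigma>. ennreal (inverse \<sigma> ^ (DIM('a) - 1)) * ball_mass L x \<sigma> * indicator S \<sigma> \<partial>lborel)"
  unfolding scale_measure_at_def by (rule emeasure_density) measurable

lemma sets_scale_measure_at [simp]: "sets (scale_measure_at L x) = sets borel"
  by (simp add: scale_measure_at_def)

text \<open>Tonelli exchanges the integral over scales inside the kernel with the integral against
  \<nu>.\<close>

lemma smooth_potential_eq:
  assumes L[measurable]: "L \<in> sets borel" and s: "0 < s" "s \<le> r"
  shows "ennreal (smooth_potential L s r x) = emeasure (scale_measure_at L x) {s..r}"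
proof -
  have int: "integrable \<nu> (\<lambda>y. indicator L y * potential_kernel s r (x - y))"
    by (rule integrable_convolution_Cc[OF potential_kernel_Cc[OF s] integrable_indicator_\<nu>[OF L] sets_\<nu>])
  have "ennreal (smooth_potential L s r x) = (\<integral>\<^sup>+y. ennreal (indicator L y * potential_kernel s r (x - y)) \<partial>\<nu>)"
    unfolding smooth_potential_def
    by (rule nn_integral_eq_integral[symmetric, OF int]) (use s in \<open>auto intro!: AE_I2 mult_nonneg_nonneg potential_kernel_nonneg\<close>)
  also have "\<dots> = (\<integral>\<^sup>+y. \<integral>\<^sup>+\<sigma>. ennreal (inverse \<sigma> ^ (DIM('a) - 1) * bump (inverse \<sigma> *\<^sub>R (x - y)))
      * indicator {s..r} \<sigma> * indicator L y \<partial>lborel \<partial>\<nu>)"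
    by (intro nn_integral_cong) (auto simp: indicator_def ennreal_potential_kernel[OF s])
  also have "\<dots> = (\<integral>\<^sup>+\<sigma>. \<integral>\<^sup>+y. ennreal (inverse \<sigma> ^ (DIM('a) - 1) * bump (inverse \<sigma> *\<^sub>R (x - y)))
      * indicator {s..r} \<sigma> * indicator L y \<partial>\<nu> \<partial>lborel)"
    by (rule Fubini') measurable
  also have "\<dots> = (\<integral>\<^sup>+\<sigma>. ennreal (inverse \<sigma> ^ (DIM('a) - 1)) * ball_mass L x \<sigma> * indicator {s..r} \<sigma> \<partial>lborel)"
  proof (intro nn_integral_cong)
    fix \<sigma> :: real
    show "(\<integral>\<^sup>+y. ennreal (inverse \<sigma> ^ (DIM('a) - 1) * bump (inverse \<sigma> *\<^sub>R (x - y))) * indicator {s..r} \<sigma> * indicator L y \<partial>\<nu>)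
      = ennreal (inverse \<sigma> ^ (DIM('a) - 1)) * ball_mass L x \<sigma> * indicator {s..r} \<sigma>"
    proof (cases "\<sigma> \<in> {s..r}")
      case True
      then have "\<sigma> > 0" using s by simp
      then show ?thesis
        using True unfolding ball_mass_def
        by (subst nn_integral_cmult[symmetric]) (auto simp: ennreal_mult bump_nonneg mult.assoc)
    qed simp
  qed
  finally show ?thesis
    by (simp add: emeasure_scale_measure_at)
qed

lemma smooth_potential_nonneg: "0 < s \<Longrightarrow> 0 \<le> smooth_potential L s r x"
  unfolding smooth_potential_def
  by (intro Bochner_Integration.integral_nonneg mult_nonneg_nonneg potential_kernel_nonneg) auto

lemma smooth_potential_le:
  assumes L: "L \<in> sets borel" and s: "0 < s" "s \<le> r"
  shows "ennreal (smooth_potential L s r x) \<le> potential L r x"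
  unfolding smooth_potential_eq[OF assms] potential_def by (rule emeasure_mono) (use s in auto)

lemma smooth_potential_antimono:
  assumes L: "L \<in> sets borel" and s: "0 < s" "s \<le> t" "t \<le> r"
  shows "smooth_potential L t r x \<le> smooth_potential L s r x"
proof -
  have "ennreal (smooth_potential L t r x) \<le> ennreal (smooth_potential L s r x)"
    using s by (subst (1 2) smooth_potential_eq[OF L]) (auto intro!: emeasure_mono)
  then show ?thesis
    using s by (simp add: smooth_potential_nonneg)
qed

text \<open>Continuity from below in the scales. As a supremum of continuous functions the potential
  is Borel measurable, and its superlevel sets are unions of open sets, which the capacity estimate
  needs.\<close>

lemma potential_eq_SUP:
  assumes L: "L \<in> sets borel" and r: "0 < r"
  shows "potential L r x = (SUP n. ennreal (smooth_potential L (r / real (Suc n)) r x))"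
proof -
  have "(SUP n. emeasure (scale_measure_at L x) {r / real (Suc n)..r})
      = emeasure (scale_measure_at L x) (\<Union>n. {r / real (Suc n)..r})"
    using r by (intro SUP_emeasure_incseq) (auto simp: incseq_def frac_le intro: order_trans[rotated])
  also have "(\<Union>n. {r / real (Suc n)..r}) = {0<..r}"
  proof safe
    fix \<sigma> assume "\<sigma> \<in> {0<..r}"
    then obtain n where "inverse (real (Suc n)) < \<sigma> / r"
      using reals_Archimedean[of "\<sigma> / r"] r by auto
    then have "r / real (Suc n) \<le> \<sigma>" using r by (simp add: field_simps)
    with \<open>\<sigma> \<in> {0<..r}\<close> show "\<sigma> \<in> (\<Union>n. {r / real (Suc n)..r})" by auto
  next
    fix \<sigma> n assume "\<sigma> \<in> {r / real (Suc n)..r}"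
    then show "\<sigma> \<in> {0<..r}"
      using r less_le_trans[of 0 "r / real (Suc n)" \<sigma>] by auto
  qed
  finally show ?thesis
    using r smooth_potential_eq[OF L, of "r / real (Suc n)" r x for n] 
    by (simp add: potential_def divide_le_eq)
qed

text \<open>Continuity from above along intervals with empty intersection; this requires finite
  mass, which is the assumption that the potential is finite at \<open>x\<close>.\<close>

lemma potential_tendsto_0:
  assumes "L \<in> sets borel" and r: "0 < r" and fin: "potential L r x \<noteq> top"
  shows "(\<lambda>n. potential L (r / real (Suc n)) x) \<longlonglongrightarrow> 0"
proof -
  have "r / real (Suc n) \<le> r" for n
    using r by (simp add: divide_le_eq)
  then have sub: "{0<..r / real (Suc n)} \<subseteq> {0<..r}" for n
    by (force intro: order_trans)
  have "(\<lambda>n. emeasure (scale_measure_at L x) {0<..r / real (Suc n)})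
      \<longlonglongrightarrow> emeasure (scale_measure_at L x) (\<Inter>n. {0<..r / real (Suc n)})"
  proof (rule Lim_emeasure_decseq)
    show "decseq (\<lambda>n. {0<..r / real (Suc n)})"
    proof (rule decseq_SucI, rule subsetI)
      fix n \<sigma> assume "\<sigma> \<in> {0<..r / real (Suc (Suc n))}"
      moreover have "r / real (Suc (Suc n)) \<le> r / real (Suc n)"
        using r by (intro frac_le) auto
      ultimately show "\<sigma> \<in> {0<..r / real (Suc n)}" by simp
    qed
    show "emeasure (scale_measure_at L x) {0<..r / real (Suc n)} \<noteq> \<infinity>" for n
      using fin emeasure_mono[OF sub, of "scale_measure_at L x" n] unfolding potential_def
      by (auto simp: top_unique)
  qed auto
  also have "(\<Inter>n. {0<..r / real (Suc n)}) = {}"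
  proof safe
    fix \<sigma> assume *: "\<sigma> \<in> (\<Inter>n. {0<..r / real (Suc n)})"
    then have "0 < \<sigma>" by auto
    then obtain n where "inverse (real (Suc n)) < \<sigma> / r"
      using reals_Archimedean[of "\<sigma> / r"] r by auto
    then have "r / real (Suc n) < \<sigma>" using r by (simp add: field_simps)
    moreover have "\<sigma> \<in> {0<..r / real (Suc n)}" by (rule INT_D[OF *]) simp
    ultimately show "\<sigma> \<in> {}" by simp
  qed
  finally show ?thesis
    by (simp add: potential_def)
qed

lemma potential_mono:
  assumes "L \<in> sets borel" "L' \<in> sets borel" "L \<subseteq> L'" "r \<le> r'"
  shows "potential L r x \<le> potential L' r' x"
proof -
  have "ball_mass L x \<sigma> \<le> ball_mass L' x \<sigma>" for \<sigma>
    unfolding ball_mass_def using assms(3) by (intro nn_integral_mono mult_left_mono) (auto simp: indicator_def)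
  then show ?thesis
    unfolding potential_def emeasure_scale_measure_at[OF assms(1) greaterThanAtMost_borel] emeasure_scale_measure_at[OF assms(2) greaterThanAtMost_borel]
    using assms(4) by (intro nn_integral_mono mult_mono mult_left_mono) (auto simp: indicator_def)
qed

lemma potential_Un_le:
  assumes [measurable]: "L \<in> sets borel" "L' \<in> sets borel"
  shows "potential (L \<union> L') r x \<le> potential L r x + potential L' r x"
proof -
  have bm: "ball_mass (L \<union> L') x \<sigma> \<le> ball_mass L x \<sigma> + ball_mass L' x \<sigma>" for \<sigma>
    unfolding ball_mass_def
    by (subst nn_integral_add[symmetric]) (auto intro!: nn_integral_mono simp: indicator_def)
  have "potential (L \<union> L') r x \<le> (\<integral>\<^sup>+\<sigma>. ennreal (inverse \<sigma> ^ (DIM('a) - 1)) * ball_mass L x \<sigma> * indicator {0<..r} \<sigma>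
      + ennreal (inverse \<sigma> ^ (DIM('a) - 1)) * ball_mass L' x \<sigma> * indicator {0<..r} \<sigma> \<partial>lborel)"
    unfolding potential_def emeasure_scale_measure_at[OF sets.Un[OF assms] greaterThanAtMost_borel]
    by (intro nn_integral_mono) (auto simp: indicator_def distrib_left[symmetric] intro!: mult_left_mono bm)
  also have "\<dots> = potential L r x + potential L' r x"
    unfolding potential_def by (subst nn_integral_add) (auto simp: emeasure_scale_measure_at)
  finally show ?thesis .
qed

text \<open>A weak form of the maximum principle: if \<open>x'\<close> is a point of \<open>L\<close> closest to \<open>x\<close>, then
  \<open>norm (x' - y) \<le> 2 * norm (x - y)\<close> for all \<open>y \<in> L\<close>.\<close>

lemma potential_maximum_principle:
  assumes L: "compact L" "L \<noteq> {}"
  obtains x' where "x' \<in> L" "\<And>r. potential L r x \<le> 2 ^ (DIM('a) - 1) * potential L (2 * r) x'"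
proof -
  have [measurable]: "L \<in> sets borel" by (rule borel_compact[OF L(1)])
  obtain x' where x': "x' \<in> L" "\<And>y. y \<in> L \<Longrightarrow> dist x x' \<le> dist x y"
    using distance_attains_inf[of L x] L by (auto simp: compact_imp_closed)
  let ?N = "DIM('a) - 1"
  let ?w = "\<lambda>\<sigma>. ennreal (inverse \<sigma> ^ ?N)"
  have bm: "ball_mass L x \<sigma> \<le> ball_mass L x' (2 * \<sigma>)" if "\<sigma> > 0" for \<sigma>
    unfolding ball_mass_def
  proof (intro nn_integral_mono)
    fix y
    show "ennreal (bump (inverse \<sigma> *\<^sub>R (x - y))) * indicator L y
        \<le> ennreal (bump (inverse (2 * \<sigma>) *\<^sub>R (x' - y))) * indicator L y"
    proof (cases "y \<in> L")
      case True
      have "norm (x' - y) \<le> 2 * norm (x - y)"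
        using x'(2)[OF True] dist_triangle[of x' y x] by (simp add: dist_norm norm_minus_commute)
      then have "norm (inverse (2 * \<sigma>) *\<^sub>R (x' - y)) \<le> norm (inverse \<sigma> *\<^sub>R (x - y))"
        using that unfolding norm_scaleR by (simp add: field_simps)
      then show ?thesis
        using True by (simp add: bump_antimono ennreal_leI)
    qed simp
  qed
  \<comment> \<open>Substituting \<open>2 * \<sigma>\<close> for the scale gains a factor one half,
    which is given away here. The remaining constant comes from the weight alone.\<close>
  have double: "X \<le> 2 * X" for X :: ennreal
    by (simp add: mult_2)
  have "potential L r x \<le> 2 ^ ?N * potential L (2 * r) x'" for r
  proof -
    have "potential L r x \<le> (\<integral>\<^sup>+\<sigma>. 2 ^ ?N * (?w (2 * \<sigma>) * ball_mass L x' (2 * \<sigma>) * indicator {0<..2 * r} (2 * \<sigma>)) \<partial>lborel)"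
      unfolding potential_def emeasure_scale_measure_at[OF \<open>L \<in> sets borel\<close> greaterThanAtMost_borel]
    proof (intro nn_integral_mono)
      fix \<sigma> :: real
      show "?w \<sigma> * ball_mass L x \<sigma> * indicator {0<..r} \<sigma>
        \<le> 2 ^ ?N * (?w (2 * \<sigma>) * ball_mass L x' (2 * \<sigma>) * indicator {0<..2 * r} (2 * \<sigma>))"
      proof (cases "\<sigma> \<in> {0<..r}")
        case True
        then have pos: "\<sigma> > 0" by simp
        have "inverse \<sigma> ^ ?N = 2 ^ ?N * inverse (2 * \<sigma>) ^ ?N"
          by (simp add: power_mult_distrib[symmetric])
        then have "?w \<sigma> = 2 ^ ?N * ?w (2 * \<sigma>)"
          using pos by (simp add: ennreal_mult ennreal_power[symmetric])
        then show ?thesis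
          using True bm[OF pos] by (simp add: mult.assoc mult_left_mono)
      qed simp
    qed
    also have "\<dots> = 2 ^ ?N * (\<integral>\<^sup>+\<sigma>. ?w (2 * \<sigma>) * ball_mass L x' (2 * \<sigma>) * indicator {0<..2 * r} (2 * \<sigma>) \<partial>lborel)"
      by (rule nn_integral_cmult) measurable
    also have "\<dots> \<le> 2 ^ ?N * (2 * (\<integral>\<^sup>+\<sigma>. ?w (2 * \<sigma>) * ball_mass L x' (2 * \<sigma>) * indicator {0<..2 * r} (2 * \<sigma>) \<partial>lborel))"
      by (rule mult_left_mono[OF double]) simp
    also have "2 * (\<integral>\<^sup>+\<sigma>. ?w (2 * \<sigma>) * ball_mass L x' (2 * \<sigma>) * indicator {0<..2 * r} (2 * \<sigma>) \<partial>lborel)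
        = potential L (2 * r) x'"
      unfolding potential_def emeasure_scale_measure_at[OF \<open>L \<in> sets borel\<close> greaterThanAtMost_borel]
      using nn_integral_real_affine[of "\<lambda>\<tau>. ?w \<tau> * ball_mass L x' \<tau> * indicator {0<..2 * r} \<tau>" 2 0]
      by simp
    finally show ?thesis .
  qed
  with x'(1) show ?thesis by (rule that)
qed

end

section \<open>Mollification\<close>

lemma abs_mollifier: "s > 0 \<Longrightarrow> \<bar>mollifier s x\<bar> = mollifier s x"
  by (simp add: mollifier_nonneg)

text \<open>Written with \<open>x - y\<close> under the integral, so that by Fubini it is literally
  the adjoint of forming
  \<open>\<integral>y. c y * mollifier s (x - y) \<partial>\<nu>\<close>.\<close>

definition mollify :: "real \<Rightarrow> ('a::euclidean_space \<Rightarrow> real) \<Rightarrow> 'a \<Rightarrow> real" where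
  "mollify s \<zeta> y = (\<integral>x. \<zeta> x * mollifier s (x - y) \<partial>lborel)"

lemma integrable_mult_mollifier:
  fixes \<zeta> :: "'a::euclidean_space \<Rightarrow> real"
  assumes [measurable]: "\<zeta> \<in> borel_measurable borel" and "\<And>x. \<bar>\<zeta> x\<bar> \<le> B" "s > 0"
  shows "integrable lborel (\<lambda>x. \<zeta> x * mollifier s (x - y))"
proof (rule Bochner_Integration.integrable_bound)
  show "integrable lborel (\<lambda>x. B * mollifier s (x - y))"
    by (intro integrable_mult_right integrable_mollifier_shift assms)
  show "AE x in lborel. norm (\<zeta> x * mollifier s (x - y)) \<le> norm (B * mollifier s (x - y))"
    using assms order_trans[OF assms(2) abs_ge_self] by (auto simp: abs_mult intro!: AE_I2 mult_right_mono)
qed measurable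

lemma mollify_bound:
  fixes \<zeta> :: "'a::euclidean_space \<Rightarrow> real"
  assumes [measurable]: "\<zeta> \<in> borel_measurable borel" and B: "\<And>x. \<bar>\<zeta> x\<bar> \<le> B" and s: "s > 0"
  shows "\<bar>mollify s \<zeta> y\<bar> \<le> B"
proof -
  have "\<bar>mollify s \<zeta> y\<bar> \<le> (\<integral>x. \<bar>\<zeta> x * mollifier s (x - y)\<bar> \<partial>lborel)"
    unfolding mollify_def by (rule integral_abs_bound)
  also have "\<dots> \<le> (\<integral>x. B * mollifier s (x - y) \<partial>lborel)"
    using B
    by (intro Bochner_Integration.integral_mono integrable_abs integrable_mult_mollifier[OF _ B s]
        integrable_mult_right integrable_mollifier_shift s)
      (auto simp: abs_mult abs_mollifier[OF s] intro!: mult_right_mono mollifier_nonneg[OF s])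
  also have "\<dots> = B"
    using integral_mollifier_shift(1)[OF s, of y] by simp
  finally show ?thesis .
qed

lemma mollify_tendsto:
  fixes \<zeta> :: "'a::euclidean_space \<Rightarrow> real"
  assumes \<zeta>m[measurable]: "\<zeta> \<in> borel_measurable borel" and B: "\<And>x. \<bar>\<zeta> x\<bar> \<le> B" and cont: "isCont \<zeta> y"
    and s: "\<And>n::nat. s n > 0" "s \<longlonglongrightarrow> 0"
  shows "(\<lambda>n. mollify (s n) \<zeta> y) \<longlonglongrightarrow> \<zeta> y"
proof (rule LIMSEQ_I)
  fix e :: real assume e: "e > 0"
  then obtain d where d: "d > 0" "\<And>x. dist x y < d \<Longrightarrow> dist (\<zeta> x) (\<zeta> y) < e / 2"
    using cont unfolding continuous_at_eps_delta by (metis half_gt_zero)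
  have "\<forall>\<^sub>F n in sequentially. s n < d"
    using order_tendstoD(2)[OF s(2), of d] d by simp
  then have "\<forall>\<^sub>F n in sequentially. norm (mollify (s n) \<zeta> y - \<zeta> y) < e"
  proof eventually_elim
    case (elim n)
    have "mollify (s n) \<zeta> y - \<zeta> y = (\<integral>x. \<zeta> x * mollifier (s n) (x - y) \<partial>lborel) - (\<integral>x. \<zeta> y * mollifier (s n) (x - y) \<partial>lborel)"
      using integral_mollifier_shift(1)[OF s(1), of n y] by (simp add: mollify_def)
    also have "\<dots> = (\<integral>x. (\<zeta> x - \<zeta> y) * mollifier (s n) (x - y) \<partial>lborel)"
      unfolding left_diff_distrib
      by (rule Bochner_Integration.integral_diff[symmetric])
        (intro integrable_mult_mollifier[OF \<zeta>m B s(1)] integrable_mult_right integrable_mollifier_shift s)+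
    finally have eq: "mollify (s n) \<zeta> y - \<zeta> y = mollify (s n) (\<lambda>x. \<zeta> x - \<zeta> y) y"
      by (simp add: mollify_def)
    \<comment> \<open>The mollifier vanishes at distance \<open>d\<close> and beyond, so the
      function may be set to zero there; the global bound of \<open>mollify_bound\<close> then
      becomes \<open>e / 2\<close>.\<close>
    have "mollify (s n) (\<lambda>x. \<zeta> x - \<zeta> y) y = mollify (s n) (\<lambda>x. if dist x y < d then \<zeta> x - \<zeta> y else 0) y"
      unfolding mollify_def using elim
      by (intro Bochner_Integration.integral_cong refl) (auto simp: mollifier_eq_0[OF s(1)] dist_norm)
    also have "\<bar>\<dots>\<bar> \<le> e / 2"
      by (rule mollify_bound[OF _ _ s(1)]) (use d e in \<open>auto simp: dist_real_def less_imp_le\<close>)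
    finally show ?case
      using eq e by simp
  qed
  then show "\<exists>no. \<forall>n\<ge>no. norm (mollify (s n) \<zeta> y - \<zeta> y) < e"
    by (simp add: eventually_sequentially)
qed

context finite_borel_measure
begin

text \<open>The scale may depend on the source point \<open>y\<close>. For each fixed
  \<open>y\<close> the kernel still has integral one in \<open>x\<close>, so integrating in
  \<open>x\<close> first gives the \<open>L1\<close> bound without any loss.\<close>

lemma mollification_Fubini:
  fixes c s :: "'a \<Rightarrow> real"
  assumes c: "integrable \<nu> c" and s[measurable]: "s \<in> borel_measurable borel" and s0: "\<And>y. s y > 0"
  shows "(\<lambda>x. \<integral>y. c y * mollifier (s y) (x - y) \<partial>\<nu>) \<in> borel_measurable borel"
    and "integrable lborel (\<lambda>x. \<integral>y. c y * mollifier (s y) (x - y) \<partial>\<nu>)"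
    and "(\<integral>x. \<bar>\<integral>y. c y * mollifier (s y) (x - y) \<partial>\<nu>\<bar> \<partial>lborel) \<le> (\<integral>y. \<bar>c y\<bar> \<partial>\<nu>)"
    and "\<And>\<zeta> B. \<zeta> \<in> borel_measurable borel \<Longrightarrow> (\<And>x. \<bar>\<zeta> x\<bar> \<le> B) \<Longrightarrow>
      (\<integral>x. \<zeta> x * (\<integral>y. c y * mollifier (s y) (x - y) \<partial>\<nu>) \<partial>lborel) = (\<integral>y. c y * mollify (s y) \<zeta> y \<partial>\<nu>)"
proof -
  note [measurable] = borel_measurable_integrable[OF c]
  have mm[measurable]: "(\<lambda>z. mollifier (s (snd z)) (fst z - snd z)) \<in> borel_measurable (lborel \<Otimes>\<^sub>M \<nu>)"
    unfolding mollifier_def by measurable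
  interpret Q: pair_sigma_finite \<nu> lborel ..
  have Q: "integrable (\<nu> \<Otimes>\<^sub>M lborel) (\<lambda>(y, x). c y * mollifier (s y) (x - y))"
  proof (rule Q.Fubini_integrable)
    show "(\<lambda>(y, x). c y * mollifier (s y) (x - y)) \<in> borel_measurable (\<nu> \<Otimes>\<^sub>M lborel)"
      unfolding mollifier_def by measurable
    have "(\<integral>x. norm (c y * mollifier (s y) (x - y)) \<partial>lborel) = \<bar>c y\<bar>" for y
      using integral_mollifier_shift(1)[OF s0, of y y] by (simp add: abs_mult abs_mollifier[OF s0])
    then show "integrable \<nu> (\<lambda>y. \<integral>x. norm (case (y, x) of (y, x) \<Rightarrow> c y * mollifier (s y) (x - y)) \<partial>lborel)"
      using c by simp
    show "AE y in \<nu>. integrable lborel (\<lambda>x. case (y, x) of (y, x) \<Rightarrow> c y * mollifier (s y) (x - y))"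
      by (auto intro!: integrable_mult_right integrable_mollifier_shift s0)
  qed
  from Q.integrable_product_swap[OF this]
  have P: "integrable (lborel \<Otimes>\<^sub>M \<nu>) (\<lambda>(x, y). c y * mollifier (s y) (x - y))"
    by (simp add: split_beta')
  show int: "integrable lborel (\<lambda>x. \<integral>y. c y * mollifier (s y) (x - y) \<partial>\<nu>)"
    by (rule integrable_fst[OF P])
  then show "(\<lambda>x. \<integral>y. c y * mollifier (s y) (x - y) \<partial>\<nu>) \<in> borel_measurable borel"
    using borel_measurable_integrable by fastforce
  have Pa: "integrable (lborel \<Otimes>\<^sub>M \<nu>) (\<lambda>(x, y). \<bar>c y\<bar> * mollifier (s y) (x - y))"
    using integrable_abs[OF P] by (simp add: split_beta' abs_mult abs_mollifier[OF s0])
  have "(\<integral>x. \<bar>\<integral>y. c y * mollifier (s y) (x - y) \<partial>\<nu>\<bar> \<partial>lborel) \<le> (\<integral>x. \<integral>y. \<bar>c y\<bar> * mollifier (s y) (x - y) \<partial>\<nu> \<partial>lborel)"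
  proof (rule Bochner_Integration.integral_mono[OF integrable_abs[OF int] integrable_fst[OF Pa]])
    fix x
    show "\<bar>\<integral>y. c y * mollifier (s y) (x - y) \<partial>\<nu>\<bar> \<le> (\<integral>y. \<bar>c y\<bar> * mollifier (s y) (x - y) \<partial>\<nu>)"
      using integral_abs_bound[of \<nu> "\<lambda>y. c y * mollifier (s y) (x - y)"]
      by (simp add: abs_mult abs_mollifier[OF s0])
  qed
  also have "\<dots> = (\<integral>y. \<integral>x. \<bar>c y\<bar> * mollifier (s y) (x - y) \<partial>lborel \<partial>\<nu>)"
    by (rule Fubini_integral[symmetric, OF Pa])
  also have "\<dots> = (\<integral>y. \<bar>c y\<bar> \<partial>\<nu>)"
    by (simp add: integral_mollifier_shift(1)[OF s0])
  finally show "(\<integral>x. \<bar>\<integral>y. c y * mollifier (s y) (x - y) \<partial>\<nu>\<bar> \<partial>lborel) \<le> (\<integral>y. \<bar>c y\<bar> \<partial>\<nu>)" .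
  fix \<zeta> :: "'a \<Rightarrow> real" and B assume \<zeta>[measurable]: "\<zeta> \<in> borel_measurable borel" and B: "\<And>x. \<bar>\<zeta> x\<bar> \<le> B"
  have PZ: "integrable (lborel \<Otimes>\<^sub>M \<nu>) (\<lambda>(x, y). \<zeta> x * (c y * mollifier (s y) (x - y)))"
  proof (rule Bochner_Integration.integrable_bound[OF integrable_mult_right[OF P, of B]])
    show "AE z in lborel \<Otimes>\<^sub>M \<nu>. norm (case z of (x, y) \<Rightarrow> \<zeta> x * (c y * mollifier (s y) (x - y)))
        \<le> norm (B * (case z of (x, y) \<Rightarrow> c y * mollifier (s y) (x - y)))"
      using order_trans[OF B abs_ge_self] by (auto simp: abs_mult split_beta' intro!: AE_I2 mult_right_mono)
    show "(\<lambda>(x, y). \<zeta> x * (c y * mollifier (s y) (x - y))) \<in> borel_measurable (lborel \<Otimes>\<^sub>M \<nu>)"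
      unfolding mollifier_def by measurable
  qed
  have "(\<integral>x. \<zeta> x * (\<integral>y. c y * mollifier (s y) (x - y) \<partial>\<nu>) \<partial>lborel)
      = (\<integral>x. \<integral>y. \<zeta> x * (c y * mollifier (s y) (x - y)) \<partial>\<nu> \<partial>lborel)"
    by simp
  also have "\<dots> = (\<integral>y. \<integral>x. \<zeta> x * (c y * mollifier (s y) (x - y)) \<partial>lborel \<partial>\<nu>)"
    by (rule Fubini_integral[symmetric, OF PZ])
  also have "\<dots> = (\<integral>y. c y * mollify (s y) \<zeta> y \<partial>\<nu>)"
    unfolding mollify_def by (simp add: mult.left_commute[of _ "c _"])
  finally show "(\<integral>x. \<zeta> x * (\<integral>y. c y * mollifier (s y) (x - y) \<partial>\<nu>) \<partial>lborel) = (\<integral>y. c y * mollify (s y) \<zeta> y \<partial>\<nu>)" .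
qed

text \<open>The Laplacian of the kernel is a difference of two mollifiers, and Fubini moves each of
  them onto \<zeta>. Thus \<zeta> itself is never differentiated.\<close>

lemma integral_mult_laplacian_convolution:
  fixes c :: "'a \<Rightarrow> real"
  assumes c: "integrable \<nu> c" and s: "0 < s" "s \<le> r"
    and \<zeta>: "\<zeta> \<in> borel_measurable borel" "\<And>x. \<bar>\<zeta> x\<bar> \<le> B"
  shows "(\<integral>x. \<zeta> x * laplacian (\<lambda>x. \<integral>y. c y * potential_kernel s r (x - y) \<partial>\<nu>) x \<partial>lborel)
    = (\<integral>y. c y * mollify r \<zeta> y \<partial>\<nu>) - (\<integral>y. c y * mollify s \<zeta> y \<partial>\<nu>)"
proof -
  have r: "r > 0" using s by simp
  have "laplacian (\<lambda>x. \<integral>y. c y * potential_kernel s r (x - y) \<partial>\<nu>) x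
      = (\<integral>y. c y * mollifier r (x - y) \<partial>\<nu>) - (\<integral>y. c y * mollifier s (x - y) \<partial>\<nu>)" for x
    unfolding laplacian_convolution[OF potential_kernel_Cc[OF s] c sets_\<nu>]
    using integrable_convolution_Cc[OF mollifier_Cc[OF r] c sets_\<nu>, of x]
      integrable_convolution_Cc[OF mollifier_Cc[OF s(1)] c sets_\<nu>, of x]
    by (simp add: laplacian_potential_kernel[OF s] right_diff_distrib)
  moreover have int: "integrable lborel (\<lambda>x. \<zeta> x * (\<integral>y. c y * mollifier t (x - y) \<partial>\<nu>))" if t: "t > 0" for t
  proof -
    note F = mollification_Fubini(1,2)[where s="\<lambda>_. t", OF c borel_measurable_const t]
    note [measurable] = F(1) \<zeta>(1)
    show ?thesis
      by (rule Bochner_Integration.integrable_bound[OF integrable_mult_right[OF F(2), of B]])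
        (use order_trans[OF \<zeta>(2) abs_ge_self] in \<open>auto simp: abs_mult intro!: AE_I2 mult_right_mono\<close>)
  qed
  ultimately show ?thesis
    using mollification_Fubini(4)[where s="\<lambda>_. r", OF c borel_measurable_const r \<zeta>]
      mollification_Fubini(4)[where s="\<lambda>_. s", OF c borel_measurable_const s(1) \<zeta>]
      int[OF r] int[OF s(1)]
    by (simp add: right_diff_distrib)
qed

section \<open>Capacity of the set where the potential is infinite\<close>

lemma smooth_potential_Cc:
  assumes L: "compact L" and r: "(\<Union>y\<in>L. cball y r) \<subseteq> \<Omega>" and s: "0 < s" "s \<le> r"
  shows "smooth_potential L s r \<in> Cc_infinity \<Omega>"
  unfolding smooth_potential_def[abs_def]
  using borel_compact[OF L] s
  by (intro convolution_Cc[OF potential_kernel_Cc[OF s] integrable_indicator_\<nu> sets_\<nu> L _ _ r])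
    (auto simp: potential_kernel_eq_0)

text \<open>The test function is \<open>2 * (1 - exp (- V / t))\<close> for the smooth potential \<open>V\<close>. Since its values
  and \<open>t\<close> times its derivative with respect to \<open>V \<ge> 0\<close> are at most \<open>2\<close>, its energy is at most
  \<open>2 / t\<close> times \<open>2\<close> times the total mass of the measure generating \<open>V\<close>.\<close>

lemma capacity_superlevel_le:
  assumes L: "compact L" and r: "(\<Union>y\<in>L. cball y r) \<subseteq> \<Omega>" and s: "0 < s" "s \<le> r" and t: "0 < t"
    and \<Omega>: "open \<Omega>" and K: "\<And>x. x \<in> K \<Longrightarrow> t < smooth_potential L s r x"
  shows "cap_compact \<Omega> K \<le> ennreal (4 * measure \<nu> UNIV / t)"
proof -
  let ?M = "lebesgue_on \<Omega>"
  have b\<Omega>: "\<Omega> \<in> sets borel" using \<Omega> by simp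
  have Lb: "L \<in> sets borel" by (rule borel_compact[OF L])
  define V where "V = smooth_potential L s r"
  have V: "V \<in> Cc_infinity \<Omega>"
    unfolding V_def by (rule smooth_potential_Cc[OF L r s])
  have V0: "V x \<ge> 0" for x unfolding V_def by (rule smooth_potential_nonneg[OF s(1)])
  \<comment> \<open>A smooth substitute for truncating the potential at height \<open>t\<close>,
    since competitors for the capacity must be smooth. \<open>g n\<close> is the \<open>n\<close>-th
    derivative in \<open>u\<close>, in the form that \<open>Ck_on_compose\<close> expects.\<close>
  define g :: "nat \<Rightarrow> real \<Rightarrow> real" where
    "g n u = (if n = 0 then 2 * (1 - exp (- u / t)) else - 2 * (- 1 / t) ^ n * exp (- u / t))" for n u
  have gd: "(g n has_real_derivative g (Suc n) u) (at u)" for n u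
  proof (cases n)
    case 0
    then show ?thesis
      unfolding g_def using t by (auto intro!: derivative_eq_intros)
  next
    case (Suc m)
    have "((\<lambda>u. C * exp (- u / t)) has_real_derivative C * (exp (- u / t) * (- 1 / t))) (at u)" for C
      using t by (auto intro!: derivative_eq_intros)
    from this[of "- 2 * (- 1 / t) ^ n"] Suc show ?thesis
      unfolding g_def by (simp add: mult_ac)
  qed
  define \<phi> where "\<phi> x = g 0 (V x)" for x
  obtain K' where K': "compact K'" "K' \<subseteq> \<Omega>" "\<And>x. x \<notin> K' \<Longrightarrow> V x = 0"
    using V by (rule Cc_infinity_support) blast
  have \<phi>: "\<phi> \<in> Cc_infinity \<Omega>"
    unfolding \<phi>_def using K'
    by (intro Cc_infinityI[OF Ck_on_compose[of g, OF gd Cc_infinity_Ck[OF V]], of K']) (auto simp: g_def)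
  have grad: "grad \<phi> x = ((2 / t) * exp (- V x / t)) *\<^sub>R grad V x" for x
  proof -
    have "(\<phi> has_derivative (\<lambda>h. frechet_derivative V (at x) h * g 1 (V x))) (at x)"
      unfolding \<phi>_def One_nat_def
      by (rule DERIV_compose_FDERIV[OF gd Cc_infinity_has_derivative[OF V]])
    from frechet_derivative_at[OF this, symmetric] show ?thesis
      unfolding grad_def scaleR_sum_right by (simp add: g_def mult_ac)
  qed
  have \<phi>01: "0 \<le> \<phi> x" "\<phi> x \<le> 2" for x
    using V0[of x] t by (auto simp: \<phi>_def g_def)
  have c: "integrable \<nu> (indicator L :: 'a \<Rightarrow> real)"
    by (rule integrable_indicator_\<nu>[OF Lb])
  \<comment> \<open>The gradient of \<phi> is that of \<open>V\<close> times a factor between 0 and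
    \<open>2 / t\<close>; bounding one of the two such factors leaves a quantity linear in the
    equation for \<open>V\<close>.\<close>
  have sq: "(norm (grad \<phi> x))\<^sup>2 \<le> (2 / t) * (grad \<phi> x \<bullet> grad V x)" for x
  proof -
    define e where "e = (2 / t) * exp (- V x / t)"
    have e: "0 \<le> e" "e \<le> 2 / t"
      using t V0[of x] by (auto simp: e_def field_simps)
    have "(norm (grad \<phi> x))\<^sup>2 = e * (e * (grad V x \<bullet> grad V x))"
      unfolding grad power2_norm_eq_inner e_def[symmetric] by simp
    also have "\<dots> \<le> (2 / t) * (e * (grad V x \<bullet> grad V x))"
      using e by (intro mult_right_mono) auto
    finally show ?thesis unfolding grad e_def by simp
  qed
  have lb: "f \<in> borel_measurable ?M" if "f \<in> borel_measurable borel" for f :: "'a \<Rightarrow> 'c::euclidean_space"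
    using that by (intro measurable_restrict_space1 measurable_completion) simp
  have gV: "continuous_on UNIV (grad V)" and g\<phi>: "continuous_on UNIV (grad \<phi>)"
    by (rule grad_continuous[OF V], rule grad_continuous[OF \<phi>])
  have int: "integrable ?M (\<lambda>x. grad \<phi> x \<bullet> grad V x)"
  proof -
    have "integrable ?M (\<lambda>x. \<Sum>i\<in>Basis. frechet_derivative V (at x) i *\<^sub>R (grad \<phi> x \<bullet> i))"
      using Cc_infinity_partial[OF V] continuous_locally_integrable[of "\<lambda>x. grad \<phi> x \<bullet> i" \<Omega> for i] g\<phi>
      by (intro Bochner_Integration.integrable_sum locally_integrable_mult_Cc[OF b\<Omega>] continuous_locally_integrable
          continuous_on_inner continuous_on_const) auto
    then show ?thesis
      by (subst euclidean_inner) (simp add: grad_inner_Basis mult.commute)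
  qed
  have "(\<integral>x. grad \<phi> x \<bullet> grad V x \<partial>?M) = - (\<integral>x. \<phi> x * laplacian V x \<partial>?M)"
    by (rule weak_gradient_laplacian[OF b\<Omega> has_weak_gradient_Cc[OF b\<Omega> \<phi>] V])
  also have "(\<integral>x. \<phi> x * laplacian V x \<partial>?M) = (\<integral>x. \<phi> x * laplacian V x \<partial>lborel)"
    using Cc_infinity_borel[OF \<phi>] borel_measurable_continuous_onI[OF laplacian_continuous[OF V]]
    by (intro lebesgue_on_integral_eq[OF b\<Omega>]) (auto simp: Cc_infinity_outside[OF \<phi>])
  also have "\<dots> = (\<integral>y. indicator L y * mollify r \<phi> y \<partial>\<nu>) - (\<integral>y. indicator L y * mollify s \<phi> y \<partial>\<nu>)"
    unfolding V_def smooth_potential_def[abs_def]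
    by (rule integral_mult_laplacian_convolution[OF c s Cc_infinity_borel[OF \<phi>], of 2]) (use \<phi>01 in auto)
  finally have eq: "(\<integral>x. grad \<phi> x \<bullet> grad V x \<partial>?M)
      = (\<integral>y. indicator L y * mollify s \<phi> y \<partial>\<nu>) - (\<integral>y. indicator L y * mollify r \<phi> y \<partial>\<nu>)"
    by simp
  \<comment> \<open>The coarse-scale term enters the energy with a minus sign and is dropped; the
    fine-scale term integrates values at most 2 against \<nu>.\<close>
  have "(\<integral>y. indicator L y * mollify r \<phi> y \<partial>\<nu>) \<ge> 0"
    unfolding mollify_def
    by (intro Bochner_Integration.integral_nonneg mult_nonneg_nonneg mollifier_nonneg \<phi>01(1) less_le_trans[OF s])
      simp
  moreover have "(\<integral>y. indicator L y * mollify s \<phi> y \<partial>\<nu>) \<le> (\<integral>y. 2 \<partial>\<nu>)"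
  proof (rule Bochner_Integration.integral_mono')
    fix y
    have "mollify s \<phi> y \<le> 2"
      using mollify_bound[OF Cc_infinity_borel[OF \<phi>] _ s(1), of 2 y] \<phi>01 by fastforce
    then show "indicator L y * mollify s \<phi> y \<le> 2" by (simp add: indicator_def)
  qed auto
  ultimately have le: "(\<integral>x. grad \<phi> x \<bullet> grad V x \<partial>?M) \<le> 2 * measure \<nu> UNIV"
    unfolding eq by simp
  have "(\<integral>\<^sup>+x. ennreal ((norm (grad \<phi> x))\<^sup>2) \<partial>?M) \<le> (\<integral>\<^sup>+x. ennreal ((2 / t) * (grad \<phi> x \<bullet> grad V x)) \<partial>?M)"
    by (intro nn_integral_mono ennreal_leI sq)
  also have "\<dots> = ennreal (\<integral>x. (2 / t) * (grad \<phi> x \<bullet> grad V x) \<partial>?M)"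
    using order_trans[OF zero_le_power2 sq]
    by (intro nn_integral_eq_integral integrable_mult_right int) auto
  also have "\<dots> \<le> ennreal (4 * measure \<nu> UNIV / t)"
    using le t by (intro ennreal_leI) (simp add: field_simps)
  finally have energy: "(\<integral>\<^sup>+x. ennreal ((norm (grad \<phi> x))\<^sup>2) \<partial>?M) \<le> ennreal (4 * measure \<nu> UNIV / t)" .
  let ?U = "{x. t < V x}"
  have "open ?U"
    using Cc_infinity_continuous[OF V] by (intro open_Collect_less) auto
  moreover have "K \<subseteq> ?U" using K by (auto simp: V_def)
  moreover have "1 \<le> \<phi> x" if "x \<in> ?U" for x
  proof -
    \<comment> \<open>Where \<open>V\<close> exceeds \<open>t\<close>,
      \<open>1 - exp (- V x / t)\<close> is at least one half; the factor 2 in \<phi> compensates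
      for this.\<close>
    have "1 \<le> V x / t" using that t by simp
    then have "2 \<le> exp (V x / t)"
      using exp_ge_add_one_self[of "V x / t"] by linarith
    then have "exp (- V x / t) \<le> 1 / 2"
      by (simp add: exp_minus field_simps)
    then show ?thesis by (simp add: \<phi>_def g_def)
  qed
  ultimately have "cap_compact \<Omega> K \<le> (\<integral>\<^sup>+x. ennreal ((norm (grad \<phi> x))\<^sup>2) \<partial>?M)"
    unfolding cap_compact_def using \<phi> by (intro INF_lower) blast
  with energy show ?thesis by (rule order_trans[rotated])
qed

text \<open>The set where the potential exceeds \<open>t\<close> is open. By compactness and
  monotonicity in the scale, a compact subset of it lies in a superlevel set of a single smooth
  potential, so its capacity is at most a constant over \<open>t\<close>; then \<open>t\<close>
  tends to infinity.\<close>

lemma capacity_potential_top: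
  assumes L: "compact L" and r: "0 < r" "(\<Union>y\<in>L. cball y r) \<subseteq> \<Omega>" and \<Omega>: "open \<Omega>"
  shows "cap \<Omega> {x \<in> \<Omega>. potential L r x = top} = 0"
proof -
  have Lb: "L \<in> sets borel" by (rule borel_compact[OF L])
  let ?V = "\<lambda>n. smooth_potential L (r / real (Suc n)) r"
  have sn: "0 < r / real (Suc n)" "r / real (Suc n) \<le> r" for n
    using r by (auto simp: divide_le_eq)
  have Vmono: "?V m x \<le> ?V n x" if "m \<le> n" for m n x
    using that r sn by (intro smooth_potential_antimono[OF Lb] frac_le) auto
  have le: "cap \<Omega> {x \<in> \<Omega>. potential L r x = top} \<le> ennreal (4 * measure \<nu> UNIV / t)" if t: "t > 0" for t
  proof -
    let ?O = "\<lambda>n. {x. t < ?V n x}"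
    let ?U = "{x \<in> \<Omega>. ennreal t < potential L r x}"
    have O: "open (?O n)" for n
      using Cc_infinity_continuous[OF smooth_potential_Cc[OF L r(2) sn]]
      by (intro open_Collect_less) auto
    have Ueq: "?U = \<Omega> \<inter> (\<Union>n. ?O n)"
      unfolding potential_eq_SUP[OF Lb r(1)] less_SUP_iff
      using t by (auto simp: ennreal_less_iff)
    have "open ?U"
      unfolding Ueq using O \<Omega> by (intro open_Int open_UN) auto
    have "cap_open \<Omega> ?U \<le> ennreal (4 * measure \<nu> UNIV / t)"
      unfolding cap_open_def
    proof (rule SUP_least)
      fix K assume "K \<in> {K. compact K \<and> K \<subseteq> ?U}"
      then have K: "compact K" "K \<subseteq> (\<Union>n\<in>UNIV. ?O n)" unfolding Ueq by auto
      obtain C where C: "finite C" "K \<subseteq> (\<Union>n\<in>C. ?O n)"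
        by (rule compactE_image[OF K(1) O K(2)])
      have "t < ?V (Max C) x" if x: "x \<in> K" for x
      proof -
        obtain n where "n \<in> C" "t < ?V n x" using C x by auto
        then show ?thesis using Vmono[of n "Max C" x] C(1) by auto
      qed
      then show "cap_compact \<Omega> K \<le> ennreal (4 * measure \<nu> UNIV / t)"
        by (intro capacity_superlevel_le[OF L r(2) sn t \<Omega>]) auto
    qed
    moreover have "cap \<Omega> {x \<in> \<Omega>. potential L r x = top} \<le> cap_open \<Omega> ?U"
      unfolding cap_def using \<open>open ?U\<close> by (intro INF_lower) auto
    ultimately show ?thesis by (rule order_trans[rotated])
  qed
  have "(\<lambda>n. ennreal (4 * measure \<nu> UNIV / real (Suc n))) \<longlonglongrightarrow> ennreal 0"
    by (intro tendsto_ennrealI LIMSEQ_Suc[OF lim_const_over_n])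
  then have "cap \<Omega> {x \<in> \<Omega>. potential L r x = top} \<le> ennreal 0"
    by (rule LIMSEQ_le_const) (auto intro!: exI[of _ 0] le)
  then show ?thesis by simp
qed

end

section \<open>Compact sets with uniformly small potential\<close>

context finite_borel_measure
begin

lemma inner_compact:
  assumes A: "A \<in> sets borel" and e: "e > 0"
  obtains K where "compact K" "K \<subseteq> A" "measure \<nu> (A - K) < e"
proof (cases "measure \<nu> A < e")
  case True
  then show ?thesis by (intro that[of "{}"]) auto
next
  case False
  have "ennreal (measure \<nu> A - e) < ennreal (measure \<nu> A)"
    using e False by (intro ennreal_lessI) auto
  also have "\<dots> = (SUP K \<in> {K. K \<subseteq> A \<and> compact K}. emeasure \<nu> K)"
    unfolding emeasure_eq_measure[symmetric] by (rule inner_regular[OF sets_\<nu> _ A]) simp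
  finally obtain K where K: "K \<subseteq> A" "compact K" "ennreal (measure \<nu> A - e) < ennreal (measure \<nu> K)"
    unfolding less_SUP_iff emeasure_eq_measure by auto
  have "measure \<nu> A - e < measure \<nu> K"
    by (rule ennreal_less_iff[THEN iffD1, OF _ K(3)]) (use False in simp)
  then have "measure \<nu> (A - K) < e"
    using finite_measure_Diff[of A K] A K borel_compact[OF K(2)] by (simp add: sets_\<nu>)
  then show ?thesis using K by (intro that) auto
qed

lemma potential_borel:
  assumes L: "L \<in> sets borel" and r: "0 < r"
  shows "potential L r \<in> borel_measurable borel"
proof -
  have [measurable]: "smooth_potential L (r / real (Suc n)) r \<in> borel_measurable borel" for n
  proof -
    have "Ck_on 0 UNIV (smooth_potential L (r / real (Suc n)) r)"
      unfolding smooth_potential_def[abs_def] using r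
      by (intro Ck_on_convolution potential_kernel_Cc integrable_indicator_\<nu>[OF L] sets_\<nu>) (auto simp: divide_le_eq)
    then show ?thesis
      by (intro borel_measurable_continuous_onI) simp
  qed
  show ?thesis
    unfolding potential_eq_SUP[OF L r, abs_def] by measurable
qed

text \<open>A condition of Kato type. The point \<open>x\<close> ranges over the whole space and not
  only over \<open>L\<close>, because \<open>v\<close> is to be small everywhere.\<close>

definition uniformly_small_potential :: "'a set \<Rightarrow> bool" where
  "uniformly_small_potential L \<longleftrightarrow> (\<forall>e>0. \<exists>r>0. \<forall>x. potential L r x \<le> ennreal e)"

lemma potential_null:
  assumes "L \<in> sets borel" "emeasure \<nu> L = 0"
  shows "potential L r x = 0"
proof -
  have "AE y in \<nu>. y \<notin> L"
    using assms by (intro AE_not_in) (auto simp: null_sets_def sets_\<nu>)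
  then have "ball_mass L x \<sigma> = 0" for \<sigma>
    unfolding ball_mass_def by (subst nn_integral_cong_AE[of _ "\<lambda>_. 0"]) (auto elim!: eventually_mono)
  then show ?thesis
    by (simp add: potential_def emeasure_scale_measure_at[OF assms(1)])
qed

text \<open>Subadditivity of the potential in the set; it allows the compact sets of the exhaustion
  to be made increasing.\<close>

lemma uniformly_small_potential_Un:
  assumes L: "L \<in> sets borel" "L' \<in> sets borel"
    and small: "uniformly_small_potential L" "uniformly_small_potential L'"
  shows "uniformly_small_potential (L \<union> L')"
  unfolding uniformly_small_potential_def
proof safe
  fix e :: real assume "e > 0"
  then have e2: "e / 2 > 0" by simp
  obtain r where r: "r > 0" "\<And>x. potential L r x \<le> ennreal (e / 2)"
    using small(1) e2 unfolding uniformly_small_potential_def by blast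
  obtain r' where r': "r' > 0" "\<And>x. potential L' r' x \<le> ennreal (e / 2)"
    using small(2) e2 unfolding uniformly_small_potential_def by blast
  have "potential (L \<union> L') (min r r') x \<le> ennreal e" for x
  proof -
    have "potential (L \<union> L') (min r r') x \<le> potential L (min r r') x + potential L' (min r r') x"
      by (rule potential_Un_le[OF L])
    also have "\<dots> \<le> potential L r x + potential L' r' x"
      by (intro add_mono potential_mono L) auto
    also have "\<dots> \<le> ennreal (e / 2) + ennreal (e / 2)"
      by (intro add_mono r r')
    also have "\<dots> = ennreal e"
      using \<open>e > 0\<close> by (simp flip: ennreal_plus)
    finally show ?thesis .
  qed
  then show "\<exists>r>0. \<forall>x. potential (L \<union> L') r x \<le> ennreal e"
    using r(1) r'(1) by (intro exI[of _ "min r r'"]) auto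
qed

text \<open>This is Egorov's theorem for the pointwise convergence in \<open>potential_tendsto_0\<close>, combined
  with the maximum principle.\<close>

lemma exists_uniformly_small_potential:
  assumes \<Omega>: "open \<Omega>" and \<eta>: "\<eta> > 0"
    and diffuse: "\<And>A. A \<in> sets borel \<Longrightarrow> A \<subseteq> \<Omega> \<Longrightarrow> cap \<Omega> A = 0 \<Longrightarrow> emeasure \<nu> A = 0"
  obtains L where "compact L" "L \<subseteq> \<Omega>" "measure \<nu> (\<Omega> - L) < \<eta>" "uniformly_small_potential L"
proof -
  have b\<Omega>[measurable]: "\<Omega> \<in> sets borel" using \<Omega> by simp
  \<comment> \<open>There are three losses of mass: outside \<open>L0\<close>, in the exceptional
    sets \<open>D\<close>, and in passing to a compact subset at the end.\<close>
  have \<eta>3: "\<eta> / 3 > 0" using \<eta> by simp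
  obtain L0 where L0: "compact L0" "L0 \<subseteq> \<Omega>" "measure \<nu> (\<Omega> - L0) < \<eta> / 3"
    by (rule inner_compact[OF b\<Omega> \<eta>3])
  have bL0[measurable]: "L0 \<in> sets borel" by (rule borel_compact[OF L0(1)])
  obtain r where r: "r > 0" "(\<Union>y\<in>L0. cball y r) \<subseteq> \<Omega>"
    by (rule compact_neighbourhood_radius[OF L0(1) \<Omega> L0(2)])
  define A where "A = {x \<in> \<Omega>. potential L0 r x = top}"
  have [measurable]: "potential L0 r \<in> borel_measurable borel"
    by (rule potential_borel[OF bL0 r(1)])
  have bA: "A \<in> sets borel"
    unfolding A_def by measurable
  have A0: "emeasure \<nu> A = 0"
    using capacity_potential_top[OF L0(1) r \<Omega>] by (intro diffuse[OF bA]) (auto simp: A_def)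
  have rn: "r / real (Suc n) > 0" for n using r(1) by simp
  \<comment> \<open>The exceptional set of Egorov's argument: points where truncation at the
    \<open>n\<close>-th radius has not yet brought the potential below the \<open>j\<close>-th
    threshold.\<close>
  define D where "D j n = {x \<in> L0. ennreal (1 / real (Suc j)) < potential L0 (r / real (Suc n)) x}" for j n
  have bD[measurable]: "D j n \<in> sets borel" for j n
    unfolding D_def using potential_borel[OF bL0 rn[of n]] by measurable
  have "\<exists>n. measure \<nu> (D j n) < \<eta> / 3 * (1 / 2) ^ Suc j" for j
  proof -
    have "(\<lambda>n. measure \<nu> (D j n)) \<longlonglongrightarrow> measure \<nu> (\<Inter>n. D j n)"
    proof (rule finite_Lim_measure_decseq)
      show "range (D j) \<subseteq> sets \<nu>" by (auto simp: sets_\<nu>)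
      show "decseq (D j)"
      proof (rule decseq_SucI, rule subsetI)
        fix n x assume x: "x \<in> D j (Suc n)"
        have "potential L0 (r / real (Suc (Suc n))) x \<le> potential L0 (r / real (Suc n)) x"
          using r(1) by (intro potential_mono bL0 frac_le) auto
        with x show "x \<in> D j n" unfolding D_def by auto
      qed
    qed
    moreover have "measure \<nu> (\<Inter>n. D j n) = 0"
    proof -
      \<comment> \<open>At a point of finite potential the truncated potentials tend to zero, so a
        point lying in every \<open>D j n\<close> has infinite potential and belongs to the null set
        \<open>A\<close>.\<close>
      have "(\<Inter>n. D j n) \<subseteq> A"
      proof
        fix x assume x: "x \<in> (\<Inter>n. D j n)"
        then have xL: "x \<in> L0" unfolding D_def by blast
        have big: "ennreal (1 / real (Suc j)) < potential L0 (r / real (Suc n)) x" for n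
          using INT_D[OF x, of n] unfolding D_def by simp
        have "potential L0 r x = top"
        proof (rule ccontr)
          assume "potential L0 r x \<noteq> top"
          from potential_tendsto_0[OF bL0 r(1) this]
          have "ennreal (1 / real (Suc j)) \<le> 0"
            by (rule LIMSEQ_le_const) (use big less_imp_le in blast)
          then show False by simp
        qed
        then show "x \<in> A" using xL L0(2) by (auto simp: A_def)
      qed
      then have "measure \<nu> (\<Inter>n. D j n) \<le> measure \<nu> A"
        using bA by (intro finite_measure_mono) (auto simp: sets_\<nu>)
      then show ?thesis
        using A0 measure_nonneg[of \<nu> "\<Inter>n. D j n"] by (simp add: measure_eq_emeasure_eq_ennreal[of 0] antisym)
    qed
    ultimately have "\<forall>\<^sub>F n in sequentially. measure \<nu> (D j n) < \<eta> / 3 * (1 / 2) ^ Suc j"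
      using \<eta> by (intro order_tendstoD(2)) auto
    then show ?thesis
      by (auto simp: eventually_sequentially)
  qed
  then obtain n where n: "\<And>j. measure \<nu> (D j (n j)) < \<eta> / 3 * (1 / 2) ^ Suc j" by metis
  define E where "E = L0 - (\<Union>j. D j (n j))"
  have bE: "E \<in> sets borel"
    unfolding E_def by measurable
  have sums: "(\<lambda>j. \<eta> / 3 * (1 / 2) ^ Suc j) sums (\<eta> / 3)"
    using sums_mult[OF power_half_series, of "\<eta> / 3"] by simp
  have summ: "summable (\<lambda>j. measure \<nu> (D j (n j)))"
    by (rule summable_comparison_test'[OF sums_summable[OF sums], of 0]) (use n less_imp_le in auto)
  have "measure \<nu> (\<Union>j. D j (n j)) \<le> (\<Sum>j. measure \<nu> (D j (n j)))"
    by (rule finite_measure_subadditive_countably[OF _ summ]) (auto simp: sets_\<nu>)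
  also have "\<dots> \<le> (\<Sum>j. \<eta> / 3 * (1 / 2) ^ Suc j)"
    by (rule suminf_le[OF less_imp_le[OF n] summ sums_summable[OF sums]])
  also have "\<dots> = \<eta> / 3"
    by (rule sums_unique[OF sums, symmetric])
  finally have UD: "measure \<nu> (\<Union>j. D j (n j)) \<le> \<eta> / 3" .
  obtain L where L: "compact L" "L \<subseteq> E" "measure \<nu> (E - L) < \<eta> / 3"
    by (rule inner_compact[OF bE \<eta>3])
  have bL: "L \<in> sets borel" by (rule borel_compact[OF L(1)])
  have "measure \<nu> (\<Omega> - L) \<le> measure \<nu> ((\<Omega> - L0) \<union> (\<Union>j. D j (n j)) \<union> (E - L))"
    using bL bE bL0 b\<Omega> by (intro finite_measure_mono) (auto simp: sets_\<nu> E_def)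
  also have "\<dots> \<le> measure \<nu> ((\<Omega> - L0) \<union> (\<Union>j. D j (n j))) + measure \<nu> (E - L)"
    using bL bE bL0 b\<Omega> by (intro measure_Un_le) (auto simp: sets_\<nu>)
  also have "\<dots> \<le> measure \<nu> (\<Omega> - L0) + measure \<nu> (\<Union>j. D j (n j)) + measure \<nu> (E - L)"
    using bL0 b\<Omega> by (intro add_right_mono measure_Un_le) (auto simp: sets_\<nu>)
  also have "\<dots> < \<eta>"
    using L0(3) UD L(3) by linarith
  finally have small: "measure \<nu> (\<Omega> - L) < \<eta>" .
  have LL0: "L \<subseteq> L0" using L(2) by (auto simp: E_def)
  have "uniformly_small_potential L"
    unfolding uniformly_small_potential_def
  proof safe
    fix e :: real assume e: "e > 0"
    let ?C = "2 ^ (DIM('a) - 1) :: real"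
    \<comment> \<open>The threshold absorbs the constant \<open>?C\<close> of the maximum principle,
      and \<open>t\<close> is half of \<open>u\<close> because that principle doubles the
      radius.\<close>
    obtain j where j: "inverse (real (Suc j)) < e / ?C"
      using reals_Archimedean[of "e / ?C"] e by auto
    define u where "u = r / real (Suc (n j))"
    define t where "t = u / 2"
    have "potential L t x \<le> ennreal e" for x
    proof (cases "L = {}")
      case True
      then show ?thesis using potential_null[of "{}"] by simp
    next
      case False
      obtain x' where x': "x' \<in> L" "potential L t x \<le> 2 ^ (DIM('a) - 1) * potential L (2 * t) x'"
        by (rule potential_maximum_principle[OF L(1) False]) blast
      \<comment> \<open>The maximum principle has moved the point into \<open>L\<close>, where
        \<open>D\<close> is avoided; the sets \<open>D\<close> were formed with \<open>L0\<close>,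
        so the potential is enlarged to that of \<open>L0\<close>.\<close>
      have "potential L (2 * t) x' \<le> potential L0 u x'"
        by (intro potential_mono bL bL0 LL0) (simp add: t_def)
      also have "\<dots> \<le> ennreal (1 / real (Suc j))"
      proof -
        have "x' \<notin> D j (n j)" "x' \<in> L0" using x'(1) L(2) by (auto simp: E_def)
        then show ?thesis unfolding D_def u_def by auto
      qed
      finally have "2 ^ (DIM('a) - 1) * potential L (2 * t) x' \<le> ennreal ?C * ennreal (1 / real (Suc j))"
        by (intro mult_mono) (auto simp: ennreal_power[symmetric])
      also have "\<dots> = ennreal (?C * (1 / real (Suc j)))"
        by (rule ennreal_mult[symmetric]) auto
      also have "\<dots> \<le> ennreal e"
        using j by (intro ennreal_leI) (simp add: field_simps)
      finally show ?thesis using x'(2) by simp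
    qed
    moreover have "t > 0" using r(1) by (simp add: t_def u_def)
    ultimately show "\<exists>r>0. \<forall>x. potential L r x \<le> ennreal e" by blast
  qed
  with L(1) small show ?thesis
    using LL0 L0(2) by (intro that) auto
qed

text \<open>Compact sets missing less mass than \<open>(1 / 2) ^ n\<close> are joined to finite
  unions; these increase, keep uniformly small potentials, and exhaust the measure.\<close>

lemma exists_exhaustion:
  assumes \<Omega>: "open \<Omega>"
    and diffuse: "\<And>A. A \<in> sets borel \<Longrightarrow> A \<subseteq> \<Omega> \<Longrightarrow> cap \<Omega> A = 0 \<Longrightarrow> emeasure \<nu> A = 0"
    and conc: "emeasure \<nu> (- \<Omega>) = 0"
  obtains L :: "nat \<Rightarrow> 'a set" where "\<And>k. compact (L k)" "\<And>k. L k \<subseteq> \<Omega>" "\<And>k. L k \<subseteq> L (Suc k)"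
    "\<And>k. uniformly_small_potential (L k)" "AE y in \<nu>. y \<in> (\<Union>k. L k)"
proof -
  have "\<exists>K. compact K \<and> K \<subseteq> \<Omega> \<and> measure \<nu> (\<Omega> - K) < (1 / 2) ^ n \<and> uniformly_small_potential K" for n :: nat
    by (rule exists_uniformly_small_potential[OF \<Omega> _ diffuse, of "(1 / 2) ^ n"]) auto
  then obtain K where K: "\<And>n::nat. compact (K n)" "\<And>n. K n \<subseteq> \<Omega>" "\<And>n. measure \<nu> (\<Omega> - K n) < (1 / 2) ^ n"
    "\<And>n. uniformly_small_potential (K n)" by metis
  have bK[measurable]: "K n \<in> sets borel" for n by (rule borel_compact[OF K(1)])
  have b\<Omega>[measurable]: "\<Omega> \<in> sets borel" using \<Omega> by simp
  define L where "L k = (\<Union>n\<le>k. K n)" for k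
  have L_Suc: "L (Suc k) = L k \<union> K (Suc k)" for k
    by (auto simp: L_def atMost_Suc)
  have bL: "L k \<in> sets borel" for k unfolding L_def by measurable
  show ?thesis
  proof (rule that[of L])
    show "compact (L k)" for k unfolding L_def by (intro compact_UN K) auto
    show "L k \<subseteq> \<Omega>" for k unfolding L_def using K(2) by blast
    show "L k \<subseteq> L (Suc k)" for k by (simp add: L_Suc)
    show "uniformly_small_potential (L k)" for k
    proof (induction k)
      case 0
      show ?case using K(4)[of 0] by (simp add: L_def)
    next
      case (Suc k)
      show ?case unfolding L_Suc by (rule uniformly_small_potential_Un[OF bL bK Suc K(4)])
    qed
    have "measure \<nu> (\<Omega> - (\<Union>n. K n)) \<le> (1 / 2) ^ n" for n
    proof -
      have "measure \<nu> (\<Omega> - (\<Union>n. K n)) \<le> measure \<nu> (\<Omega> - K n)"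
        by (intro finite_measure_mono) (auto simp: sets_\<nu>)
      with K(3)[of n] show ?thesis by simp
    qed
    then have "measure \<nu> (\<Omega> - (\<Union>n. K n)) \<le> 0"
      by (intro LIMSEQ_le_const[OF LIMSEQ_realpow_zero[of "1 / 2"]]) auto
    then have "emeasure \<nu> (\<Omega> - (\<Union>n. K n)) = 0"
      by (simp add: emeasure_eq_measure measure_le_0_iff)
    then have "AE y in \<nu>. y \<notin> \<Omega> - (\<Union>n. K n)"
      by (intro AE_not_in) (auto simp: null_sets_def sets_\<nu>)
    moreover have "AE y in \<nu>. y \<notin> - \<Omega>"
      using conc by (intro AE_not_in) (auto simp: null_sets_def sets_\<nu>)
    ultimately show "AE y in \<nu>. y \<in> (\<Union>k. L k)"
      by eventually_elim (auto simp: L_def)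
  qed
qed

end

section \<open>The decomposition\<close>

text \<open>Members of \<open>C_0\<close> have arbitrary values outside the closure of \<Omega>,
  hence the indicator. Continuity at points of \<Omega> is what the limits need, because the measure
  is concentrated there.\<close>

lemma C_0_times_indicator:
  fixes \<Omega> :: "'a::euclidean_space set"
  assumes \<Omega>: "open \<Omega>" "bounded \<Omega>" and \<zeta>: "\<zeta> \<in> C_0 \<Omega>"
  obtains B where "B \<ge> 0" "\<And>x. \<bar>indicator \<Omega> x * \<zeta> x\<bar> \<le> B"
    "(\<lambda>x. indicator \<Omega> x * \<zeta> x) \<in> borel_measurable borel"
    "\<And>y. y \<in> \<Omega> \<Longrightarrow> isCont (\<lambda>x. indicator \<Omega> x * \<zeta> x) y"
proof -
  have cont: "continuous_on (closure \<Omega>) \<zeta>"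
    using \<zeta> by (simp add: C_0_def)
  have cont': "continuous_on \<Omega> \<zeta>"
    by (rule continuous_on_subset[OF cont closure_subset])
  have "bounded (\<zeta> ` closure \<Omega>)"
    using \<Omega> cont by (intro compact_imp_bounded compact_continuous_image) (auto simp: compact_closure)
  then obtain B where B: "\<And>x. x \<in> closure \<Omega> \<Longrightarrow> \<bar>\<zeta> x\<bar> \<le> B"
    unfolding bounded_iff by auto
  have "\<bar>indicator \<Omega> x * \<zeta> x\<bar> \<le> max B 0" for x
    using B[of x] closure_subset[of \<Omega>] by (cases "x \<in> \<Omega>") (auto simp: subset_iff)
  moreover have "\<zeta> \<in> borel_measurable (restrict_space borel \<Omega>)"
    by (rule borel_measurable_continuous_on_restrict[OF cont'])
  then have "(\<lambda>x. indicator \<Omega> x * \<zeta> x) \<in> borel_measurable borel"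
    using \<Omega>(1) by (simp add: borel_measurable_restrict_space_iff)
  moreover have "isCont (\<lambda>x. indicator \<Omega> x * \<zeta> x) y" if "y \<in> \<Omega>" for y
  proof -
    have "continuous_on \<Omega> (\<lambda>x. indicator \<Omega> x * \<zeta> x)"
      by (rule continuous_on_eq[OF cont']) simp
    then show ?thesis
      using that \<Omega>(1) continuous_on_eq_continuous_at by blast
  qed
  ultimately show ?thesis
    by (intro that[of "max B 0"]) auto
qed

lemma lborel_integrable_L1_on:
  fixes f :: "'a::euclidean_space \<Rightarrow> real"
  assumes f: "integrable lborel f" and \<Omega>: "\<Omega> \<in> sets borel"
  shows "f \<in> L1_on \<Omega>" "L1_norm \<Omega> f \<le> (\<integral>x. \<bar>f x\<bar> \<partial>lborel)"
proof -
  note [measurable] = borel_measurable_integrable[OF f] \<Omega>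
  have i: "integrable lborel (\<lambda>x. indicator \<Omega> x *\<^sub>R f x)"
    by (rule integrable_mult_indicator[OF _ f]) simp
  then show "f \<in> L1_on \<Omega>"
    using \<Omega> by (simp add: L1_on_def integrable_restrict_space integrable_completion)
  have "L1_norm \<Omega> f = (\<integral>x. indicator \<Omega> x *\<^sub>R \<bar>f x\<bar> \<partial>lborel)"
    using \<Omega> by (simp add: L1_norm_def integral_restrict_space integral_completion)
  also have "\<dots> \<le> (\<integral>x. \<bar>f x\<bar> \<partial>lborel)"
    by (intro Bochner_Integration.integral_mono integrable_mult_indicator[OF _ integrable_abs[OF f]] integrable_abs[OF f])
      (auto simp: indicator_def)
  finally show "L1_norm \<Omega> f \<le> (\<integral>x. \<bar>f x\<bar> \<partial>lborel)" .
qed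

context finite_borel_measure
begin

text \<open>The scales \<open>s k\<close> are chosen so small that the potential of \<open>\<nu>\<close> on \<open>L k\<close> truncated at \<open>s k\<close> is
  negligible, and \<open>v\<close> is minus the potential in which only scales below \<open>s k\<close> are used for the part of the
  measure on \<open>L k - L (k - 1)\<close>. The sum defining it is arranged by scales: the \<open>k\<close>-th
  term uses the scales between \<open>s (Suc k)\<close> and \<open>s k\<close> and the measure on all of \<open>L k\<close>.\<close>

lemma diffuse_decomposition:
  fixes g :: "'a \<Rightarrow> real"
  assumes \<Omega>: "open \<Omega>" "bounded \<Omega>" and \<delta>: "\<delta> > 0"
    and diffuse: "\<And>A. A \<in> sets borel \<Longrightarrow> A \<subseteq> \<Omega> \<Longrightarrow> cap \<Omega> A = 0 \<Longrightarrow> emeasure \<nu> A = 0"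
    and conc: "emeasure \<nu> (- \<Omega>) = 0"
    and g[measurable]: "g \<in> borel_measurable borel" and g1: "\<And>x. \<bar>g x\<bar> \<le> 1"
  obtains f v where "f \<in> L1_on \<Omega>" "L1_norm \<Omega> f \<le> measure \<nu> UNIV"
    "v \<in> C_0 \<Omega>" "v \<in> H1_0 \<Omega>" "continuous_on UNIV v" "\<And>x. \<bar>v x\<bar> \<le> \<delta> * measure \<nu> UNIV"
    "H1_norm \<Omega> v \<le> sqrt \<delta> * measure \<nu> UNIV"
    "\<And>\<zeta>. \<zeta> \<in> C_0 \<Omega> \<Longrightarrow> \<zeta> \<in> H1_0 \<Omega> \<Longrightarrow> (\<integral>x. g x * (indicator \<Omega> x * \<zeta> x) \<partial>\<nu>)
       = (\<integral>x. f x * \<zeta> x \<partial>lebesgue_on \<Omega>) - (\<integral>x. weak_grad \<Omega> v x \<bullet> weak_grad \<Omega> \<zeta> x \<partial>lebesgue_on \<Omega>)"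
proof -

  \<comment> \<open>Choice of the exhaustion and of the scales\<close>
  let ?\<Lambda> = "measure \<nu> UNIV" and ?m = "measure lebesgue \<Omega>" and ?M = "lebesgue_on \<Omega>"
  have b\<Omega>[measurable]: "\<Omega> \<in> sets borel" using \<Omega> by simp
  have \<Lambda>0: "?\<Lambda> \<ge> 0" and m0: "?m \<ge> 0" by auto
  \<comment> \<open>The square of the \<open>H1\<close> norm will be at most
    \<open>?\<Lambda>\<^sup>2 * (e\<^sup>2 * ?m + 2 * e)\<close>; with \<open>e \<le> 1\<close> this
    is at most \<open>?\<Lambda>\<^sup>2 * (e * (?m + 2))\<close>.\<close>
  define e where "e = min 1 (\<delta> / (?m + 2))"
  have m2: "?m + 2 > 0" using m0 by linarith
  have e: "e > 0" "e \<le> 1" "e * (?m + 2) \<le> \<delta>" "e \<le> \<delta>"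
  proof -
    show "e > 0" "e \<le> 1" using \<delta> m2 by (auto simp: e_def)
    have "e \<le> \<delta> / (?m + 2)" by (simp add: e_def)
    then show 1: "e * (?m + 2) \<le> \<delta>" using m2 by (simp add: pos_le_divide_eq)
    have "e * 1 \<le> e * (?m + 2)" using m0 \<open>e > 0\<close> by (intro mult_left_mono) auto
    with 1 show "e \<le> \<delta>" by simp
  qed
  \<comment> \<open>The ratio is one quarter because gradients are only controlled by square roots
    of these numbers, which then form a series of ratio one half.\<close>
  define ek where "ek k = e * (1 / 4) ^ Suc k" for k
  have ek0: "ek k > 0" for k using e by (simp add: ek_def)
  obtain L where L: "\<And>k. compact (L k)" "\<And>k. L k \<subseteq> \<Omega>" "\<And>k. L k \<subseteq> L (Suc k)"
    "\<And>k. uniformly_small_potential (L k)" "AE y in \<nu>. y \<in> (\<Union>k. L k)"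
    by (rule exists_exhaustion[OF \<Omega>(1) diffuse conc]; (rule that; assumption)?)
  have bL[measurable]: "L k \<in> sets borel" for k by (rule borel_compact[OF L(1)])
  have Lmono: "L j \<subseteq> L k" if "j \<le> k" for j k
    by (rule lift_Suc_mono_le[of L, OF L(3) that])
  have "\<exists>t>0. t \<le> 1 / real (Suc k) \<and> (\<Union>y\<in>L k. cball y t) \<subseteq> \<Omega> \<and> (\<forall>x. potential (L k) t x \<le> ennreal (ek k * ?\<Lambda>))" for k
  proof -
    obtain d where d: "d > 0" "(\<Union>y\<in>L k. cball y d) \<subseteq> \<Omega>"
      by (rule compact_neighbourhood_radius[OF L(1) \<Omega>(1) L(2)])
    obtain r where r: "r > 0" "\<And>x. potential (L k) r x \<le> ennreal (ek k * ?\<Lambda>)"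
    \<comment> \<open>For a zero measure the required bound is zero, whereas uniform smallness only
      provides positive bounds.\<close>
    proof (cases "?\<Lambda> = 0")
      case True
      then have "emeasure \<nu> (L k) = 0"
        using finite_measure_mono[of "L k" UNIV] measure_nonneg[of \<nu> "L k"] by (simp add: emeasure_eq_measure sets_\<nu>)
      then show ?thesis
        using potential_null[OF bL] by (intro that[of 1]) auto
    next
      case False
      then have "ek k * ?\<Lambda> > 0" using ek0 \<Lambda>0 by (simp add: less_le)
      then show ?thesis
        using L(4)[of k] that unfolding uniformly_small_potential_def by blast
    qed
    let ?t = "min d (min r (1 / real (Suc k)))"
    have "potential (L k) ?t x \<le> ennreal (ek k * ?\<Lambda>)" for x
      by (rule order_trans[OF potential_mono r(2)]) (auto simp: bL)
    moreover have "(\<Union>y\<in>L k. cball y ?t) \<subseteq> (\<Union>y\<in>L k. cball y d)"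
      by (intro UN_mono subset_cball) auto
    ultimately show ?thesis
      using d r(1) by (intro exI[of _ ?t]) auto
  qed
  then obtain t where t: "\<And>k. t k > 0" "\<And>k. t k \<le> 1 / real (Suc k)" "\<And>k. (\<Union>y\<in>L k. cball y (t k)) \<subseteq> \<Omega>"
    "\<And>k x. potential (L k) (t k) x \<le> ennreal (ek k * ?\<Lambda>)"
    by metis
  \<comment> \<open>Taking minima over the earlier radii makes the scales decreasing, as the
    interval of scales in the \<open>k\<close>-th kernel requires.\<close>
  define s where "s k = Min (t ` {..k})" for k
  have s0: "s k > 0" for k unfolding s_def using t(1) by (subst Min_gr_iff) auto
  have st: "s k \<le> t k" for k unfolding s_def by (rule Min_le) auto
  have s_Suc: "s (Suc k) \<le> s k" for k unfolding s_def by (rule Min_antimono) auto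
  have s_lim: "s \<longlonglongrightarrow> 0"
    by (rule tendsto_sandwich[OF always_eventually always_eventually tendsto_const LIMSEQ_Suc[OF lim_const_over_n[of 1]]])
      (use s0 order_trans[OF st t(2)] in \<open>auto intro: less_imp_le\<close>)
  have cball: "(\<Union>y\<in>L k. cball y (s k)) \<subseteq> \<Omega>" for k
    using t(3)[of k] subset_cball[OF st[of k]] by blast
  have pot: "potential (L k) (s k) x \<le> ennreal (ek k * ?\<Lambda>)" for k x
    by (rule order_trans[OF potential_mono t(4)]) (auto simp: bL st)
  \<comment> \<open>With this sign the Laplacian of \<open>v\<close> is the given measure minus
    \<open>f\<close>, and not its negative.\<close>
  define c where "c k y = - (indicator (L k) y * g y)" for k y
  have c_le: "\<bar>c k y\<bar> \<le> indicator (L k) y" for k y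
    using g1[of y] by (auto simp: c_def indicator_def)
  have [measurable]: "c k \<in> borel_measurable borel" for k
    unfolding c_def by measurable

  \<comment> \<open>The terms of the series: support, size and energy\<close>
  have int_bounded: "integrable \<nu> h" if "h \<in> borel_measurable borel" "\<And>y. \<bar>h y\<bar> \<le> B" for h :: "'a \<Rightarrow> real" and B
    using that by (intro integrable_const_bound[of _ B]) (auto simp: measurable_cong_sets[OF sets_\<nu> refl])
  have int_le: "\<bar>\<integral>y. h y \<partial>\<nu>\<bar> \<le> B * ?\<Lambda>" if "h \<in> borel_measurable borel" "\<And>y. \<bar>h y\<bar> \<le> B" for h :: "'a \<Rightarrow> real" and B
  proof -
    have "\<bar>\<integral>y. h y \<partial>\<nu>\<bar> \<le> (\<integral>y. \<bar>h y\<bar> \<partial>\<nu>)" by (rule integral_abs_bound)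
    also have "\<dots> \<le> (\<integral>y. B \<partial>\<nu>)"
      using that int_bounded[OF that] by (intro Bochner_Integration.integral_mono integrable_abs) auto
    finally show ?thesis by (simp add: mult.commute)
  qed
  have c_int: "integrable \<nu> (c k)" for k
    by (rule int_bounded[of _ 1]) (use c_le order_trans[OF c_le] in \<open>auto simp: indicator_def\<close>)
  define w where "w k x = (\<integral>y. c k y * potential_kernel (s (Suc k)) (s k) (x - y) \<partial>\<nu>)" for k x
  have w: "w k \<in> Cc_infinity \<Omega>" for k
    unfolding w_def[abs_def]
    by (rule convolution_Cc[OF potential_kernel_Cc[OF s0 s_Suc] c_int sets_\<nu> L(1)[of k] _ _ cball])
      (auto simp: c_def potential_kernel_eq_0[OF s0])
  have w_le: "\<bar>w k x\<bar> \<le> ek k * ?\<Lambda>" for k x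
  proof -
    have "\<bar>w k x\<bar> \<le> (\<integral>y. \<bar>c k y * potential_kernel (s (Suc k)) (s k) (x - y)\<bar> \<partial>\<nu>)"
      unfolding w_def by (rule integral_abs_bound)
    also have "\<dots> \<le> smooth_potential (L k) (s (Suc k)) (s k) x"
      unfolding smooth_potential_def
      by (intro Bochner_Integration.integral_mono integrable_abs
          integrable_convolution_Cc[OF potential_kernel_Cc[OF s0 s_Suc] _ sets_\<nu>] c_int integrable_indicator_\<nu> bL)
        (auto simp: abs_mult potential_kernel_nonneg[OF s0] intro!: mult_right_mono c_le)
    finally have "ennreal \<bar>w k x\<bar> \<le> ennreal (smooth_potential (L k) (s (Suc k)) (s k) x)"
      by (rule ennreal_leI)
    also have "\<dots> \<le> potential (L k) (s k) x"
      by (rule smooth_potential_le[OF bL s0 s_Suc])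
    also have "\<dots> \<le> ennreal (ek k * ?\<Lambda>)"
      by (rule pot)
    finally show ?thesis
      using ek0[of k] \<Lambda>0 by (subst (asm) ennreal_le_iff) auto
  qed
  have pair: "(\<integral>x. Z x \<bullet> grad (w k) x \<partial>?M)
      = (\<integral>y. c k y * mollify (s (Suc k)) (\<lambda>x. indicator \<Omega> x * \<zeta> x) y \<partial>\<nu>)
        - (\<integral>y. c k y * mollify (s k) (\<lambda>x. indicator \<Omega> x * \<zeta> x) y \<partial>\<nu>)"
    if Z: "has_weak_gradient \<Omega> \<zeta> Z" and \<zeta>m: "(\<lambda>x. indicator \<Omega> x * \<zeta> x) \<in> borel_measurable borel"
      and B: "\<And>x. \<bar>indicator \<Omega> x * \<zeta> x\<bar> \<le> B" for k \<zeta> Z B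
  proof -
    have "(\<integral>x. Z x \<bullet> grad (w k) x \<partial>?M) = - (\<integral>x. \<zeta> x * laplacian (w k) x \<partial>?M)"
      by (rule weak_gradient_laplacian[OF b\<Omega> Z w])
    also have "(\<integral>x. \<zeta> x * laplacian (w k) x \<partial>?M) = (\<integral>x. (indicator \<Omega> x * \<zeta> x) * laplacian (w k) x \<partial>?M)"
      by (rule Bochner_Integration.integral_cong) auto
    also have "\<dots> = (\<integral>x. (indicator \<Omega> x * \<zeta> x) * laplacian (w k) x \<partial>lborel)"
      by (rule lebesgue_on_integral_eq[OF b\<Omega> borel_measurable_times[OF \<zeta>m borel_measurable_continuous_onI[OF laplacian_continuous[OF w]]]])
        simp
    also have "\<dots> = (\<integral>y. c k y * mollify (s k) (\<lambda>x. indicator \<Omega> x * \<zeta> x) y \<partial>\<nu>)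
        - (\<integral>y. c k y * mollify (s (Suc k)) (\<lambda>x. indicator \<Omega> x * \<zeta> x) y \<partial>\<nu>)"
      unfolding w_def[abs_def] by (rule integral_mult_laplacian_convolution[OF c_int s0 s_Suc \<zeta>m B])
    finally show ?thesis by simp
  qed
  have mollify_borel: "mollify r \<zeta> \<in> borel_measurable borel" if [measurable]: "\<zeta> \<in> borel_measurable borel" for r and \<zeta> :: "'a \<Rightarrow> real"
    unfolding mollify_def[abs_def] mollifier_def by measurable
  \<comment> \<open>\<open>w k\<close> is paired with itself. Each of the two resulting integrals is
    at most the sup norm \<open>ek k * ?\<Lambda>\<close> times the mass, since
    \<open>\<bar>c k y\<bar>\<close> is at most 1 and mollifying does not increase the sup
    norm.\<close>
  have energy: "(\<integral>x. (norm (grad (w k) x))\<^sup>2 \<partial>?M) \<le> (?\<Lambda> * (sqrt (2 * e) * (1 / 2) ^ Suc k))\<^sup>2" for k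
  proof -
    have ind: "(\<lambda>x. indicator \<Omega> x * w k x) = w k"
      using Cc_infinity_outside[OF w] by (force simp: indicator_def)
    have wl: "\<bar>indicator \<Omega> x * w k x\<bar> \<le> ek k * ?\<Lambda>" for x
      unfolding fun_cong[OF ind, of x] by (rule w_le)
    have wm: "w k \<in> borel_measurable borel" by (rule Cc_infinity_borel[OF w])
    have "(\<integral>x. (norm (grad (w k) x))\<^sup>2 \<partial>?M)
        = (\<integral>y. c k y * mollify (s (Suc k)) (w k) y \<partial>\<nu>) - (\<integral>y. c k y * mollify (s k) (w k) y \<partial>\<nu>)"
      using pair[OF has_weak_gradient_Cc[OF b\<Omega> w], of k "ek k * ?\<Lambda>" k, OF _ wl] wm
      unfolding ind power2_norm_eq_inner by blast
    moreover have "\<bar>\<integral>y. c k y * mollify (s j) (w k) y \<partial>\<nu>\<bar> \<le> ek k * ?\<Lambda> * ?\<Lambda>" for j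
    proof (rule int_le)
      show "(\<lambda>y. c k y * mollify (s j) (w k) y) \<in> borel_measurable borel"
        using mollify_borel[OF wm] by measurable
      fix y
      have "\<bar>c k y\<bar> \<le> 1" using order_trans[OF c_le] by (simp add: indicator_def)
      then have "\<bar>c k y\<bar> * \<bar>mollify (s j) (w k) y\<bar> \<le> 1 * (ek k * ?\<Lambda>)"
        by (intro mult_mono mollify_bound[OF wm w_le s0]) auto
      then show "\<bar>c k y * mollify (s j) (w k) y\<bar> \<le> ek k * ?\<Lambda>" by (simp add: abs_mult)
    qed
    from this[of "Suc k"] this[of k] have "(\<integral>y. c k y * mollify (s (Suc k)) (w k) y \<partial>\<nu>)
        - (\<integral>y. c k y * mollify (s k) (w k) y \<partial>\<nu>) \<le> 2 * (ek k * ?\<Lambda> * ?\<Lambda>)"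
      by linarith
    moreover have "2 * (ek k * ?\<Lambda> * ?\<Lambda>) = (?\<Lambda> * (sqrt (2 * e) * (1 / 2) ^ Suc k))\<^sup>2"
    proof -
      have "(?\<Lambda> * (sqrt (2 * e) * (1 / 2) ^ Suc k))\<^sup>2 = ?\<Lambda>\<^sup>2 * ((sqrt (2 * e))\<^sup>2 * ((1 / 2) ^ Suc k)\<^sup>2)"
        by (simp only: power_mult_distrib)
      also have "((1 / 2 :: real) ^ Suc k)\<^sup>2 = (1 / 4) ^ Suc k"
        by (simp add: power_mult_distrib[symmetric] power2_eq_square)
      also have "(sqrt (2 * e))\<^sup>2 = 2 * e"
        using e(1) by simp
      finally have eq: "(?\<Lambda> * (sqrt (2 * e) * (1 / 2) ^ Suc k))\<^sup>2 = ?\<Lambda>\<^sup>2 * (2 * e * (1 / 4) ^ Suc k)" .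
      show ?thesis
        unfolding eq by (simp add: ek_def power2_eq_square mult_ac del: power_Suc)
    qed
    ultimately show ?thesis by simp
  qed
  \<comment> \<open>Weaker than the bound by \<open>ek k\<close>, so that the sum is exactly
    \<open>?\<Lambda> * e\<close>.\<close>
  define a where "a k = ?\<Lambda> * e * (1 / 2) ^ Suc k" for k
  define b where "b k = sqrt (2 * e) * (1 / 2) ^ Suc k" for k
  have w_a: "\<bar>w k x\<bar> \<le> a k" for k x
  proof -
    have "(1 / 4 :: real) ^ Suc k \<le> (1 / 2) ^ Suc k" by (rule power_mono) auto
    then have "ek k * ?\<Lambda> \<le> a k"
      using mult_left_mono[of "(1 / 4) ^ Suc k" "(1 / 2) ^ Suc k" "?\<Lambda> * e"] \<Lambda>0 e(1)
      by (simp add: a_def ek_def mult_ac)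
    with w_le[of k x] show ?thesis by linarith
  qed
  have a_sums: "a sums (?\<Lambda> * e)"
    using sums_mult[OF power_half_series, of "?\<Lambda> * e"] unfolding a_def[abs_def] by simp
  have b_sums: "b sums sqrt (2 * e)"
    using sums_mult[OF power_half_series, of "sqrt (2 * e)"] unfolding b_def[abs_def] by simp
  have b0: "b k > 0" for k using e(1) by (simp add: b_def)
  define v where "v x = (\<Sum>k. w k x)" for x
  define G where "G x = (\<Sum>k. grad (w k) x)" for x
  note H = H1_0_series[OF \<Omega> w w_a sums_summable[OF a_sums] energy[folded b_def] b0 sums_summable[OF b_sums],
      folded v_def[abs_def] G_def[abs_def] sums_unique[OF a_sums] sums_unique[OF b_sums]]
  have H1v: "H1_norm \<Omega> v \<le> sqrt \<delta> * ?\<Lambda>"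
  proof -
    have "e\<^sup>2 * ?m + 2 * e \<le> e * ?m + 2 * e"
      using e m0 by (intro add_right_mono mult_right_mono) (auto simp: power2_eq_square mult_left_le)
    also have "\<dots> = e * (?m + 2)" by (simp add: algebra_simps)
    finally have le: "e\<^sup>2 * ?m + 2 * e \<le> \<delta>" using e(3) by linarith
    have "H1_norm \<Omega> v \<le> sqrt ((?\<Lambda> * e)\<^sup>2 * ?m + ?\<Lambda>\<^sup>2 * (sqrt (2 * e))\<^sup>2)"
      by (rule H(6))
    also have "(?\<Lambda> * e)\<^sup>2 * ?m + ?\<Lambda>\<^sup>2 * (sqrt (2 * e))\<^sup>2 = ?\<Lambda>\<^sup>2 * (e\<^sup>2 * ?m + 2 * e)"
      using e(1) by (simp add: power_mult_distrib algebra_simps)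
    also have "sqrt \<dots> \<le> sqrt (?\<Lambda>\<^sup>2 * \<delta>)"
      using le by (intro real_sqrt_le_mono mult_left_mono) auto
    also have "\<dots> = sqrt \<delta> * ?\<Lambda>"
      by (simp add: real_sqrt_mult)
    finally show ?thesis .
  qed
  have v_le: "\<bar>v x\<bar> \<le> \<delta> * ?\<Lambda>" for x
    using H(3)[of x] mult_left_mono[OF e(4) \<Lambda>0] by (simp add: v_def mult.commute)
  \<comment> \<open>The first stage of the exhaustion that contains \<open>y\<close>. Off the union
    of the \<open>L k\<close> the value is arbitrary, which concerns a null set only; the scale
    \<open>s (j y)\<close> is positive even there.\<close>
  define j where "j y = (LEAST k. y \<in> L k)" for y
  have sj[measurable]: "(\<lambda>y. s (j y)) \<in> borel_measurable borel"
  proof -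
    have "j \<in> measurable borel (count_space UNIV)"
      unfolding j_def[abs_def] by measurable
    then show ?thesis
      by (rule measurable_compose) simp
  qed

  \<comment> \<open>The density \<open>f\<close>, mollified at the scale
    \<open>s (j y)\<close>\<close>
  have g_int: "integrable \<nu> g" by (rule int_bounded[OF g g1])
  define f where "f x = (\<integral>y. g y * mollifier (s (j y)) (x - y) \<partial>\<nu>)" for x
  note F = mollification_Fubini[OF g_int sj s0, folded f_def[abs_def] f_def]
  have fL1: "f \<in> L1_on \<Omega>" "L1_norm \<Omega> f \<le> ?\<Lambda>"
  proof -
    show "f \<in> L1_on \<Omega>" by (rule lborel_integrable_L1_on(1)[OF F(2) b\<Omega>])
    have "L1_norm \<Omega> f \<le> (\<integral>y. \<bar>g y\<bar> \<partial>\<nu>)"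
      by (rule order_trans[OF lborel_integrable_L1_on(2)[OF F(2) b\<Omega>] F(3)])
    also have "\<dots> \<le> (\<integral>y. 1 \<partial>\<nu>)"
      using g1 by (intro Bochner_Integration.integral_mono integrable_abs g_int) auto
    finally show "L1_norm \<Omega> f \<le> ?\<Lambda>" by simp
  qed

  \<comment> \<open>Testing the series against \<zeta> and passing to the limit\<close>
  have rep: "(\<integral>x. g x * (indicator \<Omega> x * \<zeta> x) \<partial>\<nu>)
      = (\<integral>x. f x * \<zeta> x \<partial>?M) - (\<integral>x. weak_grad \<Omega> v x \<bullet> weak_grad \<Omega> \<zeta> x \<partial>?M)"
    if \<zeta>: "\<zeta> \<in> C_0 \<Omega>" "\<zeta> \<in> H1_0 \<Omega>" for \<zeta>
  proof -
    define \<xi> where "\<xi> x = indicator \<Omega> x * \<zeta> x" for x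
    obtain B where B: "B \<ge> 0" "\<And>x. \<bar>\<xi> x\<bar> \<le> B" and \<xi>m[measurable]: "\<xi> \<in> borel_measurable borel"
      and \<xi>c: "\<And>y. y \<in> \<Omega> \<Longrightarrow> isCont \<xi> y"
      using C_0_times_indicator[OF \<Omega> \<zeta>(1)] unfolding \<xi>_def[abs_def] by metis
    obtain Z where Z: "has_weak_gradient \<Omega> \<zeta> Z" "Z \<in> L2_on \<Omega>"
      using \<zeta>(2) by (auto simp: H1_0_def H1_def)
    let ?m = "\<lambda>k y. mollify (s k) \<xi> y"
    let ?T = "\<lambda>n y. \<Sum>k<n. indicator (L k) y * (?m k y - ?m (Suc k) y)"
    have mb: "\<bar>?m k y\<bar> \<le> B" for k y
      by (rule mollify_bound[OF \<xi>m B(2) s0])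
    have mm[measurable]: "?m k \<in> borel_measurable borel" for k
      by (rule mollify_borel[OF \<xi>m])
    have cm_int: "integrable \<nu> (\<lambda>y. c k y * ?m i y)" for k i
    proof (rule int_bounded[of _ B])
      have "\<bar>c k y\<bar> \<le> 1" for y using order_trans[OF c_le] by (simp add: indicator_def)
      then have "\<bar>c k y\<bar> * \<bar>?m i y\<bar> \<le> 1 * B" for y
        by (intro mult_mono mb) auto
      then show "\<bar>c k y * ?m i y\<bar> \<le> B" for y by (simp add: abs_mult)
    qed measurable
    have S: "(\<integral>x. Z x \<bullet> grad (\<lambda>x. \<Sum>k<n. w k x) x \<partial>?M) = (\<integral>y. g y * ?T n y \<partial>\<nu>)" for n
    proof -
      have "integrable ?M (\<lambda>x. Z x \<bullet> grad (w k) x)" for k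
      proof (rule integrable_inner_L2(1))
        show "grad (w k) \<in> borel_measurable ?M"
          using grad_borel[OF w] by (intro measurable_restrict_space1 measurable_completion) simp
        obtain C where C: "\<And>x. norm (grad (w k) x) \<le> C" using w[of k] by (rule grad_bounded) blast
        have "(\<lambda>x. norm (grad (w k) x)) \<in> L2_on \<Omega>"
          by (rule L2_on_bounded(1)[OF \<Omega>, of _ C])
            (use C \<open>grad (w k) \<in> borel_measurable ?M\<close> in auto)
        then show "integrable ?M (\<lambda>x. (norm (grad (w k) x))\<^sup>2)" by (simp add: L2_on_def)
      qed (use Z(2) in \<open>auto simp: L2_on_def\<close>)
      then have "(\<integral>x. Z x \<bullet> grad (\<lambda>x. \<Sum>k<n. w k x) x \<partial>?M) = (\<Sum>k<n. \<integral>x. Z x \<bullet> grad (w k) x \<partial>?M)"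
        unfolding Cc_infinity_sum(2)[of w, OF w] inner_sum_right by (intro Bochner_Integration.integral_sum)
      also have "\<dots> = (\<Sum>k<n. \<integral>y. c k y * ?m (Suc k) y - c k y * ?m k y \<partial>\<nu>)"
      proof (rule sum.cong[OF refl])
        fix k
        show "(\<integral>x. Z x \<bullet> grad (w k) x \<partial>?M) = (\<integral>y. c k y * ?m (Suc k) y - c k y * ?m k y \<partial>\<nu>)"
          using pair[OF Z(1), of B k] \<xi>m B(2) cm_int unfolding \<xi>_def[abs_def]
          by (subst Bochner_Integration.integral_diff) auto
      qed
      also have "\<dots> = (\<integral>y. (\<Sum>k<n. c k y * ?m (Suc k) y - c k y * ?m k y) \<partial>\<nu>)"
        by (rule Bochner_Integration.integral_sum[symmetric]) (intro Bochner_Integration.integrable_diff cm_int)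
      also have "\<dots> = (\<integral>y. g y * ?T n y \<partial>\<nu>)"
        by (intro Bochner_Integration.integral_cong refl) (simp add: c_def sum_distrib_left algebra_simps)
      finally show ?thesis .
    qed
    have jL: "y \<in> L k \<longleftrightarrow> j y \<le> k" if "y \<in> (\<Union>k. L k)" for y k
    proof
      show "j y \<le> k" if "y \<in> L k" unfolding j_def using that by (rule Least_le)
      have "y \<in> L (j y)" unfolding j_def using that by (auto intro: LeastI)
      then show "y \<in> L k" if "j y \<le> k" using Lmono[OF that] by blast
    qed
    \<comment> \<open>The indicators remove the terms with index below \<open>j y\<close>, and the
      others telescope; for \<open>n = j y\<close> the sum is empty and the difference vanishes as
      well.\<close>
    have T_eq: "?T n y = (if j y \<le> n then ?m (j y) y - ?m n y else 0)" if y: "y \<in> (\<Union>k. L k)" for n y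
      by (induction n) (auto simp: jL[OF y] indicator_def not_le less_Suc_eq_le le_Suc_eq)
    have "(\<lambda>n. \<integral>y. g y * ?T n y \<partial>\<nu>) \<longlonglongrightarrow> (\<integral>y. g y * (?m (j y) y - \<xi> y) \<partial>\<nu>)"
    proof (rule integral_dominated_convergence[of _ _ _ "\<lambda>_. 2 * B"])
      have "(\<lambda>y. ?m (j y) y) \<in> borel_measurable borel"
        unfolding mollify_def[abs_def] mollifier_def by measurable
      then show "(\<lambda>y. g y * (?m (j y) y - \<xi> y)) \<in> borel_measurable \<nu>"
        by measurable
      show "(\<lambda>y. g y * ?T n y) \<in> borel_measurable \<nu>" for n by measurable
      show "AE y in \<nu>. (\<lambda>n. g y * ?T n y) \<longlonglongrightarrow> g y * (?m (j y) y - \<xi> y)"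
        using L(5)
      proof eventually_elim
        case (elim y)
        then have "y \<in> \<Omega>" using L(2) by blast
        then have "(\<lambda>n. ?m n y) \<longlonglongrightarrow> \<xi> y"
          by (intro mollify_tendsto[OF \<xi>m B(2) \<xi>c s0 s_lim])
        then have "(\<lambda>n. ?m (j y) y - ?m n y) \<longlonglongrightarrow> ?m (j y) y - \<xi> y"
          by (intro tendsto_intros)
        moreover have "\<forall>\<^sub>F n in sequentially. ?m (j y) y - ?m n y = ?T n y"
          using T_eq[OF elim] by (intro eventually_sequentiallyI[of "j y"]) simp
        ultimately show ?case
          by (intro tendsto_mult_left) (rule Lim_transform_eventually)
      qed
      show "AE y in \<nu>. norm (g y * ?T n y) \<le> 2 * B" for n
        using L(5)
      proof eventually_elim
        case (elim y)
        have "\<bar>?T n y\<bar> \<le> 2 * B"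
          unfolding T_eq[OF elim] using mb[of "j y" y] mb[of n y] B(1) by auto
        then have "\<bar>g y\<bar> * \<bar>?T n y\<bar> \<le> 1 * (2 * B)"
          by (intro mult_mono g1) auto
        then show ?case by (simp add: abs_mult)
      qed
    qed simp
    \<comment> \<open>Both limits describe the same pairings: the fine end of the telescoping sum
      recovers \<xi>, hence the measure, and the end at stage \<open>j y\<close> becomes the
      integral against \<open>f\<close>.\<close>
    with H(7)[OF Z(2)] have "(\<integral>x. Z x \<bullet> G x \<partial>?M) = (\<integral>y. g y * (?m (j y) y - \<xi> y) \<partial>\<nu>)"
      unfolding S G_def by (rule LIMSEQ_unique)
    also have "\<dots> = (\<integral>y. g y * ?m (j y) y \<partial>\<nu>) - (\<integral>y. g y * \<xi> y \<partial>\<nu>)"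
    proof -
      have mj: "(\<lambda>y. ?m (j y) y) \<in> borel_measurable borel"
        unfolding mollify_def[abs_def] mollifier_def by measurable
      have 1: "integrable \<nu> (\<lambda>y. g y * ?m (j y) y)"
      proof (rule int_bounded[of _ B])
        show "(\<lambda>y. g y * ?m (j y) y) \<in> borel_measurable borel"
          by (rule borel_measurable_times[OF g mj])
        have "\<bar>g y\<bar> * \<bar>?m (j y) y\<bar> \<le> 1 * B" for y by (intro mult_mono g1 mb) auto
        then show "\<bar>g y * ?m (j y) y\<bar> \<le> B" for y by (simp add: abs_mult)
      qed
      have 2: "integrable \<nu> (\<lambda>y. g y * \<xi> y)"
      proof (intro int_bounded[of _ B])
        have "\<bar>g y\<bar> * \<bar>\<xi> y\<bar> \<le> 1 * B" for y by (intro mult_mono g1 B) auto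
        then show "\<bar>g y * \<xi> y\<bar> \<le> B" for y by (simp add: abs_mult)
      qed measurable
      show ?thesis
        unfolding right_diff_distrib by (rule Bochner_Integration.integral_diff[OF 1 2])
    qed
    also have "(\<integral>y. g y * ?m (j y) y \<partial>\<nu>) = (\<integral>x. \<xi> x * f x \<partial>lborel)"
      by (rule F(4)[OF \<xi>m B(2), symmetric])
    also have "\<dots> = (\<integral>x. \<xi> x * f x \<partial>?M)"
      by (rule lebesgue_on_integral_eq(1)[OF b\<Omega> borel_measurable_times[OF \<xi>m F(1)], symmetric]) (simp add: \<xi>_def)
    also have "\<dots> = (\<integral>x. f x * \<zeta> x \<partial>?M)"
      by (rule Bochner_Integration.integral_cong) (auto simp: \<xi>_def)
    finally have "(\<integral>x. Z x \<bullet> G x \<partial>?M) = (\<integral>x. f x * \<zeta> x \<partial>?M) - (\<integral>y. g y * \<xi> y \<partial>\<nu>)" .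
    moreover have "(\<integral>x. weak_grad \<Omega> v x \<bullet> weak_grad \<Omega> \<zeta> x \<partial>?M) = (\<integral>x. Z x \<bullet> G x \<partial>?M)"
      unfolding integral_weak_grad_inner_eq[OF \<Omega>(1) H(5) Z(1)] by (simp add: inner_commute)
    ultimately show ?thesis by (simp add: \<xi>_def)
  qed
  show ?thesis
    by (rule that[OF fL1 H(1,2,4) v_le H1v rep])
qed

end

theorem theorem3:
  fixes \<Omega> :: "'a::euclidean_space set" and \<mu> :: "'a set \<Rightarrow> real"
  assumes "smooth_bounded_domain \<Omega>"
    and "\<mu> \<in> signed_measures \<Omega>"
    and "diffuse \<Omega> \<mu>"
  shows "(\<exists>f \<in> L1_on \<Omega>. \<exists>v \<in> C_0 \<Omega> \<inter> H1_0 \<Omega>. represents \<Omega> \<mu> f v)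
    \<and> (\<forall>\<delta>>0. \<exists>f \<in> L1_on \<Omega>. \<exists>v \<in> C_0 \<Omega> \<inter> H1_0 \<Omega>. represents \<Omega> \<mu> f v
         \<and> L1_norm \<Omega> f \<le> TV_norm \<Omega> \<mu>
         \<and> Linfty_norm \<Omega> v \<le> ereal (\<delta> * TV_norm \<Omega> \<mu>)
         \<and> H1_norm \<Omega> v \<le> sqrt \<delta> * TV_norm \<Omega> \<mu>)"
proof -
  have \<Omega>: "open \<Omega>" "bounded \<Omega>"
    using assms(1) by (auto simp: smooth_bounded_domain_def)
  obtain \<nu> g where \<nu>: "sets \<nu> = sets borel" "finite_measure \<nu>" "emeasure \<nu> (- \<Omega>) = 0" "measure \<nu> UNIV = TV_norm \<Omega> \<mu>"
    "\<And>A. A \<in> sets borel \<Longrightarrow> A \<subseteq> \<Omega> \<Longrightarrow> emeasure \<nu> A = emeasure (total_variation (borel_on \<Omega>) \<mu>) A"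
    and g: "g \<in> borel_measurable borel" "\<And>x. \<bar>g x\<bar> \<le> 1"
    and rep: "\<And>\<zeta>. integrable \<nu> (\<lambda>x. indicator \<Omega> x * \<zeta> x) \<Longrightarrow> \<zeta> \<in> borel_measurable (borel_on \<Omega>) \<Longrightarrow>
       signed_integral (borel_on \<Omega>) \<mu> \<zeta> = (\<integral>x. g x * (indicator \<Omega> x * \<zeta> x) \<partial>\<nu>)"
    by (rule signed_measure_representation[OF \<Omega>(1) assms(2)]) blast
  interpret finite_borel_measure \<nu>
    using \<nu>(1,2) by (intro finite_borel_measure.intro finite_borel_measure_axioms.intro)
  have diffuse: "emeasure \<nu> A = 0" if "A \<in> sets borel" "A \<subseteq> \<Omega>" "cap \<Omega> A = 0" for A
    using assms(3) that by (simp add: diffuse_def \<nu>(5))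
  have main: "\<exists>f \<in> L1_on \<Omega>. \<exists>v \<in> C_0 \<Omega> \<inter> H1_0 \<Omega>. represents \<Omega> \<mu> f v
         \<and> L1_norm \<Omega> f \<le> TV_norm \<Omega> \<mu>
         \<and> Linfty_norm \<Omega> v \<le> ereal (\<delta> * TV_norm \<Omega> \<mu>)
         \<and> H1_norm \<Omega> v \<le> sqrt \<delta> * TV_norm \<Omega> \<mu>" if \<delta>: "\<delta> > 0" for \<delta>
  proof -
    obtain f v where f: "f \<in> L1_on \<Omega>" "L1_norm \<Omega> f \<le> measure \<nu> UNIV"
      and v: "v \<in> C_0 \<Omega>" "v \<in> H1_0 \<Omega>" "continuous_on UNIV v" "\<And>x. \<bar>v x\<bar> \<le> \<delta> * measure \<nu> UNIV"
        "H1_norm \<Omega> v \<le> sqrt \<delta> * measure \<nu> UNIV"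
      and fv: "\<And>\<zeta>. \<zeta> \<in> C_0 \<Omega> \<Longrightarrow> \<zeta> \<in> H1_0 \<Omega> \<Longrightarrow> (\<integral>x. g x * (indicator \<Omega> x * \<zeta> x) \<partial>\<nu>)
       = (\<integral>x. f x * \<zeta> x \<partial>lebesgue_on \<Omega>) - (\<integral>x. weak_grad \<Omega> v x \<bullet> weak_grad \<Omega> \<zeta> x \<partial>lebesgue_on \<Omega>)"
      by (rule diffuse_decomposition[OF \<Omega> \<delta> diffuse \<nu>(3) g]; (rule that; assumption)?)
    have "represents \<Omega> \<mu> f v"
      unfolding represents_def
    proof safe
      fix \<zeta> assume \<zeta>: "\<zeta> \<in> C_0 \<Omega>" "\<zeta> \<in> H1_0 \<Omega>"
      obtain B where B: "\<And>x. \<bar>indicator \<Omega> x * \<zeta> x\<bar> \<le> B" "(\<lambda>x. indicator \<Omega> x * \<zeta> x) \<in> borel_measurable borel"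
        using C_0_times_indicator[OF \<Omega> \<zeta>(1)] by metis
      have "integrable \<nu> (\<lambda>x. indicator \<Omega> x * \<zeta> x)"
        using B by (intro integrable_const_bound[of _ B]) (auto simp: measurable_cong_sets[OF \<nu>(1) refl])
      moreover have "\<zeta> \<in> borel_measurable (borel_on \<Omega>)"
        using B(2) \<Omega>(1) by (simp add: borel_measurable_restrict_space_iff)
      ultimately show "signed_integral (borel_on \<Omega>) \<mu> \<zeta>
          = (\<integral>x. f x * \<zeta> x \<partial>lebesgue_on \<Omega>) - (\<integral>x. weak_grad \<Omega> v x \<bullet> weak_grad \<Omega> \<zeta> x \<partial>lebesgue_on \<Omega>)"
        using rep fv[OF \<zeta>] by simp
    qed
    moreover have "Linfty_norm \<Omega> v \<le> ereal (\<delta> * TV_norm \<Omega> \<mu>)"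
      unfolding Linfty_norm_def
    proof (rule esssup_I)
      have "v \<in> borel_measurable (lebesgue_on \<Omega>)"
        using borel_measurable_continuous_onI[OF v(3)]
        by (intro measurable_restrict_space1 measurable_completion) simp
      then show "(\<lambda>x. ereal \<bar>v x\<bar>) \<in> borel_measurable (lebesgue_on \<Omega>)"
        by measurable
    qed (use v(4) \<nu>(4) in simp)
    ultimately show ?thesis
      using f v \<nu>(4) by auto
  qed
  moreover from main[of 1] have "\<exists>f \<in> L1_on \<Omega>. \<exists>v \<in> C_0 \<Omega> \<inter> H1_0 \<Omega>. represents \<Omega> \<mu> f v"
    by auto
  ultimately show ?thesis by blast
qed

end
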